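(* Let $u_0\in H$, fix $T>0$, and let $f(t)=f(\cdot,t)$ be an entire function with respect to the spatial variable $x$, with $\int_0^T |e^{(n-1)\sigma A^{1/2}}f(s)|^2\,ds<\infty$ for every $n=0,1,2,\ldots$. Let $u(t)$ be the solution on $[0,T]$ of $$\frac{du}{dt}+\mu e^{2\sigma A^{1/2}}u+B(u,u)=f,\qquad u(0)=u_0 .$$ Then for every $n=0,1,2,\ldots$ there exist constants $C_n,\bar C_n,K_n,\bar K_n$, which depend on $|u_0|,\mu,T,\sigma$ and on the quantity $\int_0^T |e^{(n-1)\sigma A^{1/2}}f(s)|^2\,ds$, and there exist integers $p_n,q_n\ge 1$, such that $$|e^{n\sigma A^{1/2}}u(t)|^2\le \frac{K_n}{t^{p_n}}+C_n\quad\text{for all } t\in(0,T],$$ and $$\int_t^T |e^{(n+1)\sigma A^{1/2}}u(s)|^2\,ds\le \frac{\bar K_n}{t^{q_n}}+\bar C_n\quad\text{for all } t\in(0,T].$$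
   Context: Let $\Omega=[0,2\pi]^3$ with periodic boundary conditions, and let $\mu>0$, $\sigma>0$ be fixed. For a space-periodic function or vector field $g$, $|g|=\left(\int_\Omega |g(x)|^2dx\right)^{1/2}$ is the $L^2$ norm. $H=\{\varphi\in (L^2(\Omega))^3:\ \varphi \text{ periodic},\ \int_\Omega\varphi\,dx=0,\ \nabla\cdot\varphi=0\}$. $A=-\nabla^2$; for real $\lambda$, $e^{\lambda A^{1/2}}$ is the operator with Fourier symbol $e^{\lambda|k|}$, $k\in\mathbb Z^3\setminus\{0\}$. $B(u,u)=P\big((u\cdot\nabla)u\big)$, where $P$ is the Leray ($L^2$-orthogonal) projector onto mean-zero divergence-free periodic fields; thus the equation is the abstract form of the 3D periodic incompressible Navier–Stokes equations $\partial_t u+u\cdot\nabla u=-\nabla p-\mu\mathcal D u+f$, $\nabla\cdot u=0$, where $\mathcal D$ has Fourier symbol $e^{2\sigma|k|}$. The forcing $f(\cdot,t)$ is a $2\pi$-periodic, mean-zero, divergence-free vector field. "Solution" means the weak solution with $u\in C([0,T];H)$ and $e^{\sigma A^{1/2}}u\in L^2(0,T;H)$, obtained e.g. as the limit of Galerkin approximations. "Entire with respect to the spatial variable" means that the function of $x\in\mathbb R^3$ extends to a holomorphic function on $\mathbb C^3$. *)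

theory Defs
  imports "HOL-Analysis.Analysis"
begin

section \<open>Square-integrable periodic fields\<close>

text \<open>Fields are functions on the whole space that are \<open>2\<pi>\<close>-periodic in each coordinate.  Elements
  of \<open>L\<^sup>2\<close> are represented by functions, not by classes modulo null sets.\<close>

definition Omega :: "(real^3) set" where
  "Omega = cbox 0 (\<chi> i. 2 * pi)"

definition periodic :: "(real^3 \<Rightarrow> 'b) \<Rightarrow> bool" where
  "periodic g \<longleftrightarrow> (\<forall>x i. g (x + axis i (2 * pi)) = g x)"

definition L2per :: "(real^3 \<Rightarrow> 'b::euclidean_space) set" where
  "L2per = {g. g \<in> borel_measurable lebesgue \<and> periodic g \<and>
               set_integrable lebesgue Omega (\<lambda>x. (norm (g x))\<^sup>2)}"

definition L2norm :: "(real^3 \<Rightarrow> 'b::euclidean_space) \<Rightarrow> real" where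
  "L2norm g = sqrt (LINT x:Omega|lebesgue. (norm (g x))\<^sup>2)"

definition L2inner :: "(real^3 \<Rightarrow> 'b::euclidean_space) \<Rightarrow> (real^3 \<Rightarrow> 'b) \<Rightarrow> real" where
  "L2inner g h = (LINT x:Omega|lebesgue. g x \<bullet> h x)"

text \<open>Periodic \<open>C\<^sup>1\<close> scalar test functions, paired with their gradient.  For fields in \<open>L\<^sup>2\<close> they give the
  same weak derivatives as smooth periodic test functions.\<close>

definition test_fun :: "(real^3 \<Rightarrow> real) \<Rightarrow> (real^3 \<Rightarrow> real^3) \<Rightarrow> bool" where
  "test_fun \<psi> d\<psi> \<longleftrightarrow> periodic \<psi> \<and> continuous_on UNIV d\<psi> \<and>
     (\<forall>x. (\<psi> has_derivative (\<lambda>h. d\<psi> x \<bullet> h)) (at x))"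

definition div_free :: "(real^3 \<Rightarrow> real^3) \<Rightarrow> bool" where
  "div_free \<phi> \<longleftrightarrow> (\<forall>\<psi> d\<psi>. test_fun \<psi> d\<psi> \<longrightarrow> L2inner \<phi> d\<psi> = 0)"

definition H_space :: "(real^3 \<Rightarrow> real^3) set" where
  "H_space = {\<phi> \<in> L2per. (LINT x:Omega|lebesgue. \<phi> x) = 0 \<and> div_free \<phi>}"


section \<open>The operators of the equation\<close>

definition real_vec :: "int^3 \<Rightarrow> real^3" where
  "real_vec k = (\<chi> i. real_of_int (k $ i))"

definition fourier_coeff :: "(real^3 \<Rightarrow> real^3) \<Rightarrow> int^3 \<Rightarrow> complex^3" where
  "fourier_coeff g k =
     (\<chi> i. (LINT x:Omega|lebesgue. complex_of_real (g x $ i) * exp (- \<i> * complex_of_real (real_vec k \<bullet> x)))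
           / complex_of_real ((2 * pi) ^ 3))"

text \<open>\<open>is_expA l g h\<close> says that \<open>h = e\<^bsup>l A^(1/2)\<^esup> g\<close>.  Both fields have mean zero, so the mode
  \<open>k = 0\<close> plays no role.\<close>

definition is_expA :: "real \<Rightarrow> (real^3 \<Rightarrow> real^3) \<Rightarrow> (real^3 \<Rightarrow> real^3) \<Rightarrow> bool" where
  "is_expA l g h \<longleftrightarrow> g \<in> H_space \<and> h \<in> H_space \<and>
     (\<forall>k. k \<noteq> 0 \<longrightarrow>
        fourier_coeff h k = complex_of_real (exp (l * norm (real_vec k))) *s fourier_coeff g k)"

definition dom_expA :: "real \<Rightarrow> (real^3 \<Rightarrow> real^3) set" where
  "dom_expA l = {g. \<exists>h. is_expA l g h}"

text \<open>The value is determined up to a null set for \<open>g \<in> dom_expA l\<close> and is meaningless otherwise, so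
  membership in the domain is always stated alongside.\<close>

definition expA :: "real \<Rightarrow> (real^3 \<Rightarrow> real^3) \<Rightarrow> (real^3 \<Rightarrow> real^3)" where
  "expA l g = (SOME h. is_expA l g h)"

text \<open>\<open>G x $ i $ j\<close> is the weak partial derivative of the component \<open>w\<^sub>i\<close> in direction \<open>j\<close>.\<close>

definition is_weak_grad :: "(real^3 \<Rightarrow> real^3) \<Rightarrow> (real^3 \<Rightarrow> real^3^3) \<Rightarrow> bool" where
  "is_weak_grad w G \<longleftrightarrow> G \<in> L2per \<and>
     (\<forall>\<psi> d\<psi> i j. test_fun \<psi> d\<psi> \<longrightarrow>
        (LINT x:Omega|lebesgue. G x $ i $ j * \<psi> x) = - (LINT x:Omega|lebesgue. w x $ i * d\<psi> x $ j))"

text \<open>\<open>advect u w = (u \<cdot> \<nabla>) w\<close>\<close>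

definition advect :: "(real^3 \<Rightarrow> real^3) \<Rightarrow> (real^3 \<Rightarrow> real^3) \<Rightarrow> (real^3 \<Rightarrow> real^3)" where
  "advect u w = (\<lambda>x. (SOME G. is_weak_grad w G) x *v u x)"

definition leray :: "(real^3 \<Rightarrow> real^3) \<Rightarrow> (real^3 \<Rightarrow> real^3)" where
  "leray w = (SOME h. h \<in> H_space \<and> (\<forall>v\<in>H_space. L2inner (\<lambda>x. w x - h x) v = 0))"

definition B :: "(real^3 \<Rightarrow> real^3) \<Rightarrow> (real^3 \<Rightarrow> real^3) \<Rightarrow> (real^3 \<Rightarrow> real^3)" where
  "B u w = leray (advect u w)"


section \<open>Weak solutions\<close>

text \<open>\<open>e\<^bsup>l A^(1/2)\<^esup> w \<in> L\<^sup>2(a, b; H)\<close>.  As \<open>H\<close> is separable, weak measurability in time is the same as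
  strong measurability (Pettis).\<close>

definition expA_in_L2 :: "real \<Rightarrow> real \<Rightarrow> real \<Rightarrow> (real \<Rightarrow> real^3 \<Rightarrow> real^3) \<Rightarrow> bool" where
  "expA_in_L2 a b l w \<longleftrightarrow>
     (AE s in lebesgue. s \<in> {a..b} \<longrightarrow> w s \<in> dom_expA l) \<and>
     (\<forall>v\<in>H_space. (\<lambda>s. L2inner (expA l (w s)) v) \<in> borel_measurable (lebesgue_on {a..b})) \<and>
     set_integrable lebesgue {a..b} (\<lambda>s. (L2norm (expA l (w s)))\<^sup>2)"

definition continuous_in_H :: "real \<Rightarrow> (real \<Rightarrow> real^3 \<Rightarrow> real^3) \<Rightarrow> bool" where
  "continuous_in_H T u \<longleftrightarrow> (\<forall>t\<in>{0..T}. u t \<in> H_space \<and>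
     ((\<lambda>s. L2norm (\<lambda>x. u s x - u t x)) \<longlongrightarrow> 0) (at t within {0..T}))"

text \<open>The equation is understood in the dual of \<open>V = D(e\<^bsup>\<sigma> A^(1/2)\<^esup>)\<close>, integrated in time; the dissipative
  term acts on \<open>v \<in> V\<close> by \<open>(e\<^bsup>\<sigma> A^(1/2)\<^esup> u, e\<^bsup>\<sigma> A^(1/2)\<^esup> v)\<close>.  For almost every \<open>s\<close> the field \<open>u s\<close> lies in \<open>V\<close>,
  so that \<open>B (u s) (u s)\<close> is a genuine element of \<open>H\<close>.\<close>

definition weak_solution ::
  "real \<Rightarrow> real \<Rightarrow> real \<Rightarrow> (real^3 \<Rightarrow> real^3) \<Rightarrow> (real \<Rightarrow> real^3 \<Rightarrow> real^3) \<Rightarrow> (real \<Rightarrow> real^3 \<Rightarrow> real^3) \<Rightarrow> bool"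
where
  "weak_solution \<mu> \<sigma> T u0 f u \<longleftrightarrow>
     continuous_in_H T u \<and>
     expA_in_L2 0 T \<sigma> u \<and>
     (AE x in lebesgue. u 0 x = u0 x) \<and>
     (\<forall>v\<in>dom_expA \<sigma>.
        let R = (\<lambda>s. L2inner (f s) v - \<mu> * L2inner (expA \<sigma> (u s)) (expA \<sigma> v)
                     - L2inner (B (u s) (u s)) v)
        in set_integrable lebesgue {0..T} R \<and>
           (\<forall>t\<in>{0..T}. L2inner (u t) v - L2inner u0 v = (LINT s:{0..t}|lebesgue. R s)))"


section \<open>Entire functions\<close>

text \<open>Holomorphic on all of \<open>\<complex>\<^sup>3\<close>: Frechet differentiable everywhere with complex-linear derivative.\<close>

definition holomorphic_C3 :: "(complex^3 \<Rightarrow> complex^3) \<Rightarrow> bool" where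
  "holomorphic_C3 F \<longleftrightarrow>
     (\<forall>z. \<exists>D. (F has_derivative D) (at z) \<and> (\<forall>c v. D (c *s v) = c *s D v))"

definition entire_field :: "(real^3 \<Rightarrow> real^3) \<Rightarrow> bool" where
  "entire_field g \<longleftrightarrow> (\<exists>F. holomorphic_C3 F \<and>
     (\<forall>x. F (\<chi> i. complex_of_real (x $ i)) = (\<chi> i. complex_of_real (g x $ i))))"

end

theory Submission
  imports Defs
begin

text \<open>
  Everything takes place on the Fourier side.  Let \<open>Y\<^sub>n(t)\<close> be the sum of \<open>e\<^bsup>2n\<sigma>|k|\<^esup> \<bar>u\<^sub>k(t)\<bar>\<^sup>2\<close> over the lattice, that is, up to
  a constant, the squared norm of \<open>e\<^bsup>n\<sigma> A^(1/2)\<^esup> u(t)\<close>.  The dissipation of the equation is one full step stronger than the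
  energy: an energy estimate for \<open>Y\<^sub>n\<close> controls the time integral of \<open>Y\<^sub>n\<^sub>+\<^sub>1\<close>.  Smoothness is therefore gained by
  induction on \<open>n\<close>, starting from the basic energy estimate, in which the nonlinear term cancels
  (\<open>advect_coeff_cancellation\<close>, \<open>regular_level_zero\<close>).

  For \<open>n \<ge> 1\<close> suppose that \<open>Y\<^sub>n\<^sub>-\<^sub>1\<close> is bounded and \<open>Y\<^sub>n\<close> is integrable on \<open>[t/2, T]\<close>.  The triangle inequality
  \<open>\<bar>k\<bar> \<le> \<bar>l\<bar> + \<bar>k - l\<bar>\<close> distributes exponential weights over the convolution in the nonlinear term
  (\<open>advect_coeff_bound\<close>).  A half step \<open>\<sigma>/2\<close> of the weight is enough to pay for the derivative and for all
  summations over the lattice, and what remains is \<open>\<mu>/2 Y\<^sub>n\<^sub>+\<^sub>1\<close>, absorbed by the dissipation, plus a multiple of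
  \<open>Y\<^sub>n\<^sub>-\<^sub>1 Y\<^sub>n\<close> (\<open>nonlinear_term_bound\<close>).  The latter is integrable by the induction hypothesis, so that no exponential
  of a time integral appears.  Since \<open>Y\<^sub>n\<close> is integrable, some time \<open>s\<close> between \<open>t/2\<close> and \<open>t\<close> has \<open>Y\<^sub>n(s)\<close> at most of
  order \<open>1/t\<close> times the integral, and the energy inequality started there gives the bounds of level \<open>n\<close>
  (\<open>regular_step\<close>).  If the bounds of level \<open>n - 1\<close> are \<open>M (1 + 1/t)\<^sup>p\<close>, those of level \<open>n\<close> have the exponent
  \<open>2p + 1\<close>.  The forcing is needed with the weight \<open>n - 1\<close> only, because the dissipation pays for the other
  two steps.

  The solution is a given weak solution, not a limit of smooth ones, so the estimates are done for finitely many
  modes.  A weak solution satisfies an integrated ordinary differential equation for each mode, where the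
  nonlinear term is the full convolution (\<open>mode_equation\<close>, \<open>B_coeff\<close>), and the square of an indefinite integral
  obeys the chain rule (\<open>absolutely_continuous_norm_square\<close>).  The weights are such that all constants are
  independent of the set of modes; only in the basic energy estimate the truncation destroys the cancellation,
  and there the error is a tail that tends to zero (\<open>truncated_cancellation\<close>).

  The translation between fields and coefficients rests on the completeness of the modes
  (\<open>fourier_completeness\<close>).  Fields that have to be shown to exist, such as the Leray projection of the nonlinear
  term and \<open>e\<^bsup>n\<sigma> A^(1/2)\<^esup> u(t)\<close>, have absolutely summable coefficients: in the second case this is what finiteness of
  \<open>Y\<^sub>n\<^sub>+\<^sub>1(t)\<close> gives.  So they are sums of uniformly convergent series.
\<close>

section \<open>Sums over the integer lattice\<close>

lemma norm_real_vec_bound: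
  "(\<Sum>i\<in>UNIV. \<bar>real_of_int (k $ i)\<bar>) \<le> 3 * norm (real_vec k)"
proof -
  have "\<bar>real_of_int (k $ i)\<bar> \<le> norm (real_vec k)" for i
    using component_le_norm_cart[of "real_vec k" i] by (simp add: real_vec_def)
  then have "(\<Sum>i\<in>UNIV. \<bar>real_of_int (k $ i)\<bar>) \<le> (\<Sum>i\<in>(UNIV::3 set). norm (real_vec k))"
    by (intro sum_mono) auto
  then show ?thesis by simp
qed

lemma summable_exp_abs_int:
  assumes "c > 0"
  shows "(\<lambda>m::int. exp (- c * \<bar>real_of_int m\<bar>)) summable_on UNIV"
proof -
  have geo: "(\<lambda>n::nat. exp (- c * real n)) summable_on UNIV"
  proof -
    have "summable (\<lambda>n. (exp (-c)) ^ n)" using assms by (intro summable_geometric) simp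
    then have "summable (\<lambda>n::nat. exp (- c * real n))"
      by (simp add: exp_of_nat_mult[symmetric] mult.commute)
    then show ?thesis by (subst summable_on_UNIV_nonneg_real_iff) auto
  qed
  have 1: "(\<lambda>m::int. exp (- c * \<bar>real_of_int m\<bar>)) summable_on (range int)"
    by (subst summable_on_reindex) (use geo in \<open>auto simp: o_def\<close>)
  have 2: "(\<lambda>m::int. exp (- c * \<bar>real_of_int m\<bar>)) summable_on (range (\<lambda>n. - int n))"
    by (subst summable_on_reindex) (use geo in \<open>auto simp: o_def inj_def\<close>)
  have "UNIV = range int \<union> range (\<lambda>n. - int n)"
    by (auto simp: image_iff) (metis int_cases2)
  then show ?thesis using summable_on_union[OF 1 2] by simp
qed

text \<open>The euclidean norm dominates a third of the sum of the absolute values of the coordinates, so a finite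
  sum over the lattice is at most the cube of a one-dimensional geometric series.\<close>

lemma summable_exp_lattice:
  assumes "c > 0"
  shows "(\<lambda>k::int^3. exp (- c * norm (real_vec k))) summable_on UNIV"
proof (rule nonneg_bdd_above_summable_on)
  define g where "g = (\<lambda>m::int. exp (- (c / 3) * \<bar>real_of_int m\<bar>))"
  have g: "g summable_on UNIV" unfolding g_def by (rule summable_exp_abs_int) (use assms in auto)
  have g0: "g m \<ge> 0" for m by (simp add: g_def)
  have "sum (\<lambda>k::int^3. exp (- c * norm (real_vec k))) F \<le> (infsum g UNIV) ^ 3" if F: "finite F" for F
  proof -
    define A where "A = (\<Union>k\<in>F. range (\<lambda>i. k $ i))"
    have A: "finite A" using F by (auto simp: A_def)
    have "sum (\<lambda>k::int^3. exp (- c * norm (real_vec k))) F \<le> sum (\<lambda>k. \<Prod>i\<in>UNIV. g (k $ i)) F"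
    proof (rule sum_mono)
      fix k :: "int^3"
      have "(\<Prod>i\<in>UNIV. g (k $ i)) = exp (\<Sum>i\<in>UNIV. - (c / 3) * \<bar>real_of_int (k $ i)\<bar>)"
        by (simp add: g_def exp_sum)
      also have "\<dots> = exp (- (c / 3) * (\<Sum>i\<in>UNIV. \<bar>real_of_int (k $ i)\<bar>))"
        by (simp only: sum_distrib_left)
      finally show "exp (- c * norm (real_vec k)) \<le> (\<Prod>i\<in>UNIV. g (k $ i))"
        using norm_real_vec_bound[of k] assms by simp
    qed
    also have "\<dots> = sum (\<lambda>h. \<Prod>i\<in>UNIV. g (h i)) (vec_nth ` F)"
      by (subst sum.reindex) (auto simp: inj_on_def vec_nth_inject)
    also have "\<dots> \<le> sum (\<lambda>h. \<Prod>i\<in>UNIV. g (h i)) (Pi\<^sub>E UNIV (\<lambda>_::3. A))"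
      by (rule sum_mono2) (auto simp: A_def A[unfolded A_def] intro!: finite_PiE prod_nonneg g0)
    also have "\<dots> = (\<Prod>i\<in>(UNIV::3 set). \<Sum>m\<in>A. g m)"
      by (rule prod_sum_PiE[symmetric]) (use A in auto)
    also have "\<dots> = (sum g A) ^ 3" by simp
    also have "\<dots> \<le> (infsum g UNIV) ^ 3"
      by (intro power_mono finite_sum_le_infsum g A sum_nonneg) (auto simp: g0)
    finally show ?thesis .
  qed
  then show "bdd_above (sum (\<lambda>k::int^3. exp (- c * norm (real_vec k))) ` {F. F \<subseteq> UNIV \<and> finite F})"
    by (intro bdd_aboveI[of _ "(infsum g UNIV) ^ 3"]) auto
qed auto

text \<open>Half of the exponent absorbs the quadratic factor, by the second-order lower bound for \<open>exp\<close>.\<close>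

lemma summable_sq_exp_lattice:
  assumes "c > 0"
  shows "(\<lambda>k::int^3. (norm (real_vec k))\<^sup>2 * exp (- c * norm (real_vec k))) summable_on UNIV"
proof (rule summable_on_comparison_test)
  show "(\<lambda>k::int^3. (8 / c\<^sup>2) * exp (- (c / 2) * norm (real_vec k))) summable_on UNIV"
    by (intro summable_on_cmult_right summable_exp_lattice) (use assms in auto)
  fix k :: "int^3"
  define x where "x = norm (real_vec k)"
  have "x\<^sup>2 * (c\<^sup>2 / 8) \<le> 1 + (c/2 * x) + (c/2 * x)\<^sup>2 / 2"
    using assms by (simp add: x_def power2_eq_square algebra_simps)
  also have "\<dots> \<le> exp (c/2 * x)"
    by (rule exp_lower_Taylor_quadratic) (use assms in \<open>simp add: x_def\<close>)
  finally have "x\<^sup>2 \<le> 8 / c\<^sup>2 * exp (c/2 * x)" using assms by (simp add: field_simps)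
  then have "x\<^sup>2 * exp (- c * x) \<le> 8 / c\<^sup>2 * exp (c/2 * x) * exp (- c * x)"
    by (intro mult_right_mono) auto
  also have "\<dots> = 8 / c\<^sup>2 * exp (- (c/2) * x)"
    by (simp add: mult_exp_exp)
  finally show "(norm (real_vec k))\<^sup>2 * exp (- c * norm (real_vec k)) \<le> (8 / c\<^sup>2) * exp (- (c / 2) * norm (real_vec k))"
    by (simp add: x_def)
qed auto

lemma summable_on_mult_of_squares:
  fixes a b :: "'i \<Rightarrow> real"
  assumes "(\<lambda>k. (a k)\<^sup>2) summable_on A" "(\<lambda>k. (b k)\<^sup>2) summable_on A"
  shows "(\<lambda>k. \<bar>a k * b k\<bar>) summable_on A"
proof (rule summable_on_comparison_test)
  show "(\<lambda>k. (a k)\<^sup>2 + (b k)\<^sup>2) summable_on A"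
    by (intro summable_on_add assms)
  fix k
  have "2 * \<bar>a k * b k\<bar> \<le> (a k)\<^sup>2 + (b k)\<^sup>2"
    using sum_squares_bound[of "\<bar>a k\<bar>" "\<bar>b k\<bar>"] by (simp add: abs_mult)
  then show "\<bar>a k * b k\<bar> \<le> (a k)\<^sup>2 + (b k)\<^sup>2"
    using abs_ge_zero[of "a k * b k"] by linarith
qed auto

lemma Cauchy_Schwarz_infsum:
  fixes a b :: "'i \<Rightarrow> real"
  assumes a: "(\<lambda>k. (a k)\<^sup>2) summable_on A" and b: "(\<lambda>k. (b k)\<^sup>2) summable_on A"
  shows "(\<Sum>\<^sub>\<infinity>k\<in>A. \<bar>a k * b k\<bar>)\<^sup>2 \<le> (\<Sum>\<^sub>\<infinity>k\<in>A. (a k)\<^sup>2) * (\<Sum>\<^sub>\<infinity>k\<in>A. (b k)\<^sup>2)"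
proof -
  let ?P = "(\<Sum>\<^sub>\<infinity>k\<in>A. (a k)\<^sup>2) * (\<Sum>\<^sub>\<infinity>k\<in>A. (b k)\<^sup>2)"
  have "(\<Sum>\<^sub>\<infinity>k\<in>A. \<bar>a k * b k\<bar>) \<le> sqrt ?P"
  proof (rule infsum_le_finite_sums[OF summable_on_mult_of_squares[OF a b]])
    fix F assume F: "finite F" "F \<subseteq> A"
    have "(\<Sum>k\<in>F. \<bar>a k\<bar> * \<bar>b k\<bar>)\<^sup>2 \<le> (\<Sum>k\<in>F. \<bar>a k\<bar>\<^sup>2) * (\<Sum>k\<in>F. \<bar>b k\<bar>\<^sup>2)"
      by (rule Cauchy_Schwarz_ineq_sum)
    also have "\<dots> = (\<Sum>k\<in>F. (a k)\<^sup>2) * (\<Sum>k\<in>F. (b k)\<^sup>2)" by simp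
    also have "\<dots> \<le> ?P"
      by (intro mult_mono finite_sum_le_infsum a b F sum_nonneg infsum_nonneg) auto
    finally show "(\<Sum>k\<in>F. \<bar>a k * b k\<bar>) \<le> sqrt ?P"
      by (intro real_le_rsqrt) (simp add: abs_mult)
  qed
  moreover have "0 \<le> (\<Sum>\<^sub>\<infinity>k\<in>A. \<bar>a k * b k\<bar>)" by (rule infsum_nonneg) auto
  ultimately show ?thesis
    by (smt (verit) power_mono real_sqrt_pow2 infsum_nonneg mult_nonneg_nonneg zero_le_power2)
qed

section \<open>Exchanging sums over a countable index set with integrals\<close>

text \<open>Dominated convergence along an enumeration of the index set.  Measurability of the pointwise sum is a
  hypothesis because convergence almost everywhere does not control its values on the exceptional set.\<close>

lemma integral_infsum:
  fixes f :: "'i::countable \<Rightarrow> 'x \<Rightarrow> 'b::{banach, second_countable_topology}"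
  assumes inf: "infinite (UNIV :: 'i set)"
    and int: "\<And>k. integrable M (f k)"
    and ae: "AE x in M. (\<lambda>k. norm (f k x)) summable_on UNIV"
    and meas: "(\<lambda>x. \<Sum>\<^sub>\<infinity>k. f k x) \<in> borel_measurable M"
    and sm: "(\<lambda>k. \<integral>x. norm (f k x) \<partial>M) summable_on UNIV"
  shows "integrable M (\<lambda>x. \<Sum>\<^sub>\<infinity>k. f k x)"
    and "(\<integral>x. (\<Sum>\<^sub>\<infinity>k. f k x) \<partial>M) = (\<Sum>\<^sub>\<infinity>k. \<integral>x. f k x \<partial>M)"
    and "(\<lambda>k. \<integral>x. f k x \<partial>M) summable_on UNIV"
proof -
  define e where "e = (from_nat_into UNIV :: nat \<Rightarrow> 'i)"
  have e: "bij_betw e UNIV UNIV" unfolding e_def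
    by (rule bij_betw_from_nat_into) (use inf in auto)
  have ae': "AE x in M. (\<lambda>n. norm (f (e n) x)) summable_on UNIV"
    using ae summable_on_reindex_bij_betw[OF e, of "\<lambda>k. norm (f k _)"] by simp
  have sm': "summable (\<lambda>n. \<integral>x. norm (f (e n) x) \<partial>M)"
    using sm summable_on_reindex_bij_betw[OF e, of "\<lambda>k. \<integral>x. norm (f k x) \<partial>M"]
    by (simp add: summable_on_imp_summable)
  have ae2: "AE x in M. summable (\<lambda>n. norm (f (e n) x))"
    using ae' by eventually_elim (rule summable_on_imp_summable)
  have eq: "AE x in M. (\<Sum>n. f (e n) x) = (\<Sum>\<^sub>\<infinity>k. f k x)"
    using ae'
  proof eventually_elim
    case (elim x)
    then have "(\<lambda>n. f (e n) x) summable_on UNIV" by (rule abs_summable_summable)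
    then have "((\<lambda>n. f (e n) x) has_sum (\<Sum>\<^sub>\<infinity>n. f (e n) x)) UNIV" by simp
    then have "(\<lambda>n. f (e n) x) sums (\<Sum>\<^sub>\<infinity>n. f (e n) x)" by (rule has_sum_imp_sums)
    then show ?case
      using infsum_reindex_bij_betw[OF e, of "\<lambda>k. f k x"] by (simp add: sums_iff)
  qed
  have i: "integrable M (\<lambda>x. \<Sum>n. f (e n) x)"
    by (rule integrable_suminf[OF int ae2 sm'])
  have s: "(\<integral>x. (\<Sum>n. f (e n) x) \<partial>M) = (\<Sum>n. \<integral>x. f (e n) x \<partial>M)"
    by (rule integral_suminf[OF int ae2 sm'])
  have abs: "(\<lambda>k. norm (\<integral>x. f k x \<partial>M)) summable_on UNIV"
    by (rule summable_on_comparison_test[OF sm]) auto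
  then show "(\<lambda>k. \<integral>x. f k x \<partial>M) summable_on UNIV" by (rule abs_summable_summable)
  show "integrable M (\<lambda>x. \<Sum>\<^sub>\<infinity>k. f k x)"
    using Bochner_Integration.integrable_cong_AE_imp[OF i meas eq] .
  have "(\<Sum>\<^sub>\<infinity>k. \<integral>x. f k x \<partial>M) = (\<Sum>\<^sub>\<infinity>n. \<integral>x. f (e n) x \<partial>M)"
    using infsum_reindex_bij_betw[OF e, of "\<lambda>k. \<integral>x. f k x \<partial>M"] by simp
  also have "\<dots> = (\<Sum>n. \<integral>x. f (e n) x \<partial>M)"
  proof -
    have "(\<lambda>n. \<integral>x. f (e n) x \<partial>M) summable_on UNIV"
      using abs_summable_summable[OF abs] summable_on_reindex_bij_betw[OF e, of "\<lambda>k. \<integral>x. f k x \<partial>M"]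
      by simp
    then have "(\<lambda>n. \<integral>x. f (e n) x \<partial>M) sums (\<Sum>\<^sub>\<infinity>n. \<integral>x. f (e n) x \<partial>M)"
      by (intro has_sum_imp_sums) simp
    then show ?thesis by (simp add: sums_iff)
  qed
  also have "\<dots> = (\<integral>x. (\<Sum>n. f (e n) x) \<partial>M)" using s by simp
  also have "\<dots> = (\<integral>x. (\<Sum>\<^sub>\<infinity>k. f k x) \<partial>M)"
    by (rule integral_cong_AE) (use i meas eq in auto)
  finally show "(\<integral>x. (\<Sum>\<^sub>\<infinity>k. f k x) \<partial>M) = (\<Sum>\<^sub>\<infinity>k. \<integral>x. f k x \<partial>M)" ..
qed

text \<open>A series of extended reals is measurable in a parameter and detects divergence by the value \<open>top\<close>; under
  \<open>enn2real\<close> that value becomes \<open>0\<close>, which is also the default value of a divergent \<open>infsum\<close>.\<close>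

lemma infsum_eq_enn2real_suminf:
  fixes g :: "'i \<Rightarrow> real"
  assumes e: "bij_betw e (UNIV :: nat set) (UNIV :: 'i set)" and nn: "\<And>k. g k \<ge> 0"
  shows "(\<Sum>\<^sub>\<infinity>k. g k) = enn2real (\<Sum>n. ennreal (g (e n)))"
    and "g summable_on UNIV \<longleftrightarrow> (\<Sum>n. ennreal (g (e n))) < top"
proof -
  have sm: "g summable_on UNIV \<longleftrightarrow> summable (\<lambda>n. g (e n))"
    using summable_on_reindex_bij_betw[OF e, of g]
    by (simp add: summable_on_UNIV_nonneg_real_iff nn)
  show iff: "g summable_on UNIV \<longleftrightarrow> (\<Sum>n. ennreal (g (e n))) < top"
    unfolding sm
  proof
    assume "summable (\<lambda>n. g (e n))"
    then have "(\<Sum>n. ennreal (g (e n))) = ennreal (\<Sum>n. g (e n))"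
      by (intro suminf_ennreal2 nn)
    then show "(\<Sum>n. ennreal (g (e n))) < top" by simp
  next
    assume "(\<Sum>n. ennreal (g (e n))) < top"
    then show "summable (\<lambda>n. g (e n))"
      by (intro summable_suminf_not_top nn) auto
  qed
  show "(\<Sum>\<^sub>\<infinity>k. g k) = enn2real (\<Sum>n. ennreal (g (e n)))"
  proof (cases "g summable_on UNIV")
    case True
    then have su: "summable (\<lambda>n. g (e n))" by (simp add: sm)
    have "(\<lambda>n. g (e n)) summable_on UNIV"
      using True summable_on_reindex_bij_betw[OF e, of g] by simp
    then have "(\<lambda>n. g (e n)) sums (\<Sum>\<^sub>\<infinity>n. g (e n))"
      by (intro has_sum_imp_sums) simp
    then have "(\<Sum>\<^sub>\<infinity>k. g k) = (\<Sum>n. g (e n))"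
      using infsum_reindex_bij_betw[OF e, of g] by (simp add: sums_iff)
    also have "\<dots> = enn2real (\<Sum>n. ennreal (g (e n)))"
      using su by (simp add: nn suminf_ennreal2 suminf_nonneg)
    finally show ?thesis .
  next
    case False
    then have "(\<Sum>n. ennreal (g (e n))) = top" using iff top.not_eq_extremum by blast
    then show ?thesis using infsum_not_exists[OF False] by simp
  qed
qed

text \<open>Monotone convergence with hypotheses on finite partial sums only, so that nothing has to be known about
  the infinite sum beforehand.  In the energy estimates the partial sums are over finitely many modes.\<close>

lemma nonneg_infsum_integral_bound:
  fixes g :: "'i::countable \<Rightarrow> 'x \<Rightarrow> real"
  assumes inf: "infinite (UNIV :: 'i set)"
    and int: "\<And>k. integrable M (g k)" and nn: "\<And>k x. g k x \<ge> 0"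
    and bd: "\<And>F. finite F \<Longrightarrow> (\<integral>x. (\<Sum>k\<in>F. g k x) \<partial>M) \<le> D"
  shows "AE x in M. (\<lambda>k. g k x) summable_on UNIV"
    and "integrable M (\<lambda>x. \<Sum>\<^sub>\<infinity>k. g k x)"
    and "(\<integral>x. (\<Sum>\<^sub>\<infinity>k. g k x) \<partial>M) \<le> D"
proof -
  define e where "e = (from_nat_into UNIV :: nat \<Rightarrow> 'i)"
  have e: "bij_betw e UNIV UNIV" unfolding e_def
    by (rule bij_betw_from_nat_into) (use inf in auto)
  then have inj: "inj_on e A" for A by (auto simp: bij_betw_def inj_on_def)
  have D0: "D \<ge> 0" using bd[of "{}"] by simp
  define S where "S x = (\<Sum>n. ennreal (g (e n) x))" for x
  have [measurable]: "g k \<in> borel_measurable M" for k using int[of k] by simp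
  have Sm[measurable]: "S \<in> borel_measurable M" unfolding S_def by measurable
  have "(\<integral>\<^sup>+x. S x \<partial>M) = (\<Sum>n. \<integral>\<^sup>+x. ennreal (g (e n) x) \<partial>M)"
    unfolding S_def by (rule nn_integral_suminf) simp
  also have "\<dots> = (\<Sum>n. ennreal (\<integral>x. g (e n) x \<partial>M))"
    by (simp add: nn_integral_eq_integral int nn)
  also have "\<dots> \<le> ennreal D"
  proof (rule suminf_le_const)
    fix n
    have "(\<Sum>i<n. ennreal (\<integral>x. g (e i) x \<partial>M)) = ennreal (\<Sum>i<n. \<integral>x. g (e i) x \<partial>M)"
      by (rule sum_ennreal) (rule Bochner_Integration.integral_nonneg[OF nn])
    also have "(\<Sum>i<n. \<integral>x. g (e i) x \<partial>M) = (\<integral>x. (\<Sum>k\<in>e ` {..<n}. g k x) \<partial>M)"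
      by (simp add: sum.reindex[OF inj] int)
    also have "ennreal \<dots> \<le> ennreal D" by (intro ennreal_leI bd) auto
    finally show "(\<Sum>i<n. ennreal (\<integral>x. g (e i) x \<partial>M)) \<le> ennreal D" .
  qed auto
  finally have SD: "(\<integral>\<^sup>+x. S x \<partial>M) \<le> ennreal D" .
  then have fin: "(\<integral>\<^sup>+x. S x \<partial>M) \<noteq> \<infinity>" by (auto simp: top_unique)
  have aefin: "AE x in M. S x \<noteq> \<infinity>" by (rule nn_integral_noteq_infinite[OF Sm fin])
  then show "AE x in M. (\<lambda>k. g k x) summable_on UNIV"
    by eventually_elim (simp add: infsum_eq_enn2real_suminf(2)[OF e nn] S_def less_top[symmetric])
  have eq: "(\<lambda>x. \<Sum>\<^sub>\<infinity>k. g k x) = (\<lambda>x. enn2real (S x))"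
    by (simp add: infsum_eq_enn2real_suminf(1)[OF e nn] S_def)
  have nni: "(\<integral>\<^sup>+x. ennreal (enn2real (S x)) \<partial>M) \<le> ennreal D"
  proof -
    have "AE x in M. ennreal (enn2real (S x)) = S x"
      using aefin by eventually_elim (simp add: less_top[symmetric])
    then have "(\<integral>\<^sup>+x. ennreal (enn2real (S x)) \<partial>M) = (\<integral>\<^sup>+x. S x \<partial>M)"
      by (rule nn_integral_cong_AE)
    then show ?thesis using SD by simp
  qed
  show int': "integrable M (\<lambda>x. \<Sum>\<^sub>\<infinity>k. g k x)"
    unfolding eq
  proof (rule integrableI_bounded)
    have "(\<integral>\<^sup>+x. ennreal (norm (enn2real (S x))) \<partial>M) \<le> ennreal D" using nni by simp
    then show "(\<integral>\<^sup>+x. ennreal (norm (enn2real (S x))) \<partial>M) < \<infinity>"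
      by (rule le_less_trans) simp
  qed simp
  have "(\<integral>x. enn2real (S x) \<partial>M) = enn2real (\<integral>\<^sup>+x. ennreal (enn2real (S x)) \<partial>M)"
    by (rule integral_eq_nn_integral) auto
  also have "\<dots> \<le> D" by (rule enn2real_leI[OF D0 nni])
  finally show "(\<integral>x. (\<Sum>\<^sub>\<infinity>k. g k x) \<partial>M) \<le> D" by (simp add: eq)
qed

lemma infinite_lattice: "infinite (UNIV :: (int^3) set)"
proof
  assume "finite (UNIV :: (int^3) set)"
  then have "finite (range (\<lambda>m::int. (\<chi> i. m) :: int^3))" by (rule finite_subset[rotated]) auto
  moreover have "inj (\<lambda>m::int. (\<chi> i. m) :: int^3)" by (auto simp: inj_def vec_eq_iff)
  ultimately show False using finite_imageD infinite_UNIV_int by blast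
qed

section \<open>Integration over the torus\<close>

abbreviation torus :: "(real^3) measure" where "torus \<equiv> lebesgue_on Omega"

lemma Omega_sets[simp]: "Omega \<in> sets lebesgue" by (simp add: Omega_def)

lemma mem_Omega: "x \<in> Omega \<longleftrightarrow> (\<forall>i. 0 \<le> x $ i \<and> x $ i \<le> 2 * pi)"
  by (simp add: Omega_def mem_box_cart)

lemma set_integral_Omega:
  fixes g :: "real^3 \<Rightarrow> 'b::{banach, second_countable_topology}"
  shows "(LINT x:Omega|lebesgue. g x) = (\<integral>x. g x \<partial>torus)"
  by (simp add: set_lebesgue_integral_def integral_restrict_space)

lemma set_integrable_Omega:
  fixes g :: "real^3 \<Rightarrow> 'b::{banach, second_countable_topology}"
  shows "set_integrable lebesgue Omega g \<longleftrightarrow> integrable torus g"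
  by (simp add: set_integrable_def integrable_restrict_space)

lemma measure_torus: "measure torus (space torus) = (2 * pi) ^ 3"
proof -
  have "measure torus (space torus) = measure lebesgue Omega"
    by (simp add: measure_restrict_space)
  also have "\<dots> = (\<Prod>i\<in>(UNIV::3 set). 2 * pi)"
  proof -
    have "(0::real^3) \<in> cbox 0 (\<chi> i. 2 * pi)" by (simp add: mem_box_cart)
    then have "cbox (0::real^3) (\<chi> i. 2 * pi) \<noteq> {}" by blast
    then show ?thesis unfolding Omega_def by (simp add: content_cbox_cart)
  qed
  finally show ?thesis by simp
qed

lemma finite_measure_torus: "finite_measure torus"
proof
  have "emeasure torus (space torus) = emeasure lebesgue Omega" by (simp add: emeasure_restrict_space)
  also have "\<dots> = emeasure lborel Omega" by (simp add: Omega_def)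
  also have "\<dots> < \<infinity>" unfolding Omega_def by (rule emeasure_lborel_cbox_finite)
  finally show "emeasure torus (space torus) \<noteq> \<infinity>" by simp
qed

lemma integrable_torus_continuous:
  fixes g :: "real^3 \<Rightarrow> 'b::euclidean_space"
  assumes "continuous_on UNIV g"
  shows "integrable torus g"
proof -
  have "set_integrable lebesgue Omega g" unfolding Omega_def
    by (rule absolutely_integrable_continuous) (rule continuous_on_subset[OF assms], simp)
  then show ?thesis by (simp only: set_integrable_Omega)
qed

lemma continuous_bounded_on_compact:
  fixes g :: "real^3 \<Rightarrow> 'b::real_normed_vector"
  assumes "continuous_on UNIV g" "compact S"
  shows "\<exists>C\<ge>0. \<forall>x\<in>S. norm (g x) \<le> C"
proof -
  have "bounded (g ` S)"
    by (intro compact_imp_bounded compact_continuous_image continuous_on_subset[OF assms(1)] assms(2)) simp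
  then show ?thesis
    by (metis bounded_pos imageI less_imp_le)
qed

text \<open>Splitting the enlarged box at the heights \<open>h\<close> and \<open>2\<pi>\<close> compares the shifted cube with the original one;
  the two leftover slabs differ by a full period.\<close>

lemma torus_integral_shift:
  fixes g :: "real^3 \<Rightarrow> 'b::euclidean_space"
  assumes per: "periodic g" and cont: "continuous_on UNIV g" and h: "0 \<le> h" "h \<le> 2 * pi"
  shows "(\<integral>x. g (x + axis i h) \<partial>torus) = (\<integral>x. g x \<partial>torus)"
proof -
  define b :: "real^3" where "b = (\<chi> j. 2 * pi)"
  define c :: "real^3" where "c = axis i h"
  define d :: "real^3" where "d = axis i (2 * pi)"
  have Om: "Omega = cbox 0 b" by (simp add: Omega_def b_def)
  have ci: "g integrable_on cbox u v" for u v
    by (rule integrable_continuous) (rule continuous_on_subset[OF cont], simp)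
  have eqMO: "(\<integral>x. f x \<partial>torus) = integral Omega f" if "continuous_on UNIV f" for f :: "real^3 \<Rightarrow> 'b"
    by (rule lebesgue_integral_eq_integral[OF integrable_torus_continuous[OF that]]) simp
  have ib: "axis i (1::real) \<in> (Basis :: (real^3) set)" by (simp add: axis_in_Basis_iff)
  have split: "integral (cbox 0 (b + c)) g = integral (cbox 0 (b + c) \<inter> {x. x \<bullet> axis i 1 \<le> m}) g +
      integral (cbox 0 (b + c) \<inter> {x. x \<bullet> axis i 1 \<ge> m}) g" for m
    by (rule integral_split[OF ci ib])
  have cn: "b $ j = 2 * pi" "c $ j = (if j = i then h else 0)" "d $ j = (if j = i then 2 * pi else 0)"
    "x \<bullet> axis i 1 = x $ i" for j and x :: "real^3"
    by (auto simp: b_def c_def d_def axis_def) (simp add: cart_eq_inner_axis axis_def)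
  note bx = set_eq_iff Int_iff mem_Collect_eq mem_box_cart vector_add_component zero_index cn vec_lambda_beta
  have aux: "((\<forall>j. P j) \<and> Q) = (\<forall>j. P j \<and> (j = i \<longrightarrow> Q))" for P Q by auto
  have 1: "cbox 0 (b + c) \<inter> {x. x \<bullet> axis i 1 \<le> 2 * pi} = cbox 0 b"
    unfolding bx aux using h by (intro allI iff_allI) auto
  have 2: "cbox 0 (b + c) \<inter> {x. x \<bullet> axis i 1 \<ge> 2 * pi} = cbox (0 + d) (((\<chi> j. if j = i then h else 2 * pi)) + d)"
    unfolding bx aux using h by (intro allI iff_allI) auto
  have 3: "cbox 0 (b + c) \<inter> {x. x \<bullet> axis i 1 \<le> h} = cbox 0 (\<chi> j. if j = i then h else 2 * pi)"
    unfolding bx aux using h by (intro allI iff_allI) auto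
  have 4: "cbox 0 (b + c) \<inter> {x. x \<bullet> axis i 1 \<ge> h} = cbox (0 + c) (b + c)"
    unfolding bx aux using h by (intro allI iff_allI) auto
  have per': "g \<circ> ((+) d) = g"
    using per by (auto simp: periodic_def d_def fun_eq_iff add.commute)
  have "integral (cbox (0 + d) (((\<chi> j. if j = i then h else 2 * pi)) + d)) g
      = integral (cbox 0 (\<chi> j. if j = i then h else 2 * pi)) g"
    using integral_shift_cbox_plus[of 0 "\<chi> j. if j = i then h else 2 * pi" g d] per' by simp
  then have "integral (cbox (0 + c) (b + c)) g = integral (cbox 0 b) g"
    using split[of h] split[of "2 * pi"] unfolding 1 2 3 4 by simp
  then have "integral Omega (\<lambda>x. g (x + c)) = integral Omega g"
    using integral_shift_cbox_plus[of 0 b g c] by (simp add: Om o_def add.commute)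
  then show ?thesis
    by (subst (1 2) eqMO) (auto simp: c_def cont intro!: continuous_on_compose2[OF cont] continuous_intros)
qed

lemma test_fun_continuous: "test_fun \<psi> d\<psi> \<Longrightarrow> continuous_on UNIV \<psi>"
  unfolding test_fun_def
  by (intro continuous_at_imp_continuous_on ballI) (elim conjE allE, rule has_derivative_continuous)

lemma test_fun_mvt:
  assumes t: "test_fun \<psi> d\<psi>" and h: "h > 0"
  shows "\<exists>z. 0 < z \<and> z < h \<and> \<psi> (x + axis j h) - \<psi> x = h * d\<psi> (x + axis j z) $ j"
proof -
  have ax: "axis j s = s *\<^sub>R axis j (1::real)" for s :: real and j :: 3 by (simp add: axis_def vec_eq_iff)
  have "((\<lambda>s. \<psi> (x + axis j s)) has_real_derivative d\<psi> (x + axis j s) $ j) (at s)" for s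
  proof -
    have "((\<lambda>s. x + axis j s) has_derivative (\<lambda>s. axis j s)) (at s)"
      by (subst (1 2) ax) (intro derivative_eq_intros, auto)
    moreover have "(\<psi> has_derivative (\<lambda>h. d\<psi> (x + axis j s) \<bullet> h)) (at (x + axis j s))"
      using t by (auto simp: test_fun_def)
    ultimately have "((\<lambda>s. \<psi> (x + axis j s)) has_derivative (\<lambda>r. d\<psi> (x + axis j s) \<bullet> axis j r)) (at s)"
      by (rule has_derivative_compose)
    moreover have "(\<lambda>r. d\<psi> (x + axis j s) \<bullet> axis j r) = (*) (d\<psi> (x + axis j s) $ j)"
      by (auto simp: inner_axis)
    ultimately show ?thesis
      by (simp only: has_field_derivative_def)
  qed
  then obtain z where "0 < z" "z < h" "\<psi> (x + axis j h) - \<psi> (x + axis j 0) = (h - 0) * d\<psi> (x + axis j z) $ j"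
    using MVT2[OF h, of "\<lambda>s. \<psi> (x + axis j s)" "\<lambda>s. d\<psi> (x + axis j s) $ j"] by auto
  moreover have "axis j 0 = (0 :: real^3)" by (simp add: axis_def vec_eq_iff)
  ultimately show ?thesis by auto
qed

text \<open>By shift invariance every difference quotient in direction \<open>j\<close> has integral zero.  By the mean value
  theorem the quotients are values of the derivative at nearby points, hence bounded and convergent.\<close>

lemma test_fun_integral_derivative:
  assumes t: "test_fun \<psi> d\<psi>"
  shows "(\<integral>x. d\<psi> x $ j \<partial>torus) = 0"
proof -
  define F where "F n x = real (Suc n) * (\<psi> (x + axis j (1 / real (Suc n))) - \<psi> x)" for n x
  have cont: "continuous_on UNIV \<psi>" by (rule test_fun_continuous[OF t])
  have contd: "continuous_on UNIV d\<psi>" using t by (simp add: test_fun_def)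
  have per: "periodic \<psi>" using t by (simp add: test_fun_def)
  have mv: "\<exists>z. 0 < z \<and> z < 1 / real (Suc n) \<and> F n x = d\<psi> (x + axis j z) $ j" for n x
    using test_fun_mvt[OF t, of "1 / real (Suc n)" x j] by (auto simp: F_def field_simps)
  then obtain z where z: "\<And>n x. 0 < z n x \<and> z n x < 1 / real (Suc n) \<and> F n x = d\<psi> (x + axis j (z n x)) $ j"
    by metis
  obtain C where C: "\<And>x. x \<in> cbox (0::real^3) (\<chi> i. 2 * pi + 1) \<Longrightarrow> norm (d\<psi> x) \<le> C"
    using continuous_bounded_on_compact[OF contd compact_cbox] by blast
  have F0: "(\<integral>x. F n x \<partial>torus) = 0" for n
  proof -
    have "1 / real (Suc n) \<le> 1" by simp
    then have le: "1 / real (Suc n) \<le> 2 * pi" using pi_ge_two by linarith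
    have "continuous_on UNIV (\<lambda>x. \<psi> (x + axis j (1 / real (Suc n))))"
      by (intro continuous_on_compose2[OF cont] continuous_intros) auto
    then have "(\<integral>x. F n x \<partial>torus) = real (Suc n) * ((\<integral>x. \<psi> (x + axis j (1 / real (Suc n))) \<partial>torus) - (\<integral>x. \<psi> x \<partial>torus))"
      unfolding F_def by (simp add: integrable_torus_continuous cont)
    also have "\<dots> = 0" using torus_integral_shift[OF per cont _ le, of j] by simp
    finally show ?thesis .
  qed
  have "(\<lambda>n. \<integral>x. F n x \<partial>torus) \<longlonglongrightarrow> (\<integral>x. d\<psi> x $ j \<partial>torus)"
  proof (rule integral_dominated_convergence[where w = "\<lambda>_. C"])
    show "(\<lambda>x. d\<psi> x $ j) \<in> borel_measurable torus"
      by (intro borel_measurable_integrable integrable_torus_continuous continuous_intros contd)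
    show "F n \<in> borel_measurable torus" for n unfolding F_def
      by (intro borel_measurable_integrable integrable_torus_continuous continuous_intros continuous_on_compose2[OF cont]) auto
    show "integrable torus (\<lambda>_. C)" by (intro integrable_torus_continuous continuous_intros)
    show "AE x in torus. (\<lambda>n. F n x) \<longlonglongrightarrow> d\<psi> x $ j"
    proof (rule AE_I2)
      fix x
      have "(\<lambda>n. z n x) \<longlonglongrightarrow> 0"
        by (rule real_tendsto_sandwich[OF _ _ tendsto_const lim_1_over_n[THEN LIMSEQ_Suc]])
          (use z in \<open>auto intro!: always_eventually less_imp_le\<close>)
      then have "(\<lambda>n. x + z n x *\<^sub>R axis j 1) \<longlonglongrightarrow> x + 0 *\<^sub>R axis j 1"
        by (intro tendsto_intros)
      moreover have "x + z n x *\<^sub>R axis j 1 = x + axis j (z n x)" for n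
        by (simp add: axis_def vec_eq_iff)
      ultimately have "(\<lambda>n. x + axis j (z n x)) \<longlonglongrightarrow> x" by simp
      moreover have "isCont d\<psi> x" using contd by (simp add: continuous_on_eq_continuous_at)
      ultimately have "(\<lambda>n. d\<psi> (x + axis j (z n x)) $ j) \<longlonglongrightarrow> d\<psi> x $ j"
        by (intro tendsto_vec_nth) (rule isCont_tendsto_compose)
      then show "(\<lambda>n. F n x) \<longlonglongrightarrow> d\<psi> x $ j" using z by simp
    qed
    show "AE x in torus. norm (F n x) \<le> C" for n
    proof (rule AE_I2)
      fix x assume "x \<in> space torus"
      then have x: "x \<in> Omega" by simp
      have "1 / real (Suc n) \<le> 1" by simp
      then have "z n x < 1" "0 < z n x" using z[of n x] by linarith+
      then have "x + axis j (z n x) \<in> cbox (0::real^3) (\<chi> i. 2 * pi + 1)"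
        unfolding mem_box_cart vector_add_component axis_def zero_index vec_lambda_beta
        using x by (auto simp: mem_Omega intro: add_increasing2) (smt (verit))
      then show "norm (F n x) \<le> C"
        using C z[of n x] component_le_norm_cart[of "d\<psi> (x + axis j (z n x))" j] by (metis order_trans real_norm_def)
    qed
  qed
  then have "(\<lambda>n::nat. 0) \<longlonglongrightarrow> (\<integral>x. d\<psi> x $ j \<partial>torus)" by (simp add: F0)
  then show ?thesis by (simp add: LIMSEQ_const_iff)
qed

subsection \<open>Fourier modes\<close>

definition mode :: "int^3 \<Rightarrow> real^3 \<Rightarrow> complex" where
  "mode k x = exp (\<i> * complex_of_real (real_vec k \<bullet> x))"

lemma real_vec_simps[simp]:
  "real_vec 0 = 0" "real_vec (- k) = - real_vec k" "real_vec (k + l) = real_vec k + real_vec l"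
  "real_vec (k - l) = real_vec k - real_vec l" "real_vec k $ i = real_of_int (k $ i)"
  by (simp_all add: real_vec_def vec_eq_iff)

lemma mode_simps:
  "mode 0 x = 1" "mode (k + l) x = mode k x * mode l x" "cnj (mode k x) = mode (- k) x" "cmod (mode k x) = 1"
  by (simp_all add: mode_def exp_add[symmetric] algebra_simps exp_cnj)

lemma mode_cis: "mode k x = Complex (cos (real_vec k \<bullet> x)) (sin (real_vec k \<bullet> x))"
  by (simp add: mode_def cis_conv_exp[symmetric] complex_eq_iff)

lemma mode_shift: "mode k (x + axis j h) = exp (\<i> * complex_of_real (of_int (k $ j) * h)) * mode k x"
  by (simp add: mode_def exp_add[symmetric] inner_add_right inner_axis algebra_simps)

lemma exp_two_pi_int: "exp (\<i> * complex_of_real (of_int m * (2 * pi))) = 1"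
  using exp_integer_2pi[of "of_int m"] by (simp add: algebra_simps)

lemma mode_periodic: "periodic (mode k)"
  by (simp only: periodic_def mode_shift exp_two_pi_int mult_1) simp

lemma mode_continuous[continuous_intros]: "continuous_on S (mode k)"
  unfolding mode_def by (intro continuous_intros)

lemma mode_measurable[measurable]: "mode k \<in> borel_measurable torus"
  by (intro borel_measurable_integrable integrable_torus_continuous continuous_intros)

lemma integrable_mult_mode:
  assumes "integrable torus f" shows "integrable torus (\<lambda>x. f x * mode k x)"
  by (rule Bochner_Integration.integrable_bound[OF assms]) (use assms in \<open>auto simp: norm_mult mode_simps\<close>)

text \<open>If \<open>k $ j \<noteq> 0\<close>, the shift by \<open>\<pi> / \<bar>k $ j\<bar>\<close> in direction \<open>j\<close> changes the sign of the mode.\<close>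

lemma mode_integral: "(\<integral>x. mode k x \<partial>torus) = (if k = 0 then of_real ((2 * pi) ^ 3) else 0)"
proof (cases "k = 0")
  case True
  then show ?thesis using measure_torus by (simp add: mode_simps scaleR_conv_of_real)
next
  case False
  then obtain j where j: "k $ j \<noteq> 0" by (auto simp: vec_eq_iff)
  define h where "h = pi / \<bar>real_of_int (k $ j)\<bar>"
  have "\<bar>real_of_int (k $ j)\<bar> \<ge> 1" using j by linarith
  then have "h \<le> pi" unfolding h_def by (simp add: divide_le_eq mult_le_cancel_left1)
  then have h: "0 \<le> h" "h \<le> 2 * pi" using pi_gt_zero by (simp add: h_def, linarith)
  have "of_int (k $ j) * h = pi \<or> of_int (k $ j) * h = - pi"
    using j by (auto simp: h_def abs_if)
  then have e: "exp (\<i> * complex_of_real (of_int (k $ j) * h)) = - 1"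
  proof (elim disjE)
    assume "of_int (k $ j) * h = - pi"
    then show ?thesis by (simp only: of_real_minus mult_minus_right exp_minus exp_pi_i') simp
  qed (simp only: exp_pi_i')
  have "(\<integral>x. mode k x \<partial>torus) = (\<integral>x. mode k (x + axis j h) \<partial>torus)"
    by (rule torus_integral_shift[OF mode_periodic mode_continuous h, symmetric])
  also have "\<dots> = - (\<integral>x. mode k x \<partial>torus)"
    unfolding mode_shift e by simp
  finally show ?thesis using False by (simp add: equal_neg_zero)
qed

lemma test_fun_cos: "test_fun (\<lambda>x. cos (real_vec k \<bullet> x)) (\<lambda>x. - (sin (real_vec k \<bullet> x) *\<^sub>R real_vec k))"
  and test_fun_sin: "test_fun (\<lambda>x. sin (real_vec k \<bullet> x)) (\<lambda>x. cos (real_vec k \<bullet> x) *\<^sub>R real_vec k)"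
proof -
  have p: "mode k (x + axis i (2 * pi)) = mode k x" for x i
    using mode_periodic[of k] by (simp add: periodic_def)
  show "test_fun (\<lambda>x. cos (real_vec k \<bullet> x)) (\<lambda>x. - (sin (real_vec k \<bullet> x) *\<^sub>R real_vec k))"
    unfolding test_fun_def using p
    by (auto simp: periodic_def mode_cis intro!: continuous_intros derivative_eq_intros)
  show "test_fun (\<lambda>x. sin (real_vec k \<bullet> x)) (\<lambda>x. cos (real_vec k \<bullet> x) *\<^sub>R real_vec k)"
    unfolding test_fun_def using p
    by (auto simp: periodic_def mode_cis intro!: continuous_intros derivative_eq_intros)
qed

lemma test_fun_mult:
  assumes "test_fun \<psi> d\<psi>" "test_fun \<phi> d\<phi>"
  shows "test_fun (\<lambda>x. \<psi> x * \<phi> x) (\<lambda>x. \<psi> x *\<^sub>R d\<phi> x + \<phi> x *\<^sub>R d\<psi> x)"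
  unfolding test_fun_def
proof (intro conjI allI)
  show "periodic (\<lambda>x. \<psi> x * \<phi> x)" using assms by (simp add: test_fun_def periodic_def)
  show "continuous_on UNIV (\<lambda>x. \<psi> x *\<^sub>R d\<phi> x + \<phi> x *\<^sub>R d\<psi> x)"
    using assms test_fun_continuous by (intro continuous_intros) (auto simp: test_fun_def)
  fix x
  have "((\<lambda>x. \<psi> x * \<phi> x) has_derivative (\<lambda>h. \<psi> x * (d\<phi> x \<bullet> h) + (d\<psi> x \<bullet> h) * \<phi> x)) (at x)"
    using assms by (intro has_derivative_mult) (auto simp: test_fun_def)
  then show "((\<lambda>x. \<psi> x * \<phi> x) has_derivative (\<lambda>h. (\<psi> x *\<^sub>R d\<phi> x + \<phi> x *\<^sub>R d\<psi> x) \<bullet> h)) (at x)"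
    by (simp add: inner_add_left algebra_simps)
qed

lemma mode_integral_by_parts:
  assumes t: "test_fun \<psi> d\<psi>"
  shows "(\<integral>x. mode k x * of_real (d\<psi> x $ j) \<partial>torus) = - \<i> * of_int (k $ j) * (\<integral>x. mode k x * of_real (\<psi> x) \<partial>torus)"
proof -
  have c: "continuous_on UNIV \<psi>" "continuous_on UNIV d\<psi>"
    using t test_fun_continuous by (auto simp: test_fun_def)
  define I where "I f = (\<integral>x. f x \<partial>torus)" for f :: "real^3 \<Rightarrow> real"
  have i: "integrable torus (\<lambda>x. \<psi> x * sin (real_vec k \<bullet> x))" "integrable torus (\<lambda>x. \<psi> x * cos (real_vec k \<bullet> x))"
    "integrable torus (\<lambda>x. sin (real_vec k \<bullet> x) * d\<psi> x $ j)" "integrable torus (\<lambda>x. cos (real_vec k \<bullet> x) * d\<psi> x $ j)"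
    by (intro integrable_torus_continuous continuous_intros c)+
  have 1: "I (\<lambda>x. cos (real_vec k \<bullet> x) * d\<psi> x $ j) = of_int (k $ j) * I (\<lambda>x. \<psi> x * sin (real_vec k \<bullet> x))"
  proof -
    have "(\<integral>x. cos (real_vec k \<bullet> x) * d\<psi> x $ j - of_int (k $ j) * (\<psi> x * sin (real_vec k \<bullet> x)) \<partial>torus) = 0"
      using test_fun_integral_derivative[OF test_fun_mult[OF t test_fun_cos[of k]], of j]
      by (simp add: algebra_simps)
    then show ?thesis unfolding I_def using i by simp
  qed
  have 2: "I (\<lambda>x. sin (real_vec k \<bullet> x) * d\<psi> x $ j) = - of_int (k $ j) * I (\<lambda>x. \<psi> x * cos (real_vec k \<bullet> x))"
  proof -
    have "(\<integral>x. sin (real_vec k \<bullet> x) * d\<psi> x $ j + of_int (k $ j) * (\<psi> x * cos (real_vec k \<bullet> x)) \<partial>torus) = 0"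
      using test_fun_integral_derivative[OF test_fun_mult[OF t test_fun_sin[of k]], of j]
      by (simp add: algebra_simps)
    then show ?thesis unfolding I_def using i by simp
  qed
  have ii: "integrable torus (\<lambda>x. mode k x * of_real (d\<psi> x $ j))" "integrable torus (\<lambda>x. mode k x * of_real (\<psi> x))"
    by (intro integrable_torus_continuous continuous_intros c)+
  have "Re (\<integral>x. mode k x * of_real (d\<psi> x $ j) \<partial>torus) = I (\<lambda>x. cos (real_vec k \<bullet> x) * d\<psi> x $ j)"
    "Im (\<integral>x. mode k x * of_real (d\<psi> x $ j) \<partial>torus) = I (\<lambda>x. sin (real_vec k \<bullet> x) * d\<psi> x $ j)"
    "Re (\<integral>x. mode k x * of_real (\<psi> x) \<partial>torus) = I (\<lambda>x. \<psi> x * cos (real_vec k \<bullet> x))"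
    "Im (\<integral>x. mode k x * of_real (\<psi> x) \<partial>torus) = I (\<lambda>x. \<psi> x * sin (real_vec k \<bullet> x))"
    using ii by (simp_all add: integral_Re[symmetric] integral_Im[symmetric] I_def mode_cis mult.commute)
  then show ?thesis using 1 2 by (simp add: complex_eq_iff)
qed

section \<open>Completeness of the Fourier modes\<close>

text \<open>Defined inductively, because closure under products then needs no reindexing of double sums.\<close>

inductive trig_poly :: "(real^3 \<Rightarrow> complex) \<Rightarrow> bool" where
  mode: "trig_poly (\<lambda>x. c * mode k x)"
| add: "trig_poly p \<Longrightarrow> trig_poly q \<Longrightarrow> trig_poly (\<lambda>x. p x + q x)"

lemma trig_poly_const: "trig_poly (\<lambda>x. c)"
  using trig_poly.mode[of c 0] by (simp add: mode_simps)

lemma trig_poly_mult_mode: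
  assumes "trig_poly q" shows "trig_poly (\<lambda>x. c * mode k x * q x)"
  using assms
proof induction
  case (mode d l)
  show ?case using trig_poly.mode[of "c * d" "k + l"] by (simp add: mode_simps mult_ac)
next
  case (add p q)
  then show ?case using trig_poly.add[OF add.IH] by (simp add: distrib_left)
qed

lemma trig_poly_mult:
  assumes "trig_poly p" "trig_poly q" shows "trig_poly (\<lambda>x. p x * q x)"
  using assms(1)
proof induction
  case (mode c k)
  show ?case by (rule trig_poly_mult_mode[OF assms(2)])
next
  case (add p p')
  then show ?case using trig_poly.add[OF add.IH] by (simp add: distrib_right)
qed

lemma trig_poly_sum:
  assumes "finite I" "\<And>i. i \<in> I \<Longrightarrow> trig_poly (p i)" shows "trig_poly (\<lambda>x. \<Sum>i\<in>I. p i x)"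
  using assms by (induction I) (auto intro: trig_poly_const trig_poly.add)

text \<open>Points of the cube that agree modulo \<open>2\<pi>\<close> have the same image, so continuous functions of the image are
  periodic; a real polynomial in the image is a trigonometric polynomial.\<close>

definition torus_emb :: "real^3 \<Rightarrow> complex^3" where
  "torus_emb x = (\<chi> j. cis (x $ j))"

lemma continuous_torus_emb: "continuous_on S torus_emb"
  unfolding torus_emb_def by (intro continuous_on_vec_lambda continuous_intros)

lemma trig_poly_cos_sin:
  "trig_poly (\<lambda>x. of_real (cos (x $ j)))" "trig_poly (\<lambda>x. of_real (sin (x $ j)))"
proof -
  have rv: "real_vec (axis j 1) \<bullet> x = x $ j" for x
  proof -
    have "real_vec (axis j 1) = axis j 1" by (simp add: real_vec_def axis_def vec_eq_iff)
    then show ?thesis by (simp add: inner_axis' )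
  qed
  have m: "mode (axis j 1) x = cis (x $ j)" "mode (- axis j 1) x = cis (- x $ j)" for x
    using rv[of x] by (auto simp: mode_def cis_conv_exp)
  have "trig_poly (\<lambda>x. (1/2) * mode (axis j 1) x + (1/2) * mode (- axis j 1) x)"
    by (intro trig_poly.intros)
  moreover have "(\<lambda>x. (1/2) * mode (axis j 1) x + (1/2) * mode (- axis j 1) x) = (\<lambda>x. of_real (cos (x $ j)))"
    by (auto simp: m complex_eq_iff)
  ultimately show "trig_poly (\<lambda>x. of_real (cos (x $ j)))" by simp
  have "trig_poly (\<lambda>x. (- \<i>/2) * mode (axis j 1) x + (\<i>/2) * mode (- axis j 1) x)"
    by (intro trig_poly.intros)
  moreover have "(\<lambda>x. (- \<i>/2) * mode (axis j 1) x + (\<i>/2) * mode (- axis j 1) x) = (\<lambda>x. of_real (sin (x $ j)))"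
    by (auto simp: m complex_eq_iff)
  ultimately show "trig_poly (\<lambda>x. of_real (sin (x $ j)))" by simp
qed

lemma trig_poly_of_polynomial:
  assumes "real_polynomial_function p"
  shows "trig_poly (\<lambda>x. of_real (p (torus_emb x)))"
  using assms
proof induction
  case (linear f)
  then interpret f: bounded_linear f .
  have tb: "trig_poly (\<lambda>x. of_real (f b) * of_real (torus_emb x \<bullet> b))" if b: "b \<in> Basis" for b
  proof -
    obtain j c where jc: "b = axis j c" "c \<in> {1, \<i>}"
      using b by (auto simp: Basis_vec_def Basis_complex_def)
    have "torus_emb x \<bullet> b = cis (x $ j) \<bullet> c" for x by (simp add: jc torus_emb_def inner_axis)
    then have "(\<forall>x. torus_emb x \<bullet> b = cos (x $ j)) \<or> (\<forall>x. torus_emb x \<bullet> b = sin (x $ j))"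
      using jc by (auto simp: inner_complex_def)
    then show ?thesis using trig_poly_cos_sin by (auto intro!: trig_poly_mult trig_poly_const)
  qed
  have rep: "f z = (\<Sum>b\<in>Basis. f b * (z \<bullet> b))" for z
  proof -
    have "f z = f (\<Sum>b\<in>Basis. (z \<bullet> b) *\<^sub>R b)" by (simp only: euclidean_representation)
    also have "\<dots> = (\<Sum>b\<in>Basis. f b * (z \<bullet> b))" by (simp add: f.sum f.scaleR mult.commute)
    finally show ?thesis .
  qed
  have "(\<lambda>x. complex_of_real (f (torus_emb x))) = (\<lambda>x. \<Sum>b\<in>Basis. of_real (f b) * of_real (torus_emb x \<bullet> b))"
    by (rule ext, subst rep) (simp only: of_real_sum of_real_mult)
  then show ?case using trig_poly_sum[OF finite_Basis tb] by simp
next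
  case (const c)
  then show ?case by (rule trig_poly_const)
next
  case (add f g)
  then show ?case using trig_poly.add by simp
next
  case (mult f g)
  then show ?case using trig_poly_mult by simp
qed

text \<open>The embedding identifies opposite faces of the cube and nothing else.\<close>

lemma torus_emb_inj:
  assumes "x \<in> Omega" "torus_emb x = torus_emb y" "\<And>j. 0 < y $ j \<and> y $ j < 2 * pi"
  shows "x = y"
proof (rule vec_eq_iff[THEN iffD2], rule allI)
  fix j
  have "cis (x $ j) = cis (y $ j)" using assms(2) by (simp add: torus_emb_def vec_eq_iff)
  then have "sin (x $ j) = sin (y $ j) \<and> cos (x $ j) = cos (y $ j)" by (simp add: complex_eq_iff)
  then obtain n :: int where n: "x $ j = y $ j + 2 * pi * n" using sin_cos_eq_iff[of "x $ j" "y $ j"] by auto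
  have "0 \<le> x $ j" "x $ j \<le> 2 * pi" using assms(1) by (auto simp: mem_Omega)
  then have "2 * pi * (- 1) < 2 * pi * real_of_int n" "2 * pi * real_of_int n < 2 * pi * 1"
    using assms(3)[of j] n by linarith+
  then have "- 1 < real_of_int n" "real_of_int n < 1"
    using pi_gt_zero by (simp_all only: mult_less_cancel_left_pos zero_less_mult_iff zero_less_numeral simp_thms)
  then have "n = 0" by linarith
  then show "x $ j = y $ j" using n by simp
qed

lemma orthogonal_trig_poly:
  fixes g :: "real^3 \<Rightarrow> real"
  assumes g: "integrable torus g" and orth: "\<And>k. (\<integral>x. of_real (g x) * mode k x \<partial>torus) = 0"
    and p: "trig_poly p"
  shows "integrable torus (\<lambda>x. of_real (g x) * p x) \<and> (\<integral>x. of_real (g x) * p x \<partial>torus) = 0"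
  using p
proof induction
  case (mode c k)
  have i: "integrable torus (\<lambda>x. complex_of_real (g x) * mode k x)"
    by (rule integrable_mult_mode) (use g in simp)
  have "(\<lambda>x. complex_of_real (g x) * (c * mode k x)) = (\<lambda>x. c * (complex_of_real (g x) * mode k x))" by auto
  then show ?case using i orth[of k] by simp
next
  case (add p q)
  then show ?case by (simp add: distrib_left)
qed

text \<open>Stone--Weierstrass on the compact image of the cube approximates \<open>h\<close> uniformly by polynomials, and these are
  trigonometric polynomials on the torus.\<close>

lemma orthogonal_continuous_torus:
  fixes g :: "real^3 \<Rightarrow> real" and h :: "complex^3 \<Rightarrow> real"
  assumes g: "integrable torus g" and orth: "\<And>k. (\<integral>x. of_real (g x) * mode k x \<partial>torus) = 0"
    and h: "continuous_on UNIV h"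
  shows "(\<integral>x. g x * h (torus_emb x) \<partial>torus) = 0"
proof -
  define S where "S = torus_emb ` Omega"
  have S: "compact S" unfolding S_def Omega_def
    by (intro compact_continuous_image continuous_torus_emb compact_cbox)
  define N where "N = (\<integral>x. norm (g x) \<partial>torus)"
  have N0: "N \<ge> 0" by (simp add: N_def)
  have hm: "(\<lambda>x. h (torus_emb x)) \<in> borel_measurable torus"
    by (intro borel_measurable_integrable integrable_torus_continuous continuous_on_compose2[OF h continuous_torus_emb]) auto
  have "bounded (h ` S)"
    by (intro compact_imp_bounded compact_continuous_image S continuous_on_subset[OF h]) auto
  then obtain C where C: "\<And>z. z \<in> S \<Longrightarrow> norm (h z) \<le> C" by (auto simp: bounded_iff)
  have gi: "integrable torus (\<lambda>x. g x * h (torus_emb x))"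
  proof (rule Bochner_Integration.integrable_bound[of _ "\<lambda>x. C * g x"])
    show "AE x in torus. norm (g x * h (torus_emb x)) \<le> norm (C * g x)"
    proof (rule AE_I2)
      fix x assume "x \<in> space torus"
      then have "norm (h (torus_emb x)) \<le> \<bar>C\<bar>" using C[of "torus_emb x"] by (auto simp: S_def)
      then show "norm (g x * h (torus_emb x)) \<le> norm (C * g x)"
        by (simp add: abs_mult mult.commute[of "\<bar>g x\<bar>"] mult_right_mono)
    qed
  qed (use g hm in auto)
  have "\<bar>\<integral>x. g x * h (torus_emb x) \<partial>torus\<bar> \<le> e" if e: "e > 0" for e
  proof -
    define d where "d = e / (N + 1)"
    have d: "d > 0" using e N0 by (simp add: d_def)
    obtain p where p: "real_polynomial_function p" "\<And>z. z \<in> S \<Longrightarrow> \<bar>h z - p z\<bar> < d"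
      using Stone_Weierstrass_real_polynomial_function[OF S continuous_on_subset[OF h] d] by auto
    have o: "integrable torus (\<lambda>x. complex_of_real (g x * p (torus_emb x)))"
      "(\<integral>x. complex_of_real (g x * p (torus_emb x)) \<partial>torus) = 0"
      using orthogonal_trig_poly[OF g orth trig_poly_of_polynomial[OF p(1)]] by simp_all
    then have o1: "integrable torus (\<lambda>x. g x * p (torus_emb x))"
      by (simp only: complex_of_real_integrable_eq)
    have o2: "(\<integral>x. g x * p (torus_emb x) \<partial>torus) = 0"
      using o(2) unfolding integral_complex_of_real by simp
    have "(\<integral>x. g x * h (torus_emb x) \<partial>torus) = (\<integral>x. g x * h (torus_emb x) - g x * p (torus_emb x) \<partial>torus)"
      using gi o1 o2 by simp
    also have "\<bar>\<dots>\<bar> \<le> (\<integral>x. d * norm (g x) \<partial>torus)"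
      unfolding real_norm_def[symmetric]
    proof (rule Bochner_Integration.integral_norm_bound_integral)
      show "integrable torus (\<lambda>x. g x * h (torus_emb x) - g x * p (torus_emb x))" using gi o1 by simp
      show "integrable torus (\<lambda>x. d * norm (g x))" using g by simp
      fix x assume "x \<in> space torus"
      then have "\<bar>h (torus_emb x) - p (torus_emb x)\<bar> \<le> d" using p(2)[of "torus_emb x"] by (auto simp: S_def)
      then have "\<bar>g x\<bar> * \<bar>h (torus_emb x) - p (torus_emb x)\<bar> \<le> \<bar>g x\<bar> * d" by (rule mult_left_mono) simp
      then show "norm (g x * h (torus_emb x) - g x * p (torus_emb x)) \<le> d * norm (g x)"
        by (simp add: abs_mult[symmetric] right_diff_distrib mult.commute)
    qed
    also have "\<dots> = d * N" by (simp add: N_def)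
    also have "\<dots> \<le> e" using e N0 by (simp add: d_def field_simps)
    finally show ?thesis .
  qed
  then have "\<bar>\<integral>x. g x * h (torus_emb x) \<partial>torus\<bar> \<le> 0"
    using field_le_epsilon[of "\<bar>\<integral>x. g x * h (torus_emb x) \<partial>torus\<bar>" 0] by simp
  then show ?thesis by simp
qed

text \<open>The functions \<open>max 0 (1 - n * infdist z F)\<close> decrease to the indicator of the closed set \<open>F\<close>, here the image of
  \<open>K\<close>.  As \<open>K\<close> avoids the faces of the cube, its image has no preimages in the cube other than \<open>K\<close>.\<close>

lemma orthogonal_compact:
  fixes g :: "real^3 \<Rightarrow> real"
  assumes g: "integrable torus g" and orth: "\<And>k. (\<integral>x. of_real (g x) * mode k x \<partial>torus) = 0"
    and K: "compact K" "\<And>y j. y \<in> K \<Longrightarrow> 0 < y $ j \<and> y $ j < 2 * pi"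
  shows "(\<integral>x. g x * indicator K x \<partial>torus) = 0"
proof (cases "K = {}")
  case False
  define F where "F = torus_emb ` K"
  have F: "closed F" "F \<noteq> {}" using False
    by (auto simp: F_def intro!: compact_imp_closed compact_continuous_image continuous_torus_emb K)
  define h where "h n z = max 0 (1 - real n * infdist z F)" for n z
  have hc: "continuous_on UNIV (h n)" for n
    unfolding h_def by (intro continuous_intros)
  have h01: "0 \<le> h n z" "h n z \<le> 1" for n z by (auto simp: h_def infdist_nonneg)
  have lim: "(\<lambda>n. h n z) \<longlonglongrightarrow> indicator F z" for z
  proof (cases "z \<in> F")
    case True
    then show ?thesis by (simp add: h_def)
  next
    case False
    then have pos: "infdist z F > 0" using F infdist_pos_not_in_closed by blast
    obtain m :: nat where m: "1 < real m * infdist z F" using reals_Archimedean3[OF pos] by blast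
    have "eventually (\<lambda>n. h n z = 0) sequentially"
      unfolding eventually_sequentially
    proof (intro exI allI impI)
      fix n assume "m \<le> n"
      then have "real m * infdist z F \<le> real n * infdist z F" using pos by (intro mult_right_mono) auto
      then show "h n z = 0" using m by (simp add: h_def)
    qed
    then show ?thesis using False by (simp add: tendsto_eventually)
  qed
  have ind: "indicator F (torus_emb x) = (indicator K x :: real)" if "x \<in> Omega" for x
    using torus_emb_inj[OF that] K(2) by (fastforce simp: F_def indicator_def)
  have hm: "(\<lambda>x. h n (torus_emb x)) \<in> borel_measurable torus" for n
    by (intro borel_measurable_integrable integrable_torus_continuous continuous_on_compose2[OF hc continuous_torus_emb]) auto
  have Km: "(\<lambda>x. indicator K x :: real) \<in> borel_measurable torus"
  proof (rule borel_measurable_indicator)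
    have "K \<in> sets lebesgue" using K(1) by (simp add: compact_imp_closed lebesgue_closedin)
    moreover have "K \<subseteq> Omega" using K(2) by (auto simp: mem_Omega less_imp_le)
    ultimately show "K \<in> sets torus" by (simp add: sets_restrict_space_iff)
  qed
  have "(\<lambda>n. \<integral>x. g x * h n (torus_emb x) \<partial>torus) \<longlonglongrightarrow> (\<integral>x. g x * indicator K x \<partial>torus)"
  proof (rule integral_dominated_convergence[where w = "\<lambda>x. norm (g x)"])
    show "AE x in torus. (\<lambda>n. g x * h n (torus_emb x)) \<longlonglongrightarrow> g x * indicator K x"
    proof (rule AE_I2)
      fix x assume "x \<in> space torus"
      then have "x \<in> Omega" by simp
      then show "(\<lambda>n. g x * h n (torus_emb x)) \<longlonglongrightarrow> g x * indicator K x"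
        using lim[of "torus_emb x"] by (intro tendsto_intros) (simp add: ind)
    qed
    show "AE x in torus. norm (g x * h n (torus_emb x)) \<le> norm (g x)" for n
      using h01 by (intro AE_I2) (auto simp: abs_mult intro!: mult_left_le)
  qed (use g hm Km in auto)
  then show ?thesis using orthogonal_continuous_torus[OF g orth hc] by (simp add: LIMSEQ_const_iff)
qed auto

text \<open>Up to a null set, the part of \<open>{g > 0}\<close> inside the open cube is a countable union of compact sets.  Over
  each of them \<open>g\<close> is positive with integral zero, so each is a null set.\<close>

lemma orthogonal_nonpos:
  fixes g :: "real^3 \<Rightarrow> real"
  assumes g: "integrable torus g" and orth: "\<And>k. (\<integral>x. of_real (g x) * mode k x \<partial>torus) = 0"
  shows "AE x in torus. g x \<le> 0"
proof -
  define I where "I = box (0::real^3) (\<chi> i. 2 * pi)"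
  have I: "I \<in> sets lebesgue" "I \<subseteq> Omega" by (auto simp: I_def Omega_def box_subset_cbox)
  have "g \<in> borel_measurable torus" using g by simp
  then have Pm0: "{x \<in> Omega. g x > 0} \<in> sets torus"
    using measurable_sets[of g torus borel "{0<..}"] by (simp add: vimage_def Int_def conj_commute)
  define P where "P = {x \<in> Omega. g x > 0} \<inter> I"
  have "{x \<in> Omega. g x > 0} \<in> sets lebesgue" using Pm0 by (simp add: sets_restrict_space_iff)
  then have Pm: "P \<in> sets lebesgue" using I by (simp add: P_def)
  obtain C T where CT: "fsigma C" "T \<in> null_sets lebesgue" "C \<union> T = P" "disjnt C T"
    using lebesgue_set_almost_fsigma[OF Pm] by blast
  obtain F :: "nat \<Rightarrow> (real^3) set" where F: "range F \<subseteq> Collect compact" "C = \<Union>(range F)"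
    using CT(1) fsigma_Union_compact by metis
  have Fn: "F n \<in> null_sets lebesgue" for n
  proof -
    have c: "compact (F n)" using F by auto
    have sub: "F n \<subseteq> P" using F CT by auto
    have box: "0 < y $ j \<and> y $ j < 2 * pi" if "y \<in> F n" for y j
      using that sub by (auto simp: P_def I_def mem_box_cart)
    have 0: "(\<integral>x. g x * indicator (F n) x \<partial>torus) = 0" by (rule orthogonal_compact[OF g orth c box])
    have Fm: "F n \<in> sets lebesgue" using c by (simp add: compact_imp_closed lebesgue_closedin)
    have Ft: "F n \<in> sets torus" using Fm sub by (auto simp: sets_restrict_space_iff P_def)
    have int: "integrable torus (\<lambda>x. g x * indicator (F n) x)"
      by (rule integrable_real_mult_indicator[OF Ft g])
    have nn: "AE x in torus. 0 \<le> g x * indicator (F n) x"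
      using sub by (intro AE_I2) (auto simp: P_def indicator_def)
    have "AE x in torus. g x * indicator (F n) x = 0"
      using integral_nonneg_eq_0_iff_AE[OF int nn] 0 by simp
    then have "AE x in lebesgue. x \<in> Omega \<longrightarrow> g x * indicator (F n) x = 0"
      by (simp add: AE_restrict_space_iff)
    then have "AE x in lebesgue. x \<notin> F n"
      by eventually_elim (use sub in \<open>auto simp: P_def indicator_def\<close>)
    then show ?thesis using Fm by (simp add: AE_iff_null_sets)
  qed
  then have "C \<in> null_sets lebesgue" using F by auto
  then have "P \<in> null_sets lebesgue" using CT by auto
  then have 1: "AE x in lebesgue. x \<notin> P" using Pm by (simp add: AE_iff_null_sets)
  have "negligible (Omega - I)" unfolding Omega_def I_def by (rule negligible_convex_frontier[THEN negligible_subset, of "cbox 0 (\<chi> i. 2 * pi)"])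
    (auto simp: frontier_cbox)
  then have "Omega - I \<in> null_sets lebesgue" by (simp add: negligible_iff_null_sets)
  then have 2: "AE x in lebesgue. x \<notin> Omega - I" by (rule AE_not_in)
  have "AE x in lebesgue. x \<in> Omega \<longrightarrow> g x \<le> 0"
    using 1 2 by eventually_elim (auto simp: P_def)
  then show ?thesis by (simp add: AE_restrict_space_iff)
qed

theorem fourier_completeness:
  fixes g :: "real^3 \<Rightarrow> real"
  assumes g: "integrable torus g" and orth: "\<And>k. (\<integral>x. of_real (g x) * mode k x \<partial>torus) = 0"
  shows "AE x in torus. g x = 0"
proof -
  have "AE x in torus. g x \<le> 0" by (rule orthogonal_nonpos[OF g orth])
  moreover have "AE x in torus. - g x \<le> 0"
    by (rule orthogonal_nonpos) (use g orth in auto)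
  ultimately show ?thesis by eventually_elim simp
qed

section \<open>Scalar Fourier coefficients and absolutely convergent series\<close>

definition fcoeff :: "(real^3 \<Rightarrow> real) \<Rightarrow> int^3 \<Rightarrow> complex" where
  "fcoeff g k = (\<integral>x. of_real (g x) * mode (- k) x \<partial>torus) / of_real ((2 * pi) ^ 3)"

lemma fcoeff_integral: "(\<integral>x. of_real (g x) * mode (- k) x \<partial>torus) = of_real ((2 * pi) ^ 3) * fcoeff g k"
  "(\<integral>x. of_real (g x) * mode k x \<partial>torus) = of_real ((2 * pi) ^ 3) * fcoeff g (- k)"
  by (simp_all add: fcoeff_def)

lemma fourier_coeff_nth: "fourier_coeff g k $ i = fcoeff (\<lambda>x. g x $ i) k"
  by (simp add: fourier_coeff_def fcoeff_def mode_def set_integral_Omega[symmetric])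

lemma fcoeff_minus: "fcoeff g (- k) = cnj (fcoeff g k)"
proof -
  have "cnj (\<integral>x. of_real (g x) * mode (- k) x \<partial>torus) = (\<integral>x. cnj (of_real (g x) * mode (- k) x) \<partial>torus)"
    by (rule Bochner_Integration.integral_cnj[symmetric])
  then show ?thesis by (simp add: fcoeff_def mode_simps)
qed

lemma integrable_of_real_mult_mode:
  assumes "integrable torus g" shows "integrable torus (\<lambda>x. complex_of_real (g x) * mode k x)"
  by (rule integrable_mult_mode) (use assms in simp)

lemma fcoeff_diff:
  assumes "integrable torus g" "integrable torus h"
  shows "fcoeff (\<lambda>x. g x - h x) k = fcoeff g k - fcoeff h k"
  using assms by (simp add: fcoeff_def left_diff_distrib integrable_of_real_mult_mode diff_divide_distrib)

lemma fcoeff_unique: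
  assumes "integrable torus g" "integrable torus h" "\<And>k. fcoeff g k = fcoeff h k"
  shows "AE x in torus. g x = h x"
proof -
  have "AE x in torus. g x - h x = 0"
  proof (rule fourier_completeness)
    show "integrable torus (\<lambda>x. g x - h x)" using assms by simp
    show "(\<integral>x. of_real (g x - h x) * mode k x \<partial>torus) = 0" for k
      using fcoeff_diff[OF assms(1,2), of "- k"] assms(3)[of "-k"] by (simp add: fcoeff_integral(2) del: of_real_diff)
  qed
  then show ?thesis by eventually_elim simp
qed

context
  fixes a :: "int^3 \<Rightarrow> complex"
  assumes sm: "(\<lambda>k. cmod (a k)) summable_on UNIV"
begin

lemma series_summable: "(\<lambda>k. a k * mode k x) summable_on UNIV"
  by (rule abs_summable_summable) (simp add: norm_mult mode_simps sm)

lemma series_continuous: "continuous_on UNIV (\<lambda>x. \<Sum>\<^sub>\<infinity>k. a k * mode k x)"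
proof (rule uniform_limit_theorem)
  show "uniform_limit UNIV (\<lambda>X x. \<Sum>k\<in>X. a k * mode k x) (\<lambda>x. \<Sum>\<^sub>\<infinity>k. a k * mode k x) (finite_subsets_at_top UNIV)"
    by (rule Weierstrass_m_test_general[OF _ sm]) (simp add: norm_mult mode_simps)
  show "\<forall>\<^sub>F X in finite_subsets_at_top UNIV. continuous_on UNIV (\<lambda>x. \<Sum>k\<in>X. a k * mode k x)"
    by (intro always_eventually allI continuous_intros)
qed simp

lemma series_periodic: "periodic (\<lambda>x. \<Sum>\<^sub>\<infinity>k. a k * mode k x)"
  using mode_periodic by (simp add: periodic_def)

text \<open>Term by term integration is justified by the majorant \<open>cmod (a k) * norm (w x)\<close>.\<close>

lemma integral_series_mult:
  assumes w: "integrable torus w"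
  shows "(\<integral>x. (\<Sum>\<^sub>\<infinity>k. a k * mode k x) * w x \<partial>torus) = (\<Sum>\<^sub>\<infinity>k. a k * (\<integral>x. mode k x * w x \<partial>torus))"
    and "integrable torus (\<lambda>x. (\<Sum>\<^sub>\<infinity>k. a k * mode k x) * w x)"
    and "(\<lambda>k. a k * (\<integral>x. mode k x * w x \<partial>torus)) summable_on UNIV"
proof -
  have eq: "(\<Sum>\<^sub>\<infinity>k. a k * mode k x * w x) = (\<Sum>\<^sub>\<infinity>k. a k * mode k x) * w x" for x
    by (rule infsum_cmult_left) (rule series_summable)
  have i: "integrable torus (\<lambda>x. a k * mode k x * w x)" for k
    using integrable_mult_right[OF integrable_mult_mode[OF w, of k], of "a k"] by (simp add: mult_ac)
  have s: "AE x in torus. (\<lambda>k. norm (a k * mode k x * w x)) summable_on UNIV"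
    by (simp add: norm_mult mode_simps summable_on_cmult_left[OF sm])
  have m: "(\<lambda>x. \<Sum>\<^sub>\<infinity>k. a k * mode k x * w x) \<in> borel_measurable torus"
    unfolding eq
    by (intro borel_measurable_times borel_measurable_integrable[OF w]
        borel_measurable_integrable[OF integrable_torus_continuous[OF series_continuous]])
  have n: "(\<lambda>k. \<integral>x. norm (a k * mode k x * w x) \<partial>torus) summable_on UNIV"
    by (simp add: norm_mult mode_simps summable_on_cmult_left[OF sm])
  note R = integral_infsum[OF infinite_lattice i s m n]
  show "integrable torus (\<lambda>x. (\<Sum>\<^sub>\<infinity>k. a k * mode k x) * w x)" using R(1) by (simp add: eq)
  show "(\<integral>x. (\<Sum>\<^sub>\<infinity>k. a k * mode k x) * w x \<partial>torus) = (\<Sum>\<^sub>\<infinity>k. a k * (\<integral>x. mode k x * w x \<partial>torus))"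
  proof -
    have "(\<integral>x. a k * mode k x * w x \<partial>torus) = a k * (\<integral>x. mode k x * w x \<partial>torus)" for k
      by (simp add: mult.assoc)
    then show ?thesis using R(2) by (simp only: eq)
  qed
  show "(\<lambda>k. a k * (\<integral>x. mode k x * w x \<partial>torus)) summable_on UNIV"
    using R(3) by (simp add: mult.assoc)
qed

lemma series_coeff:
  "(\<integral>x. (\<Sum>\<^sub>\<infinity>k. a k * mode k x) * mode (- l) x \<partial>torus) = of_real ((2 * pi) ^ 3) * a l"
proof -
  have "(\<integral>x. (\<Sum>\<^sub>\<infinity>k. a k * mode k x) * mode (- l) x \<partial>torus) = (\<Sum>\<^sub>\<infinity>k. a k * (\<integral>x. mode k x * mode (- l) x \<partial>torus))"
    by (rule integral_series_mult(1)[OF integrable_torus_continuous[OF mode_continuous]])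
  also have "\<dots> = (\<Sum>\<^sub>\<infinity>k. a k * (\<integral>x. mode (k - l) x \<partial>torus))"
    by (simp add: mode_simps(2)[symmetric])
  also have "\<dots> = (\<Sum>\<^sub>\<infinity>k\<in>{l}. a k * (\<integral>x. mode (k - l) x \<partial>torus))"
    by (rule infsum_cong_neutral) (auto simp: mode_integral)
  finally show ?thesis by (simp add: mode_integral)
qed

text \<open>For a Hermitian family the summands at \<open>k\<close> and \<open>- k\<close> are conjugate, so that the sum is already real and the
  projection to the real part loses nothing.\<close>

definition real_series :: "real^3 \<Rightarrow> real" where
  "real_series x = Re (\<Sum>\<^sub>\<infinity>k. a k * mode k x)"

context
  assumes herm: "\<And>k. a (- k) = cnj (a k)"
begin

lemma of_real_series: "complex_of_real (real_series x) = (\<Sum>\<^sub>\<infinity>k. a k * mode k x)"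
proof -
  have "cnj (\<Sum>\<^sub>\<infinity>k. a k * mode k x) = (\<Sum>\<^sub>\<infinity>k. a (- k) * mode (- k) x)"
    by (simp add: infsum_cnj[symmetric] herm mode_simps)
  also have "\<dots> = (\<Sum>\<^sub>\<infinity>k. a k * mode k x)"
    by (rule infsum_reindex_bij_witness[of _ uminus uminus]) auto
  finally show ?thesis by (simp add: real_series_def complex_eq_iff)
qed

lemma real_series_continuous: "continuous_on UNIV real_series"
  unfolding real_series_def by (intro continuous_intros series_continuous)

lemma real_series_periodic: "periodic real_series"
  using series_periodic by (simp add: periodic_def real_series_def)

lemma fcoeff_real_series: "fcoeff real_series k = a k"
  by (simp add: fcoeff_def of_real_series series_coeff)

end
end

text \<open>The function and the sum of its series are integrable with the same coefficients, so completeness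
  identifies them.\<close>

lemma fcoeff_series_AE:
  assumes g: "integrable torus g" and sm: "(\<lambda>k. cmod (fcoeff g k)) summable_on UNIV"
  shows "AE x in torus. complex_of_real (g x) = (\<Sum>\<^sub>\<infinity>k. fcoeff g k * mode k x)"
proof -
  have "AE x in torus. g x = real_series (fcoeff g) x"
    by (rule fcoeff_unique[OF g integrable_torus_continuous[OF real_series_continuous[OF sm fcoeff_minus]]])
      (simp add: fcoeff_real_series[OF sm fcoeff_minus])
  then show ?thesis
    by eventually_elim (simp add: of_real_series[OF sm fcoeff_minus])
qed

text \<open>Almost everywhere \<open>g\<close> is a uniformly convergent series, which can be integrated term by term against \<open>w\<close>.
  In particular the product is integrable although \<open>w\<close> is only integrable.\<close>

lemma fcoeff_integral_mult:
  fixes w :: "real^3 \<Rightarrow> complex"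
  assumes g: "integrable torus g" and sm: "(\<lambda>k. cmod (fcoeff g k)) summable_on UNIV" and w: "integrable torus w"
  shows "(\<integral>x. of_real (g x) * w x \<partial>torus) = (\<Sum>\<^sub>\<infinity>k. fcoeff g k * (\<integral>x. mode k x * w x \<partial>torus))"
    and "integrable torus (\<lambda>x. of_real (g x) * w x)"
    and "(\<lambda>k. fcoeff g k * (\<integral>x. mode k x * w x \<partial>torus)) summable_on UNIV"
proof -
  have ae: "AE x in torus. (\<Sum>\<^sub>\<infinity>k. fcoeff g k * mode k x) * w x = of_real (g x) * w x"
    using fcoeff_series_AE[OF g sm] by eventually_elim simp
  have m: "(\<lambda>x. of_real (g x) * w x) \<in> borel_measurable torus" using g w by simp
  note S = integral_series_mult[OF sm w]
  show "integrable torus (\<lambda>x. of_real (g x) * w x)"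
    by (rule Bochner_Integration.integrable_cong_AE_imp[OF S(2) m ae])
  have "(\<integral>x. (\<Sum>\<^sub>\<infinity>k. fcoeff g k * mode k x) * w x \<partial>torus) = (\<integral>x. of_real (g x) * w x \<partial>torus)"
    by (rule integral_cong_AE[OF _ m ae]) (use S(2) in auto)
  then show "(\<integral>x. of_real (g x) * w x \<partial>torus) = (\<Sum>\<^sub>\<infinity>k. fcoeff g k * (\<integral>x. mode k x * w x \<partial>torus))"
    using S(1) by simp
  show "(\<lambda>k. fcoeff g k * (\<integral>x. mode k x * w x \<partial>torus)) summable_on UNIV" by (rule S(3))
qed

lemma fcoeff_parseval:
  assumes g: "integrable torus g" and sm: "(\<lambda>k. cmod (fcoeff g k)) summable_on UNIV" and h: "integrable torus h"
  shows "complex_of_real (\<integral>x. g x * h x \<partial>torus) = of_real ((2 * pi) ^ 3) * (\<Sum>\<^sub>\<infinity>k. fcoeff g k * cnj (fcoeff h k))"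
    and "integrable torus (\<lambda>x. g x * h x)"
    and "(\<lambda>k. fcoeff g k * cnj (fcoeff h k)) summable_on UNIV"
proof -
  have h': "integrable torus (\<lambda>x. complex_of_real (h x))" using h by simp
  have m: "(\<integral>x. mode k x * of_real (h x) \<partial>torus) = of_real ((2 * pi) ^ 3) * cnj (fcoeff h k)" for k
    using fcoeff_integral(2)[of h k] by (simp add: fcoeff_minus mult.commute)
  note R = fcoeff_integral_mult[OF g sm h']
  have "complex_of_real (\<integral>x. g x * h x \<partial>torus) = (\<integral>x. of_real (g x) * of_real (h x) \<partial>torus)"
    unfolding integral_complex_of_real[symmetric] by simp
  also have "\<dots> = (\<Sum>\<^sub>\<infinity>k. of_real ((2 * pi) ^ 3) * (fcoeff g k * cnj (fcoeff h k)))"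
    unfolding R(1) m by (simp add: mult_ac)
  also have "\<dots> = of_real ((2 * pi) ^ 3) * (\<Sum>\<^sub>\<infinity>k. fcoeff g k * cnj (fcoeff h k))"
    by (rule infsum_cmult_right')
  finally show "complex_of_real (\<integral>x. g x * h x \<partial>torus) = of_real ((2 * pi) ^ 3) * (\<Sum>\<^sub>\<infinity>k. fcoeff g k * cnj (fcoeff h k))" .
  show "integrable torus (\<lambda>x. g x * h x)"
    using R(2) by (simp only: of_real_mult[symmetric] complex_of_real_integrable_eq)
  have "(\<lambda>k. of_real ((2 * pi) ^ 3) * (fcoeff g k * cnj (fcoeff h k))) summable_on UNIV"
    using R(3) unfolding m by (simp add: mult_ac)
  then show "(\<lambda>k. fcoeff g k * cnj (fcoeff h k)) summable_on UNIV"
    by (subst (asm) summable_on_cmult_right') auto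
qed

text \<open>Expand the integral of \<open>\<bar>g - p\<bar>\<^sup>2 \<ge> 0\<close> for the partial sum \<open>p\<close> of the Fourier series over \<open>F\<close>.\<close>

lemma fcoeff_bessel:
  assumes g: "integrable torus g" and g2: "integrable torus (\<lambda>x. (g x)\<^sup>2)" and F: "finite F"
  shows "(2 * pi) ^ 3 * (\<Sum>k\<in>F. (cmod (fcoeff g k))\<^sup>2) \<le> (\<integral>x. (g x)\<^sup>2 \<partial>torus)"
proof -
  define V where "V = (2 * pi) ^ 3"
  define p where "p x = (\<Sum>k\<in>F. fcoeff g k * mode k x)" for x
  define S where "S = (\<Sum>k\<in>F. (cmod (fcoeff g k))\<^sup>2)"
  have pc: "continuous_on UNIV p" unfolding p_def by (intro continuous_intros)
  have gp: "(\<integral>x. of_real (g x) * p x \<partial>torus) = of_real (V * S)" "integrable torus (\<lambda>x. of_real (g x) * p x)"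
  proof -
    have eq: "of_real (g x) * p x = (\<Sum>k\<in>F. fcoeff g k * (of_real (g x) * mode k x))" for x
      by (simp add: p_def sum_distrib_left mult_ac)
    show "integrable torus (\<lambda>x. of_real (g x) * p x)" unfolding eq
      by (intro Bochner_Integration.integrable_sum integrable_mult_right integrable_of_real_mult_mode g)
    have "(\<integral>x. of_real (g x) * p x \<partial>torus) = (\<Sum>k\<in>F. fcoeff g k * (\<integral>x. of_real (g x) * mode k x \<partial>torus))" unfolding eq
      by (subst Bochner_Integration.integral_sum)
        (auto intro!: integrable_mult_right integrable_of_real_mult_mode g)
    also have "\<dots> = (\<Sum>k\<in>F. of_real V * (fcoeff g k * cnj (fcoeff g k)))"
      by (intro sum.cong refl, subst fcoeff_integral(2)) (simp add: fcoeff_minus V_def mult_ac)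
    also have "\<dots> = of_real (V * S)"
      by (simp add: S_def sum_distrib_left complex_norm_square[symmetric] del: of_real_power) 
    finally show "(\<integral>x. of_real (g x) * p x \<partial>torus) = of_real (V * S)" .
  qed
  have pp: "(\<integral>x. p x * cnj (p x) \<partial>torus) = of_real (V * S)"
  proof -
    have eq: "p x * cnj (p x) = (\<Sum>k\<in>F. \<Sum>l\<in>F. (fcoeff g k * cnj (fcoeff g l)) * mode (k - l) x)" for x
    proof -
      have m: "mode (k - l) x = mode k x * mode (- l) x" for k l using mode_simps(2)[of k "- l" x] by simp
      show ?thesis by (simp add: p_def sum_product mode_simps(3) m mult_ac)
    qed
    have "(\<integral>x. p x * cnj (p x) \<partial>torus) = (\<Sum>k\<in>F. \<Sum>l\<in>F. (fcoeff g k * cnj (fcoeff g l)) * (\<integral>x. mode (k - l) x \<partial>torus))"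
      unfolding eq by (simp add: integrable_torus_continuous mode_continuous)
    also have "\<dots> = (\<Sum>k\<in>F. \<Sum>l\<in>F. if k = l then (fcoeff g k * cnj (fcoeff g l)) * of_real V else 0)"
      by (intro sum.cong refl) (simp add: mode_integral V_def)
    also have "\<dots> = (\<Sum>k\<in>F. of_real V * (fcoeff g k * cnj (fcoeff g k)))"
      using F by (simp add: sum.delta' mult_ac)
    also have "\<dots> = of_real (V * S)"
      by (simp add: S_def sum_distrib_left complex_norm_square[symmetric] del: of_real_power) 
    finally show ?thesis .
  qed
  have ri: "integrable torus (\<lambda>x. g x * Re (p x))"
    using integrable_Re[OF gp(2)] by simp
  have r: "(\<integral>x. g x * Re (p x) \<partial>torus) = V * S"
  proof -
    have "(\<integral>x. Re (of_real (g x) * p x) \<partial>torus) = Re (\<integral>x. of_real (g x) * p x \<partial>torus)"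
      by (rule integral_Re[OF gp(2)])
    then show ?thesis by (simp add: gp(1))
  qed
  have pi2: "integrable torus (\<lambda>x. (cmod (p x))\<^sup>2)"
    by (intro integrable_torus_continuous continuous_intros pc)
  have p2: "(\<integral>x. (cmod (p x))\<^sup>2 \<partial>torus) = V * S"
  proof -
    have "complex_of_real (\<integral>x. (cmod (p x))\<^sup>2 \<partial>torus) = (\<integral>x. p x * cnj (p x) \<partial>torus)"
      unfolding complex_norm_square[symmetric] integral_complex_of_real[symmetric] by simp
    then show ?thesis unfolding pp of_real_eq_iff .
  qed
  have "0 \<le> (\<integral>x. (g x)\<^sup>2 - 2 * (g x * Re (p x)) + (cmod (p x))\<^sup>2 \<partial>torus)"
  proof (rule Bochner_Integration.integral_nonneg)
    fix x
    have "0 \<le> (g x - Re (p x))\<^sup>2 + (Im (p x))\<^sup>2" by simp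
    then show "0 \<le> (g x)\<^sup>2 - 2 * (g x * Re (p x)) + (cmod (p x))\<^sup>2"
      by (simp add: cmod_power2 power2_diff algebra_simps)
  qed
  also have "\<dots> = (\<integral>x. (g x)\<^sup>2 \<partial>torus) - 2 * (V * S) + V * S"
    using g2 ri pi2 by (simp add: r p2)
  finally show ?thesis by (simp add: V_def S_def)
qed

section \<open>Fourier coefficients of vector fields\<close>

lemma has_sum_finite_sum:
  fixes f :: "'j \<Rightarrow> 'i \<Rightarrow> 'b::topological_comm_monoid_add"
  assumes "finite J" "\<And>j. j \<in> J \<Longrightarrow> (f j has_sum s j) A"
  shows "((\<lambda>k. \<Sum>j\<in>J. f j k) has_sum (\<Sum>j\<in>J. s j)) A"
  using assms by (induction J) (auto intro: has_sum_add)

lemma norm_sq_vec3: "(norm (v :: complex^3))\<^sup>2 = (\<Sum>i\<in>UNIV. (cmod (v $ i))\<^sup>2)"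
  by (simp add: norm_vec_def L2_set_def sum_nonneg)

lemma L2inner_torus: "L2inner g h = (\<integral>x. g x \<bullet> h x \<partial>torus)"
  by (simp add: L2inner_def set_integral_Omega)

lemma L2norm_torus: "(L2norm g)\<^sup>2 = (\<integral>x. (norm (g x))\<^sup>2 \<partial>torus)"
  by (simp add: L2norm_def set_integral_Omega)

lemma L2norm_nonneg: "L2norm g \<ge> 0"
  by (simp add: L2norm_def set_integral_Omega)

text \<open>Square integrable functions are integrable on the cube because \<open>2 * \<bar>y\<bar> \<le> 1 + y\<^sup>2\<close> and the measure is finite.\<close>

lemma L2per_bounded_linear:
  fixes g :: "real^3 \<Rightarrow> 'b::euclidean_space" and f :: "'b \<Rightarrow> real"
  assumes g: "g \<in> L2per" and f: "bounded_linear f"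
  shows "integrable torus (\<lambda>x. f (g x))" "integrable torus (\<lambda>x. (f (g x))\<^sup>2)"
proof -
  interpret fin: finite_measure torus by (rule finite_measure_torus)
  interpret f: bounded_linear f by (rule f)
  obtain K where K: "\<And>y. norm (f y) \<le> norm y * K" using f.bounded by blast
  have gm: "g \<in> borel_measurable torus" using g by (auto simp: L2per_def intro: measurable_restrict_space1)
  have fm: "(\<lambda>x. f (g x)) \<in> borel_measurable torus"
    by (rule borel_measurable_continuous_on[OF _ gm]) (intro linear_continuous_on f)
  have g2: "integrable torus (\<lambda>x. (norm (g x))\<^sup>2)"
    using g by (simp add: L2per_def set_integrable_Omega)
  show sq: "integrable torus (\<lambda>x. (f (g x))\<^sup>2)"
  proof (rule Bochner_Integration.integrable_bound[of _ "\<lambda>x. K\<^sup>2 * (norm (g x))\<^sup>2"])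
    show "AE x in torus. norm ((f (g x))\<^sup>2) \<le> norm (K\<^sup>2 * (norm (g x))\<^sup>2)"
    proof (rule AE_I2)
      fix x
      have "\<bar>f (g x)\<bar>\<^sup>2 \<le> (norm (g x) * K)\<^sup>2" using K[of "g x"] by (intro power_mono) auto
      then show "norm ((f (g x))\<^sup>2) \<le> norm (K\<^sup>2 * (norm (g x))\<^sup>2)"
        by (simp add: power_mult_distrib mult.commute)
    qed
  qed (use g2 fm in auto)
  show "integrable torus (\<lambda>x. f (g x))"
  proof (rule Bochner_Integration.integrable_bound[of _ "\<lambda>x. 1 + (f (g x))\<^sup>2"])
    show "AE x in torus. norm (f (g x)) \<le> norm (1 + (f (g x))\<^sup>2)"
    proof (rule AE_I2)
      fix x
      have "2 * \<bar>f (g x)\<bar> \<le> 1 + \<bar>f (g x)\<bar>\<^sup>2" using sum_squares_bound[of 1 "\<bar>f (g x)\<bar>"] by simp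
      then show "norm (f (g x)) \<le> norm (1 + (f (g x))\<^sup>2)" by (simp add: abs_if split: if_splits)
    qed
  qed (use sq fm in auto)
qed

lemma L2per_component:
  fixes g :: "real^3 \<Rightarrow> real^3"
  assumes "g \<in> L2per"
  shows "integrable torus (\<lambda>x. g x $ i)" "integrable torus (\<lambda>x. (g x $ i)\<^sup>2)"
  using L2per_bounded_linear[OF assms bounded_linear_vec_nth] by auto

lemma L2inner_components:
  fixes g h :: "real^3 \<Rightarrow> real^3"
  assumes "\<And>i. integrable torus (\<lambda>x. g x $ i * h x $ i)"
  shows "L2inner g h = (\<Sum>i\<in>UNIV. \<integral>x. g x $ i * h x $ i \<partial>torus)"
  using assms by (simp add: L2inner_torus inner_vec_def)

lemma L2norm_components:
  fixes g :: "real^3 \<Rightarrow> real^3"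
  assumes "g \<in> L2per"
  shows "(L2norm g)\<^sup>2 = (\<Sum>i\<in>UNIV. \<integral>x. (g x $ i)\<^sup>2 \<partial>torus)"
proof -
  have "(norm v)\<^sup>2 = (\<Sum>i\<in>UNIV. (v $ i)\<^sup>2)" for v :: "real^3"
    by (simp add: norm_vec_def L2_set_def sum_nonneg)
  then show ?thesis using L2per_component(2)[OF assms] by (simp add: L2norm_torus)
qed

lemma H_space_L2per: "g \<in> H_space \<Longrightarrow> g \<in> L2per" by (simp add: H_space_def)

theorem bessel_inequality:
  fixes g :: "real^3 \<Rightarrow> real^3"
  assumes g: "g \<in> L2per"
  shows "finite F \<Longrightarrow> (2 * pi) ^ 3 * (\<Sum>k\<in>F. (norm (fourier_coeff g k))\<^sup>2) \<le> (L2norm g)\<^sup>2"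
    and "(\<lambda>k. (norm (fourier_coeff g k))\<^sup>2) summable_on UNIV"
    and "(2 * pi) ^ 3 * (\<Sum>\<^sub>\<infinity>k. (norm (fourier_coeff g k))\<^sup>2) \<le> (L2norm g)\<^sup>2"
proof -
  have 1: "(2 * pi) ^ 3 * (\<Sum>k\<in>F. (norm (fourier_coeff g k))\<^sup>2) \<le> (L2norm g)\<^sup>2" if F: "finite F" for F
  proof -
    have "(2 * pi) ^ 3 * (\<Sum>k\<in>F. (norm (fourier_coeff g k))\<^sup>2)
        = (\<Sum>i\<in>UNIV. (2 * pi) ^ 3 * (\<Sum>k\<in>F. (cmod (fcoeff (\<lambda>x. g x $ i) k))\<^sup>2))"
      unfolding norm_sq_vec3 fourier_coeff_nth sum_distrib_left[symmetric] by (subst sum.swap) simp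
    also have "\<dots> \<le> (\<Sum>i\<in>UNIV. \<integral>x. (g x $ i)\<^sup>2 \<partial>torus)"
      by (intro sum_mono fcoeff_bessel F L2per_component g)
    finally show ?thesis by (simp add: L2norm_components[OF g])
  qed
  then show "finite F \<Longrightarrow> (2 * pi) ^ 3 * (\<Sum>k\<in>F. (norm (fourier_coeff g k))\<^sup>2) \<le> (L2norm g)\<^sup>2" .
  have 2: "(\<Sum>k\<in>F. (norm (fourier_coeff g k))\<^sup>2) \<le> (L2norm g)\<^sup>2 / (2 * pi) ^ 3" if "finite F" for F
    using 1[OF that] by (simp add: pos_le_divide_eq mult.commute)
  show s: "(\<lambda>k. (norm (fourier_coeff g k))\<^sup>2) summable_on UNIV"
    by (rule nonneg_bdd_above_summable_on) (use 2 in \<open>auto intro!: bdd_aboveI[of _ "(L2norm g)\<^sup>2 / (2 * pi) ^ 3"]\<close>)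
  have "(\<Sum>\<^sub>\<infinity>k. (norm (fourier_coeff g k))\<^sup>2) \<le> (L2norm g)\<^sup>2 / (2 * pi) ^ 3"
    by (rule infsum_le_finite_sums[OF s]) (use 2 in auto)
  then show "(2 * pi) ^ 3 * (\<Sum>\<^sub>\<infinity>k. (norm (fourier_coeff g k))\<^sup>2) \<le> (L2norm g)\<^sup>2"
    by (simp add: pos_le_divide_eq mult.commute)
qed

lemma cmod_fourier_coeff_nth: "cmod (fcoeff (\<lambda>x. g x $ i) k) \<le> norm (fourier_coeff g k)"
  using Finite_Cartesian_Product.norm_nth_le[of "fourier_coeff g k" i]
  by (simp add: fourier_coeff_nth)

lemma summable_fourier_component:
  assumes "(\<lambda>k. norm (fourier_coeff g k)) summable_on UNIV"
  shows "(\<lambda>k. cmod (fcoeff (\<lambda>x. g x $ i) k)) summable_on UNIV"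
  by (rule summable_on_comparison_test[OF assms]) (auto simp: cmod_fourier_coeff_nth)

text \<open>Parseval in polarised form.  Summable coefficients make \<open>g\<close> essentially bounded, so \<open>h\<close> may be
  merely integrable; this is used with \<open>h\<close> the nonlinear term.\<close>

theorem parseval_summable:
  fixes g h :: "real^3 \<Rightarrow> real^3"
  assumes g: "\<And>i. integrable torus (\<lambda>x. g x $ i)" and sm: "(\<lambda>k. norm (fourier_coeff g k)) summable_on UNIV"
    and h: "\<And>i. integrable torus (\<lambda>x. h x $ i)"
  shows "((\<lambda>k. (2 * pi) ^ 3 * (fourier_coeff g k \<bullet> fourier_coeff h k)) has_sum L2inner g h) UNIV"
proof -
  note P = fcoeff_parseval[OF g summable_fourier_component[OF sm] h]
  have "((\<lambda>k. (2 * pi) ^ 3 * (fcoeff (\<lambda>x. g x $ i) k \<bullet> fcoeff (\<lambda>x. h x $ i) k)) has_sum (\<integral>x. g x $ i * h x $ i \<partial>torus)) UNIV" for i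
  proof -
    have "((\<lambda>k. of_real ((2 * pi) ^ 3) * (fcoeff (\<lambda>x. g x $ i) k * cnj (fcoeff (\<lambda>x. h x $ i) k))) has_sum
        complex_of_real (\<integral>x. g x $ i * h x $ i \<partial>torus)) UNIV"
      unfolding P(1)[of i i] by (intro has_sum_cmult_right has_sum_infsum P(3))
    then have "((\<lambda>k. Re (of_real ((2 * pi) ^ 3) * (fcoeff (\<lambda>x. g x $ i) k * cnj (fcoeff (\<lambda>x. h x $ i) k)))) has_sum
        Re (complex_of_real (\<integral>x. g x $ i * h x $ i \<partial>torus))) UNIV"
      by (rule has_sum_Re)
    moreover have "Re (of_real ((2 * pi) ^ 3) * (z * cnj w)) = (2 * pi) ^ 3 * (z \<bullet> w)" for z w
      by (simp add: inner_complex_def del: of_real_power)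
    ultimately show ?thesis by simp
  qed
  then have "((\<lambda>k. \<Sum>i\<in>UNIV. (2 * pi) ^ 3 * (fcoeff (\<lambda>x. g x $ i) k \<bullet> fcoeff (\<lambda>x. h x $ i) k)) has_sum
      (\<Sum>i\<in>UNIV. \<integral>x. g x $ i * h x $ i \<partial>torus)) UNIV"
    by (intro has_sum_finite_sum) auto
  moreover have "L2inner g h = (\<Sum>i\<in>UNIV. \<integral>x. g x $ i * h x $ i \<partial>torus)"
    by (rule L2inner_components) (rule P(2))
  ultimately show ?thesis
    by (simp add: inner_vec_def fourier_coeff_nth sum_distrib_left)
qed

section \<open>Fields in \<open>H\<close> and their coefficients\<close>

text \<open>The conditions on coefficients that say that a field is real, divergence-free and of mean zero.\<close>

definition H_coeffs :: "(int^3 \<Rightarrow> complex^3) \<Rightarrow> bool" where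
  "H_coeffs a \<longleftrightarrow> (\<forall>k i. a (- k) $ i = cnj (a k $ i)) \<and> (\<forall>k. (\<Sum>i\<in>UNIV. of_int (k $ i) * a k $ i) = 0) \<and> a 0 = 0"

text \<open>The weak divergence condition is tested with \<open>sin (k \<bullet> x)\<close> and \<open>cos (k \<bullet> x)\<close>.\<close>

lemma H_space_coeffs:
  assumes g: "g \<in> H_space"
  shows "H_coeffs (fourier_coeff g)"
  unfolding H_coeffs_def
proof (intro conjI allI)
  have L: "g \<in> L2per" by (rule H_space_L2per[OF g])
  note ci = L2per_component(1)[OF L]
  show "fourier_coeff g (- k) $ i = cnj (fourier_coeff g k $ i)" for k i
    by (simp add: fourier_coeff_nth fcoeff_minus)
  have gm: "g \<in> borel_measurable torus" using L by (auto simp: L2per_def intro: measurable_restrict_space1)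
  have "integrable torus g"
  proof (rule Bochner_Integration.integrable_bound[of _ "\<lambda>x. \<Sum>i\<in>UNIV. \<bar>g x $ i\<bar>"])
    show "integrable torus (\<lambda>x. \<Sum>i\<in>UNIV. \<bar>g x $ i\<bar>)" using ci by simp
    show "AE x in torus. norm (g x) \<le> norm (\<Sum>i\<in>UNIV. \<bar>g x $ i\<bar>)"
      using norm_le_l1_cart[of "g _"] by (intro AE_I2) (simp add: sum_nonneg)
  qed (rule gm)
  then have "(\<integral>x. g x $ i \<partial>torus) = (\<integral>x. g x \<partial>torus) $ i" for i
    by (rule integral_bounded_linear[OF bounded_linear_vec_nth])
  then have z: "(\<integral>x. g x $ i \<partial>torus) = 0" for i using g by (simp add: H_space_def set_integral_Omega)
  show "fourier_coeff g 0 = 0"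
    by (simp add: vec_eq_iff fourier_coeff_nth fcoeff_def mode_simps z)
  fix k
  have df: "L2inner g d\<psi> = 0" if "test_fun \<psi> d\<psi>" for \<psi> d\<psi> using g that by (auto simp: H_space_def div_free_def)
  have i: "integrable torus (\<lambda>x. g x $ i * sin (real_vec k \<bullet> x))" "integrable torus (\<lambda>x. g x $ i * cos (real_vec k \<bullet> x))" for i
  proof -
    have m: "integrable torus (\<lambda>x. g x $ i * b x)" if "continuous_on UNIV b" "\<And>x. \<bar>b x\<bar> \<le> 1" for b
    proof (rule Bochner_Integration.integrable_bound[OF ci[of i]])
      show "(\<lambda>x. g x $ i * b x) \<in> borel_measurable torus"
        by (intro borel_measurable_times borel_measurable_integrable[OF ci]
            borel_measurable_integrable[OF integrable_torus_continuous[OF that(1)]])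
    qed (use that(2) in \<open>auto simp: abs_mult intro!: mult_left_le\<close>)
    show "integrable torus (\<lambda>x. g x $ i * sin (real_vec k \<bullet> x))" "integrable torus (\<lambda>x. g x $ i * cos (real_vec k \<bullet> x))"
      by (auto intro!: m continuous_intros)
  qed
  have s: "(\<Sum>i\<in>UNIV. of_int (k $ i) * (\<integral>x. g x $ i * sin (real_vec k \<bullet> x) \<partial>torus)) = 0"
  proof -
    have "L2inner g (\<lambda>x. - (sin (real_vec k \<bullet> x) *\<^sub>R real_vec k)) = 0" by (rule df[OF test_fun_cos])
    moreover have "L2inner g (\<lambda>x. - (sin (real_vec k \<bullet> x) *\<^sub>R real_vec k)) = - (\<Sum>i\<in>UNIV. of_int (k $ i) * (\<integral>x. g x $ i * sin (real_vec k \<bullet> x) \<partial>torus))"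
    proof -
      have e: "g x $ i * (- (sin (real_vec k \<bullet> x) *\<^sub>R real_vec k)) $ i = - (of_int (k $ i) * (g x $ i * sin (real_vec k \<bullet> x)))" for x i
        by simp
      show ?thesis using i by (subst L2inner_components; simp only: e) (simp_all add: sum_negf)
    qed
    ultimately show ?thesis by simp
  qed
  have c: "(\<Sum>i\<in>UNIV. of_int (k $ i) * (\<integral>x. g x $ i * cos (real_vec k \<bullet> x) \<partial>torus)) = 0"
  proof -
    have "L2inner g (\<lambda>x. cos (real_vec k \<bullet> x) *\<^sub>R real_vec k) = 0" by (rule df[OF test_fun_sin])
    moreover have "L2inner g (\<lambda>x. cos (real_vec k \<bullet> x) *\<^sub>R real_vec k) = (\<Sum>i\<in>UNIV. of_int (k $ i) * (\<integral>x. g x $ i * cos (real_vec k \<bullet> x) \<partial>torus))"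
    proof -
      have e: "g x $ i * (cos (real_vec k \<bullet> x) *\<^sub>R real_vec k) $ i = of_int (k $ i) * (g x $ i * cos (real_vec k \<bullet> x))" for x i
        by simp
      show ?thesis using i by (subst L2inner_components; simp only: e) simp_all
    qed
    ultimately show ?thesis by simp
  qed
  define J where "J i = (\<integral>x. of_real (g x $ i) * mode (- k) x \<partial>torus)" for i
  have "Re (J i) = (\<integral>x. g x $ i * cos (real_vec k \<bullet> x) \<partial>torus)"
    "Im (J i) = - (\<integral>x. g x $ i * sin (real_vec k \<bullet> x) \<partial>torus)" for i
    using integrable_of_real_mult_mode[OF ci[of i], of "-k"]
    by (simp_all add: J_def integral_Re[symmetric] integral_Im[symmetric] mode_cis)
  then have "Re (\<Sum>i\<in>UNIV. of_int (k $ i) * J i) = 0" "Im (\<Sum>i\<in>UNIV. of_int (k $ i) * J i) = 0"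
    using s c by (simp_all add: sum_negf)
  then have "(\<Sum>i\<in>UNIV. of_int (k $ i) * J i) = 0" by (simp add: complex_eq_iff)
  then show "(\<Sum>i\<in>UNIV. of_int (k $ i) * fourier_coeff g k $ i) = 0"
    by (simp add: fourier_coeff_nth fcoeff_def J_def[symmetric] sum_divide_distrib[symmetric])
qed

lemma L2per_continuous:
  fixes g :: "real^3 \<Rightarrow> 'b::euclidean_space"
  assumes "continuous_on UNIV g" "periodic g"
  shows "g \<in> L2per"
  unfolding L2per_def
proof (intro CollectI conjI)
  show "g \<in> borel_measurable lebesgue"
    using assms(1) continuous_imp_measurable_on_sets_lebesgue[of UNIV g] by (simp add: lebesgue_on_UNIV_eq)
  show "set_integrable lebesgue Omega (\<lambda>x. (norm (g x))\<^sup>2)"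
    unfolding set_integrable_Omega by (intro integrable_torus_continuous continuous_intros assms)
qed (rule assms)

text \<open>Every element of \<open>H\<close> that has to be constructed is obtained here, as the sum of its Fourier series.\<close>

lemma H_coeffs_field:
  assumes a: "H_coeffs a" and sm: "(\<lambda>k. norm (a k)) summable_on UNIV"
  obtains h where "h \<in> H_space" "\<And>k. fourier_coeff h k = a k"
proof -
  define h where "h x = (\<chi> i. real_series (\<lambda>k. a k $ i) x)" for x
  have smi: "(\<lambda>k. cmod (a k $ i)) summable_on UNIV" for i
    by (rule summable_on_comparison_test[OF sm]) (auto simp: Finite_Cartesian_Product.norm_nth_le)
  have hm: "a (- k) $ i = cnj (a k $ i)" for k i using a by (auto simp: H_coeffs_def)
  note rs = real_series_continuous[OF smi hm] real_series_periodic[OF smi hm] fcoeff_real_series[OF smi hm]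
  have hc: "continuous_on UNIV h" unfolding h_def by (intro continuous_on_vec_lambda rs)
  have hp: "periodic h" unfolding h_def using rs(2) by (simp add: periodic_def)
  have L: "h \<in> L2per" by (rule L2per_continuous[OF hc hp])
  have co: "fourier_coeff h k = a k" for k
    by (simp add: vec_eq_iff fourier_coeff_nth h_def rs(3))
  have "(\<integral>x. h x \<partial>torus) $ i = 0" for i
  proof -
    have "(\<integral>x. h x \<partial>torus) $ i = (\<integral>x. h x $ i \<partial>torus)"
      by (rule integral_bounded_linear[OF bounded_linear_vec_nth integrable_torus_continuous[OF hc], symmetric])
    moreover have "complex_of_real (\<integral>x. h x $ i \<partial>torus) = of_real ((2 * pi) ^ 3) * fourier_coeff h 0 $ i"
      by (simp only: fourier_coeff_nth fcoeff_integral(1)[symmetric])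
        (simp add: mode_simps)
    ultimately show ?thesis using a by (simp add: co H_coeffs_def)
  qed
  then have mz: "(\<integral>x. h x \<partial>torus) = 0" by (simp add: vec_eq_iff)
  have df: "div_free h" unfolding div_free_def
  proof (intro allI impI)
    fix \<psi> d\<psi> assume t: "test_fun \<psi> d\<psi>"
    have dc: "continuous_on UNIV d\<psi>" and pc: "continuous_on UNIV \<psi>"
      using t test_fun_continuous by (auto simp: test_fun_def)
    have di: "integrable torus (\<lambda>x. complex_of_real (d\<psi> x $ i))" for i
      by (intro integrable_torus_continuous continuous_intros dc)
    have hs: "complex_of_real (h x $ i) = (\<Sum>\<^sub>\<infinity>k. a k $ i * mode k x)" for x i
      by (simp add: h_def of_real_series[OF smi hm])
    have eq: "complex_of_real (\<integral>x. h x $ i * d\<psi> x $ i \<partial>torus)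
        = (\<Sum>\<^sub>\<infinity>k. a k $ i * (\<integral>x. mode k x * of_real (d\<psi> x $ i) \<partial>torus))" for i
      unfolding integral_complex_of_real[symmetric] of_real_mult hs
      by (rule integral_series_mult(1)[OF smi di])
    have si: "(\<lambda>k. a k $ i * (\<integral>x. mode k x * of_real (d\<psi> x $ i) \<partial>torus)) summable_on UNIV" for i
      by (rule integral_series_mult(3)[OF smi di])
    have "(\<Sum>i\<in>UNIV. complex_of_real (\<integral>x. h x $ i * d\<psi> x $ i \<partial>torus))
       = (\<Sum>\<^sub>\<infinity>k. \<Sum>i\<in>UNIV. a k $ i * (\<integral>x. mode k x * of_real (d\<psi> x $ i) \<partial>torus))"
      unfolding eq by (rule infsumI[symmetric], rule has_sum_finite_sum) (auto intro!: has_sum_infsum si)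
    also have "\<dots> = (\<Sum>\<^sub>\<infinity>k::int^3. 0)"
    proof (rule infsum_cong)
      fix k
      have "(\<Sum>i\<in>UNIV. a k $ i * (\<integral>x. mode k x * of_real (d\<psi> x $ i) \<partial>torus))
          = - \<i> * (\<integral>x. mode k x * of_real (\<psi> x) \<partial>torus) * (\<Sum>i\<in>UNIV. of_int (k $ i) * a k $ i)"
        unfolding mode_integral_by_parts[OF t] sum_distrib_left by (simp add: mult_ac)
      then show "(\<Sum>i\<in>UNIV. a k $ i * (\<integral>x. mode k x * of_real (d\<psi> x $ i) \<partial>torus)) = 0"
        using a by (simp add: H_coeffs_def)
    qed
    finally have z: "(\<Sum>i\<in>UNIV. \<integral>x. h x $ i * d\<psi> x $ i \<partial>torus) = 0"
      unfolding of_real_sum[symmetric] by (simp only: infsum_0_simp of_real_eq_0_iff)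
    have "L2inner h d\<psi> = (\<Sum>i\<in>UNIV. \<integral>x. h x $ i * d\<psi> x $ i \<partial>torus)"
      by (rule L2inner_components) (intro integrable_torus_continuous continuous_intros hc dc)
    then show "L2inner h d\<psi> = 0" using z by simp
  qed
  have "h \<in> H_space" using L mz df by (simp add: H_space_def set_integral_Omega)
  then show thesis using co that by blast
qed

section \<open>Exponentially weighted norms\<close>

text \<open>The weight is \<open>exp (2 * l * \<bar>k\<bar>)\<close>, so that \<open>gevrey_sum l\<close> is the square of the norm of \<open>e\<^bsup>l A^(1/2)\<^esup> a\<close>, up to
  the volume of the cube.\<close>

definition gevrey_term :: "real \<Rightarrow> (int^3 \<Rightarrow> complex^3) \<Rightarrow> int^3 \<Rightarrow> real" where
  "gevrey_term l a k = exp (2 * l * norm (real_vec k)) * (norm (a k))\<^sup>2"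

definition gevrey :: "real \<Rightarrow> (int^3 \<Rightarrow> complex^3) \<Rightarrow> bool" where
  "gevrey l a \<longleftrightarrow> gevrey_term l a summable_on UNIV"

definition gevrey_sum :: "real \<Rightarrow> (int^3 \<Rightarrow> complex^3) \<Rightarrow> real" where
  "gevrey_sum l a = (\<Sum>\<^sub>\<infinity>k. gevrey_term l a k)"

text \<open>The squared \<open>\<ell>\<^sup>2\<close> norm of \<open>\<bar>k\<bar> * exp (- d * \<bar>k\<bar>)\<close>: the price for bounding one derivative and one \<open>\<ell>\<^sup>1\<close> norm by a
  gain of \<open>d\<close> in the exponential weight.\<close>

definition lattice_const :: "real \<Rightarrow> real" where
  "lattice_const d = (\<Sum>\<^sub>\<infinity>k::int^3. (norm (real_vec k))\<^sup>2 * exp (- 2 * d * norm (real_vec k)))"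

lemma gevrey_term_nonneg[simp]: "gevrey_term l a k \<ge> 0" by (simp add: gevrey_term_def)

lemma gevrey_term_square: "gevrey_term l a k = (exp (l * norm (real_vec k)) * norm (a k))\<^sup>2"
  by (simp add: gevrey_term_def power_mult_distrib exp_double[symmetric] mult.assoc)

lemma gevrey_term_mono: "l \<le> m \<Longrightarrow> gevrey_term l a k \<le> gevrey_term m a k"
  by (auto simp: gevrey_term_def intro!: mult_right_mono)

lemma gevrey_mono: "gevrey m a \<Longrightarrow> l \<le> m \<Longrightarrow> gevrey l a"
  unfolding gevrey_def by (erule summable_on_comparison_test) (auto intro: gevrey_term_mono)

lemma gevrey_sum_nonneg[simp]: "gevrey_sum l a \<ge> 0"
  by (simp add: gevrey_sum_def infsum_nonneg)

lemma sum_gevrey_term_le: "gevrey l a \<Longrightarrow> finite F \<Longrightarrow> (\<Sum>k\<in>F. gevrey_term l a k) \<le> gevrey_sum l a"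
  unfolding gevrey_sum_def gevrey_def by (rule finite_sum_le_infsum) auto

lemma lattice_const_summable:
  assumes "d > 0"
  shows "(\<lambda>k::int^3. (norm (real_vec k) * exp (- d * norm (real_vec k)))\<^sup>2) summable_on UNIV"
    and "lattice_const d = (\<Sum>\<^sub>\<infinity>k::int^3. (norm (real_vec k) * exp (- d * norm (real_vec k)))\<^sup>2)"
proof -
  have e: "(norm (real_vec k) * exp (- d * norm (real_vec k)))\<^sup>2 = (norm (real_vec k))\<^sup>2 * exp (- 2 * d * norm (real_vec k))" for k
    by (simp add: power_mult_distrib exp_double[symmetric] mult.assoc)
  show "(\<lambda>k::int^3. (norm (real_vec k) * exp (- d * norm (real_vec k)))\<^sup>2) summable_on UNIV"
    unfolding e using summable_sq_exp_lattice[of "2 * d"] assms by (simp add: mult.assoc)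
  show "lattice_const d = (\<Sum>\<^sub>\<infinity>k::int^3. (norm (real_vec k) * exp (- d * norm (real_vec k)))\<^sup>2)"
    unfolding e lattice_const_def ..
qed

text \<open>Cauchy--Schwarz trades an arbitrarily small part of the exponential weight for summability and for one
  derivative.  The version over a subset \<open>A\<close> gives tails that are small uniformly in \<open>a\<close>.\<close>

lemma gevrey_l1:
  assumes g: "gevrey l a" and ml: "m < l"
  shows "(\<lambda>k. norm (real_vec k) * (exp (m * norm (real_vec k)) * norm (a k))) summable_on A"
    and "(\<Sum>\<^sub>\<infinity>k\<in>A. norm (real_vec k) * (exp (m * norm (real_vec k)) * norm (a k)))\<^sup>2
      \<le> (\<Sum>\<^sub>\<infinity>k\<in>A. (norm (real_vec k) * exp (- (l - m) * norm (real_vec k)))\<^sup>2) * gevrey_sum l a"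
    and "(\<lambda>k. exp (m * norm (real_vec k)) * norm (a k)) summable_on UNIV"
proof -
  define x where "x k = norm (real_vec k) * exp (- (l - m) * norm (real_vec k))" for k
  define y where "y k = exp (l * norm (real_vec k)) * norm (a k)" for k
  have xs: "(\<lambda>k. (x k)\<^sup>2) summable_on B" for B
    unfolding x_def
    by (rule summable_on_subset_banach[OF lattice_const_summable(1)[of "l - m"]]) (use ml in auto)
  have yU: "(\<lambda>k. (y k)\<^sup>2) summable_on UNIV"
    using g by (simp add: gevrey_def gevrey_term_square[abs_def] y_def)
  then have ys: "(\<lambda>k. (y k)\<^sup>2) summable_on A"
    by (rule summable_on_subset_banach) simp
  have e: "\<bar>x k * y k\<bar> = norm (real_vec k) * (exp (m * norm (real_vec k)) * norm (a k))" for k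
  proof -
    have "exp (- (l - m) * norm (real_vec k)) * exp (l * norm (real_vec k)) = exp (m * norm (real_vec k))"
      by (simp add: exp_add[symmetric] algebra_simps)
    then show ?thesis by (simp add: x_def y_def abs_mult mult_ac)
  qed
  show "(\<lambda>k. norm (real_vec k) * (exp (m * norm (real_vec k)) * norm (a k))) summable_on A"
    using summable_on_mult_of_squares[OF xs[of A] ys] by (simp only: e)
  have "(\<Sum>\<^sub>\<infinity>k\<in>A. \<bar>x k * y k\<bar>)\<^sup>2 \<le> (\<Sum>\<^sub>\<infinity>k\<in>A. (x k)\<^sup>2) * (\<Sum>\<^sub>\<infinity>k\<in>A. (y k)\<^sup>2)"
    by (rule Cauchy_Schwarz_infsum[OF xs ys])
  also have "(\<Sum>\<^sub>\<infinity>k\<in>A. (y k)\<^sup>2) \<le> gevrey_sum l a"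
    unfolding gevrey_sum_def using ys yU
    by (intro infsum_mono_neutral) (auto simp: gevrey_term_square[abs_def] y_def)
  finally show "(\<Sum>\<^sub>\<infinity>k\<in>A. norm (real_vec k) * (exp (m * norm (real_vec k)) * norm (a k)))\<^sup>2
      \<le> (\<Sum>\<^sub>\<infinity>k\<in>A. (norm (real_vec k) * exp (- (l - m) * norm (real_vec k)))\<^sup>2) * gevrey_sum l a"
    by (simp only: e x_def[symmetric]) (simp add: mult_left_mono infsum_nonneg)
  have "(\<lambda>k. \<bar>exp (- (l - m) * norm (real_vec k)) * y k\<bar>) summable_on UNIV"
  proof (rule summable_on_mult_of_squares[OF _ yU])
    have "(exp (- (l - m) * norm (real_vec k)))\<^sup>2 = exp (- (2 * (l - m)) * norm (real_vec k))" for k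
      by (simp add: exp_double[symmetric])
    then show "(\<lambda>k::int^3. (exp (- (l - m) * norm (real_vec k)))\<^sup>2) summable_on UNIV"
      using summable_exp_lattice[of "2 * (l - m)"] ml by simp
  qed
  moreover have "\<bar>exp (- (l - m) * norm (real_vec k)) * y k\<bar> = exp (m * norm (real_vec k)) * norm (a k)" for k
    by (simp add: y_def abs_mult mult.assoc[symmetric] exp_add[symmetric] algebra_simps)
  ultimately show "(\<lambda>k. exp (m * norm (real_vec k)) * norm (a k)) summable_on UNIV" by simp
qed

lemma gevrey_summable:
  assumes "gevrey l a" "l > 0"
  shows "(\<lambda>k. norm (a k)) summable_on UNIV" "(\<lambda>k. norm (real_vec k) * norm (a k)) summable_on UNIV"
  using gevrey_l1(3)[OF assms] gevrey_l1(1)[OF assms, of UNIV] by simp_all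

section \<open>The operators \<open>e\<^bsup>l A^(1/2)\<^esup>\<close>\<close>

lemma norm_smult_complex: "norm (c *s (v :: complex^3)) = cmod c * norm v"
proof -
  have "(norm (c *s v))\<^sup>2 = (cmod c * norm v)\<^sup>2"
    by (simp add: norm_sq_vec3 norm_mult power_mult_distrib sum_distrib_left)
  then show ?thesis by (simp add: power2_eq_iff_nonneg)
qed

lemma is_expA_coeff:
  assumes "is_expA l g h"
  shows "fourier_coeff h k = complex_of_real (exp (l * norm (real_vec k))) *s fourier_coeff g k"
proof (cases "k = 0")
  case True
  have "fourier_coeff h 0 = 0" "fourier_coeff g 0 = 0"
    using assms H_space_coeffs by (auto simp: is_expA_def H_coeffs_def)
  then show ?thesis using True by simp
qed (use assms in \<open>auto simp: is_expA_def\<close>)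

lemma is_expA_term:
  assumes "is_expA l g h"
  shows "(norm (fourier_coeff h k))\<^sup>2 = gevrey_term l (fourier_coeff g) k"
  by (simp add: is_expA_coeff[OF assms] norm_smult_complex gevrey_term_square)

lemma expA_is_expA: "g \<in> dom_expA l \<Longrightarrow> is_expA l g (expA l g)"
  unfolding dom_expA_def expA_def using someI_ex[of "is_expA l g"] by auto

text \<open>This direction is Bessel's inequality for \<open>e\<^bsup>l A^(1/2)\<^esup> g\<close>, an arbitrary field in \<open>H\<close>.\<close>

lemma dom_expA_gevrey:
  assumes "g \<in> dom_expA l"
  shows "gevrey l (fourier_coeff g)"
    and "(2 * pi) ^ 3 * gevrey_sum l (fourier_coeff g) \<le> (L2norm (expA l g))\<^sup>2"
proof -
  have e: "is_expA l g (expA l g)" by (rule expA_is_expA[OF assms])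
  then have L: "expA l g \<in> L2per" by (auto simp: is_expA_def H_space_L2per)
  show "gevrey l (fourier_coeff g)"
    using bessel_inequality(2)[OF L] by (simp add: gevrey_def is_expA_term[OF e])
  show "(2 * pi) ^ 3 * gevrey_sum l (fourier_coeff g) \<le> (L2norm (expA l g))\<^sup>2"
    using bessel_inequality(3)[OF L] by (simp add: gevrey_sum_def is_expA_term[OF e])
qed

text \<open>A weight strictly larger than \<open>l\<close> makes the coefficients of \<open>e\<^bsup>l A^(1/2)\<^esup> g\<close> summable.  Hence this field is the sum
  of its Fourier series, and Parseval holds with equality.\<close>

lemma gevrey_dom_expA:
  assumes g: "g \<in> H_space" and gv: "gevrey m (fourier_coeff g)" and lm: "l < m"
  shows "g \<in> dom_expA l"
    and "(L2norm (expA l g))\<^sup>2 = (2 * pi) ^ 3 * gevrey_sum l (fourier_coeff g)"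
    and "v \<in> H_space \<Longrightarrow> ((\<lambda>k. (2 * pi) ^ 3 * (exp (l * norm (real_vec k)) * (fourier_coeff g k \<bullet> fourier_coeff v k)))
           has_sum L2inner (expA l g) v) UNIV"
proof -
  define a where "a k = complex_of_real (exp (l * norm (real_vec k))) *s fourier_coeff g k" for k
  have na: "norm (a k) = exp (l * norm (real_vec k)) * norm (fourier_coeff g k)" for k
    by (simp add: a_def norm_smult_complex)
  have Hg: "H_coeffs (fourier_coeff g)" by (rule H_space_coeffs[OF g])
  have Ha: "H_coeffs a" unfolding H_coeffs_def
  proof (intro conjI allI)
    show "a (- k) $ i = cnj (a k $ i)" for k i using Hg by (simp add: H_coeffs_def a_def)
    show "a 0 = 0" using Hg by (simp add: H_coeffs_def a_def)
    fix k
    have "(\<Sum>i\<in>UNIV. of_int (k $ i) * a k $ i)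
        = complex_of_real (exp (l * norm (real_vec k))) * (\<Sum>i\<in>UNIV. of_int (k $ i) * fourier_coeff g k $ i)"
      unfolding sum_distrib_left by (simp add: a_def mult_ac)
    then show "(\<Sum>i\<in>UNIV. of_int (k $ i) * a k $ i) = 0" using Hg by (simp add: H_coeffs_def)
  qed
  have sa: "(\<lambda>k. norm (a k)) summable_on UNIV" unfolding na by (rule gevrey_l1(3)[OF gv lm])
  obtain h where "h \<in> H_space" "\<And>k. fourier_coeff h k = a k" using H_coeffs_field[OF Ha sa] by blast
  then have "is_expA l g h" using g by (simp add: is_expA_def a_def)
  then show d: "g \<in> dom_expA l" by (auto simp: dom_expA_def)
  define E where "E = expA l g"
  have e: "is_expA l g E" unfolding E_def by (rule expA_is_expA[OF d])
  have EH: "E \<in> H_space" using e by (simp add: is_expA_def)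
  have Ec: "fourier_coeff E k = a k" for k by (simp add: is_expA_coeff[OF e] a_def)
  have P: "((\<lambda>k. (2 * pi) ^ 3 * (fourier_coeff E k \<bullet> fourier_coeff v k)) has_sum L2inner E v) UNIV"
    if "v \<in> H_space" for v
    by (rule parseval_summable) (use that EH sa L2per_component(1) H_space_L2per in \<open>auto simp: Ec\<close>)
  have "(L2norm E)\<^sup>2 = L2inner E E" by (simp add: L2norm_torus L2inner_torus power2_norm_eq_inner)
  also have "\<dots> = (\<Sum>\<^sub>\<infinity>k. (2 * pi) ^ 3 * (fourier_coeff E k \<bullet> fourier_coeff E k))"
    using infsumI[OF P[OF EH]] by simp
  also have "\<dots> = (\<Sum>\<^sub>\<infinity>k. (2 * pi) ^ 3 * gevrey_term l (fourier_coeff g) k)"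
    by (simp add: power2_norm_eq_inner[symmetric] is_expA_term[OF e])
  also have "\<dots> = (2 * pi) ^ 3 * gevrey_sum l (fourier_coeff g)"
    unfolding gevrey_sum_def by (rule infsum_cmult_right')
  finally show "(L2norm (expA l g))\<^sup>2 = (2 * pi) ^ 3 * gevrey_sum l (fourier_coeff g)" by (simp add: E_def)
  have i: "a k \<bullet> w = exp (l * norm (real_vec k)) * (fourier_coeff g k \<bullet> w)" for k w
    by (simp add: a_def inner_vec_def inner_complex_def sum_distrib_left algebra_simps)
  show "((\<lambda>k. (2 * pi) ^ 3 * (exp (l * norm (real_vec k)) * (fourier_coeff g k \<bullet> fourier_coeff v k)))
           has_sum L2inner (expA l g) v) UNIV" if "v \<in> H_space"
    using P[OF that] unfolding Ec i unfolding E_def .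
qed

text \<open>A real field carried by the two modes \<open>\<plusminus>k\<close> reads off one Fourier coefficient, up to its component along \<open>k\<close>.
  Such fields serve as test functions in the weak equation and identify the Leray projection.\<close>

lemma mode_field:
  assumes k: "k \<noteq> 0" and c: "(\<Sum>i\<in>UNIV. of_int (k $ i) * c $ i) = 0"
  obtains v where "v \<in> H_space" "\<And>l. v \<in> dom_expA l"
    "\<And>g. (\<And>i. integrable torus (\<lambda>x. g x $ i)) \<Longrightarrow> L2inner g v = 2 * (2 * pi) ^ 3 * (fourier_coeff g k \<bullet> c)"
    "\<And>l g. g \<in> H_space \<Longrightarrow> L2inner g (expA l v) = 2 * (2 * pi) ^ 3 * (exp (l * norm (real_vec k)) * (fourier_coeff g k \<bullet> c))"
proof -
  define a :: "int^3 \<Rightarrow> complex^3" where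
    "a m = (if m = k then c else if m = - k then (\<chi> i. cnj (c $ i)) else 0)" for m
  have kk: "k \<noteq> - k"
  proof
    assume "k = - k"
    then have "k $ i = - k $ i" for i by (metis vector_uminus_component)
    then have "k $ i = 0" for i by (metis add.inverse_neutral equal_neg_zero)
    then show False using k by (simp add: vec_eq_iff)
  qed
  have a0: "a m = 0" if "m \<notin> {k, - k}" for m using that by (simp add: a_def)
  have Ha: "H_coeffs a" unfolding H_coeffs_def
  proof (intro conjI allI)
    show "a (- m) $ i = cnj (a m $ i)" for m i using kk by (auto simp: a_def)
    show "a 0 = 0" using k by (auto simp: a_def)
    fix m
    have "(\<Sum>i\<in>UNIV. of_int ((- k) $ i) * cnj (c $ i)) = - cnj (\<Sum>i\<in>UNIV. of_int (k $ i) * c $ i)"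
      by (simp add: cnj_sum sum_negf)
    then show "(\<Sum>i\<in>UNIV. of_int (m $ i) * a m $ i) = 0" using c by (auto simp: a_def)
  qed
  have fs: "f summable_on UNIV" if "\<And>m. m \<notin> {k, - k} \<Longrightarrow> f m = 0" for f :: "int^3 \<Rightarrow> real"
    by (subst summable_on_cong_neutral[where T = "{k, - k}" and g = f]) (use that in auto)
  have sa: "(\<lambda>m. norm (a m)) summable_on UNIV" by (rule fs) (simp add: a0)
  obtain v where v: "v \<in> H_space" "\<And>m. fourier_coeff v m = a m" using H_coeffs_field[OF Ha sa] by blast
  have gv: "gevrey l (fourier_coeff v)" for l
    unfolding gevrey_def by (rule fs) (simp add: gevrey_term_def v a0)
  have dom: "v \<in> dom_expA l" for l by (rule gevrey_dom_expA(1)[OF v(1) gv, of l "l + 1"]) simp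
  have pair: "L2inner g h = 2 * (2 * pi) ^ 3 * (e * (fourier_coeff g k \<bullet> c))"
    if g: "\<And>i. integrable torus (\<lambda>x. g x $ i)" and h: "h \<in> H_space"
      and hc: "\<And>m. fourier_coeff h m = complex_of_real (exp (l * norm (real_vec m))) *s a m"
      and e: "e = exp (l * norm (real_vec k))" for g h l e
  proof -
    have hs: "(\<lambda>m. norm (fourier_coeff h m)) summable_on UNIV" by (rule fs) (simp add: hc a0)
    have gm: "fourier_coeff g (- k) $ i = cnj (fourier_coeff g k $ i)" for i
      by (simp add: fourier_coeff_nth fcoeff_minus)
    have "L2inner h g = (\<Sum>\<^sub>\<infinity>m. (2 * pi) ^ 3 * (fourier_coeff h m \<bullet> fourier_coeff g m))"
      by (rule infsumI[symmetric], rule parseval_summable[OF _ hs g])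
        (use h L2per_component(1) H_space_L2per in auto)
    also have "\<dots> = (\<Sum>\<^sub>\<infinity>m\<in>{k, - k}. (2 * pi) ^ 3 * (fourier_coeff h m \<bullet> fourier_coeff g m))"
      by (rule infsum_cong_neutral) (auto simp: hc a0)
    also have "\<dots> = (2 * pi) ^ 3 * (fourier_coeff h k \<bullet> fourier_coeff g k) + (2 * pi) ^ 3 * (fourier_coeff h (- k) \<bullet> fourier_coeff g (- k))"
      using kk by simp
    also have "fourier_coeff h (- k) \<bullet> fourier_coeff g (- k) = fourier_coeff h k \<bullet> fourier_coeff g k"
      using kk by (simp add: hc a_def inner_vec_def gm inner_complex_def)
    also have "fourier_coeff h k \<bullet> fourier_coeff g k = e * (fourier_coeff g k \<bullet> c)"
      by (simp add: hc a_def inner_vec_def inner_complex_def sum_distrib_left e algebra_simps)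
    finally have "L2inner h g = 2 * (2 * pi) ^ 3 * (e * (fourier_coeff g k \<bullet> c))" by simp
    then show ?thesis by (simp add: L2inner_torus inner_commute)
  qed
  show thesis
  proof (rule that[OF v(1) dom])
    show "L2inner g v = 2 * (2 * pi) ^ 3 * (fourier_coeff g k \<bullet> c)" if "\<And>i. integrable torus (\<lambda>x. g x $ i)" for g
      using pair[OF that v(1), of 0 1] by (simp add: v)
    show "L2inner g (expA l v) = 2 * (2 * pi) ^ 3 * (exp (l * norm (real_vec k)) * (fourier_coeff g k \<bullet> c))"
      if "g \<in> H_space" for g l
    proof -
      have e: "is_expA l v (expA l v)" by (rule expA_is_expA[OF dom])
      show ?thesis
        by (rule pair[where l = l]) (use e that L2per_component(1)[OF H_space_L2per] in
            \<open>auto simp: is_expA_coeff[OF e] v is_expA_def\<close>)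
    qed
  qed
qed

section \<open>The nonlinear term in Fourier variables\<close>

abbreviation kdot :: "int^3 \<Rightarrow> complex^3 \<Rightarrow> complex" where
  "kdot k v \<equiv> (\<Sum>i\<in>UNIV. of_int (k $ i) * v $ i)"

text \<open>The coefficients of \<open>(u \<cdot> \<nabla>) u\<close> are \<open>\<i> \<Sum>\<^sub>l ((k - l) \<cdot> a l) a (k - l)\<close>.  As \<open>l \<cdot> a l = 0\<close>, the factor \<open>k - l\<close> may be replaced by \<open>k\<close>,
  which is the divergence form of the nonlinear term.\<close>

definition advect_coeff :: "(int^3 \<Rightarrow> complex^3) \<Rightarrow> int^3 \<Rightarrow> complex^3" where
  "advect_coeff a k = (\<Sum>\<^sub>\<infinity>l. (\<i> * kdot k (a l)) *s a (k - l))"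

lemma cmod_kdot_le: "cmod (kdot k v) \<le> norm (real_vec k) * norm v"
proof -
  have "cmod (kdot k v) \<le> (\<Sum>i\<in>UNIV. \<bar>real_of_int (k $ i)\<bar> * \<bar>cmod (v $ i)\<bar>)"
    by (rule order_trans[OF norm_sum]) (simp add: norm_mult)
  also have "\<dots> \<le> L2_set (\<lambda>i. real_of_int (k $ i)) UNIV * L2_set (\<lambda>i. cmod (v $ i)) UNIV"
    by (rule L2_set_mult_ineq)
  finally show ?thesis by (simp add: norm_vec_def L2_set_def)
qed

lemma advect_term_bound:
  assumes "\<theta> \<ge> 0"
  shows "norm ((\<i> * kdot k (a l)) *s a (k - l)) \<le> norm (real_vec k) * exp (- \<theta> * norm (real_vec k)) *
     \<bar>(exp (\<theta> * norm (real_vec l)) * norm (a l)) * (exp (\<theta> * norm (real_vec (k - l))) * norm (a (k - l)))\<bar>"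
proof -
  have "norm (real_vec k) \<le> norm (real_vec l) + norm (real_vec (k - l))"
    using norm_triangle_ineq[of "real_vec l" "real_vec (k - l)"] by simp
  then have "\<theta> * norm (real_vec k) \<le> \<theta> * norm (real_vec l) + \<theta> * norm (real_vec (k - l))"
    using assms by (metis distrib_left mult_left_mono)
  then have "1 \<le> exp (- \<theta> * norm (real_vec k)) * (exp (\<theta> * norm (real_vec l)) * exp (\<theta> * norm (real_vec (k - l))))"
    by (simp only: exp_add[symmetric] one_le_exp_iff)
  then have e: "norm (a l) * norm (a (k - l)) * 1 \<le> norm (a l) * norm (a (k - l)) *
      (exp (- \<theta> * norm (real_vec k)) * (exp (\<theta> * norm (real_vec l)) * exp (\<theta> * norm (real_vec (k - l)))))"
    by (rule mult_left_mono) simp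
  have "norm ((\<i> * kdot k (a l)) *s a (k - l)) \<le> (norm (real_vec k) * norm (a l)) * norm (a (k - l))"
    unfolding norm_smult_complex norm_mult norm_ii mult_1 by (intro mult_right_mono cmod_kdot_le) simp
  also have "\<dots> \<le> norm (real_vec k) * (norm (a l) * norm (a (k - l)) *
      (exp (- \<theta> * norm (real_vec k)) * (exp (\<theta> * norm (real_vec l)) * exp (\<theta> * norm (real_vec (k - l))))))"
    using mult_left_mono[OF e, of "norm (real_vec k)"] by (simp add: mult.assoc)
  finally show ?thesis by (simp only: abs_mult abs_norm_cancel abs_exp_cancel mult_ac)
qed

lemma convolution_gevrey:
  assumes "gevrey \<theta> a"
  shows "(\<lambda>l. \<bar>(exp (\<theta> * norm (real_vec l)) * norm (a l)) * (exp (\<theta> * norm (real_vec (k - l))) * norm (a (k - l)))\<bar>) summable_on UNIV"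
    and "(\<Sum>\<^sub>\<infinity>l. \<bar>(exp (\<theta> * norm (real_vec l)) * norm (a l)) * (exp (\<theta> * norm (real_vec (k - l))) * norm (a (k - l)))\<bar>) \<le> gevrey_sum \<theta> a"
proof -
  define x where "x l = exp (\<theta> * norm (real_vec l)) * norm (a l)" for l
  have x2: "(x l)\<^sup>2 = gevrey_term \<theta> a l" for l by (simp add: x_def gevrey_term_square)
  have s: "(\<lambda>l. (x l)\<^sup>2) summable_on UNIV" using assms by (simp add: x2 gevrey_def)
  have bij: "bij_betw (\<lambda>l. k - l) UNIV UNIV"
    by (rule bij_betw_byWitness[where f' = "\<lambda>l. k - l"]) auto
  have s': "(\<lambda>l. (x (k - l))\<^sup>2) summable_on UNIV"
    using s summable_on_reindex_bij_betw[OF bij, of "\<lambda>l. (x l)\<^sup>2"] by simp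
  have e: "(\<Sum>\<^sub>\<infinity>l. (x (k - l))\<^sup>2) = gevrey_sum \<theta> a" "(\<Sum>\<^sub>\<infinity>l. (x l)\<^sup>2) = gevrey_sum \<theta> a"
    using infsum_reindex_bij_betw[OF bij, of "\<lambda>l. (x l)\<^sup>2"] by (simp_all add: x2 gevrey_sum_def)
  have "(\<Sum>\<^sub>\<infinity>l. \<bar>x l * x (k - l)\<bar>)\<^sup>2 \<le> (gevrey_sum \<theta> a)\<^sup>2"
    using Cauchy_Schwarz_infsum[OF s s'] unfolding e by (simp only: power2_eq_square)
  then have "(\<Sum>\<^sub>\<infinity>l. \<bar>x l * x (k - l)\<bar>) \<le> gevrey_sum \<theta> a"
    by (rule power2_le_imp_le) simp
  then show "(\<Sum>\<^sub>\<infinity>l. \<bar>(exp (\<theta> * norm (real_vec l)) * norm (a l)) * (exp (\<theta> * norm (real_vec (k - l))) * norm (a (k - l)))\<bar>) \<le> gevrey_sum \<theta> a"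
    by (simp only: x_def)
  show "(\<lambda>l. \<bar>(exp (\<theta> * norm (real_vec l)) * norm (a l)) * (exp (\<theta> * norm (real_vec (k - l))) * norm (a (k - l)))\<bar>) summable_on UNIV"
    using summable_on_mult_of_squares[OF s s'] by (simp only: x_def)
qed

lemma advect_coeff_summable:
  assumes "gevrey \<theta> a" "\<theta> \<ge> 0"
  shows "(\<lambda>l. norm ((\<i> * kdot k (a l)) *s a (k - l))) summable_on UNIV"
    and "(\<Sum>\<^sub>\<infinity>l. norm ((\<i> * kdot k (a l)) *s a (k - l))) \<le> norm (real_vec k) * exp (- \<theta> * norm (real_vec k)) * gevrey_sum \<theta> a"
proof -
  note c = convolution_gevrey[OF assms(1), of k]
  have cs: "(\<lambda>l. norm (real_vec k) * exp (- \<theta> * norm (real_vec k)) *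
     \<bar>(exp (\<theta> * norm (real_vec l)) * norm (a l)) * (exp (\<theta> * norm (real_vec (k - l))) * norm (a (k - l)))\<bar>) summable_on UNIV"
    by (rule summable_on_cmult_right[OF c(1)])
  show s: "(\<lambda>l. norm ((\<i> * kdot k (a l)) *s a (k - l))) summable_on UNIV"
    by (rule summable_on_comparison_test[OF cs]) (use advect_term_bound[OF assms(2)] in auto)
  have "(\<Sum>\<^sub>\<infinity>l. norm ((\<i> * kdot k (a l)) *s a (k - l))) \<le> (\<Sum>\<^sub>\<infinity>l. norm (real_vec k) * exp (- \<theta> * norm (real_vec k)) *
     \<bar>(exp (\<theta> * norm (real_vec l)) * norm (a l)) * (exp (\<theta> * norm (real_vec (k - l))) * norm (a (k - l)))\<bar>)"
    by (rule infsum_mono[OF s cs]) (rule advect_term_bound[OF assms(2)])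
  also have "\<dots> = norm (real_vec k) * exp (- \<theta> * norm (real_vec k)) * (\<Sum>\<^sub>\<infinity>l.
     \<bar>(exp (\<theta> * norm (real_vec l)) * norm (a l)) * (exp (\<theta> * norm (real_vec (k - l))) * norm (a (k - l)))\<bar>)"
    by (rule infsum_cmult_right')
  also have "\<dots> \<le> norm (real_vec k) * exp (- \<theta> * norm (real_vec k)) * gevrey_sum \<theta> a"
    by (rule mult_left_mono[OF c(2)]) simp
  finally show "(\<Sum>\<^sub>\<infinity>l. norm ((\<i> * kdot k (a l)) *s a (k - l))) \<le> norm (real_vec k) * exp (- \<theta> * norm (real_vec k)) * gevrey_sum \<theta> a" .
qed

text \<open>The factor \<open>e\<^bsup>\<theta>|k|\<^esup>\<close> distributes over the convolution because of the triangle inequality \<open>\<bar>k\<bar> \<le> \<bar>l\<bar> + \<bar>k - l\<bar>\<close>, and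
  Cauchy--Schwarz bounds the convolution pointwise in \<open>k\<close>.\<close>

theorem advect_coeff_bound:
  assumes "gevrey \<theta> a" "\<theta> \<ge> 0"
  shows "norm (advect_coeff a k) \<le> norm (real_vec k) * exp (- \<theta> * norm (real_vec k)) * gevrey_sum \<theta> a"
  unfolding advect_coeff_def
  by (rule order_trans[OF norm_infsum_bound advect_coeff_summable(2)[OF assms]])
    (rule advect_coeff_summable(1)[OF assms])

text \<open>Conservation of energy.  For fixed \<open>l\<close> the substitution \<open>k \<mapsto> l - k\<close> reverses the sign of the summand
  \<open>\<i> (k \<cdot> a l) (a (k - l) \<cdot> a (- k))\<close>, because \<open>l \<cdot> a l = 0\<close>.  Absolute summability over pairs allows to sum over \<open>k\<close>
  first.\<close>

lemma advect_coeff_cancellation: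
  assumes H: "H_coeffs a" and gv: "gevrey l0 a" and l0: "l0 > 0"
  shows "((\<lambda>k. advect_coeff a k \<bullet> a k) has_sum 0) UNIV"
proof -
  define T where "T k l = ((\<i> * kdot k (a l)) *s a (k - l)) \<bullet> a k" for k l
  have g0: "gevrey 0 a" by (rule gevrey_mono[OF gv]) (use l0 in simp)
  note s0 = advect_coeff_summable[OF g0 order_refl]
  have sl: "(\<lambda>l. norm (T k l)) summable_on UNIV" for k
    by (rule summable_on_comparison_test[OF summable_on_cmult_left[OF s0(1)[of k], of "norm (a k)"]])
      (auto simp: T_def Cauchy_Schwarz_ineq2)
  have bl: "(\<Sum>\<^sub>\<infinity>l. norm (T k l)) \<le> norm (real_vec k) * norm (a k) * gevrey_sum 0 a" for k
  proof -
    have "(\<Sum>\<^sub>\<infinity>l. norm (T k l)) \<le> (\<Sum>\<^sub>\<infinity>l. norm ((\<i> * kdot k (a l)) *s a (k - l)) * norm (a k))"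
      by (rule infsum_mono[OF sl summable_on_cmult_left[OF s0(1)]]) (simp add: T_def Cauchy_Schwarz_ineq2)
    also have "\<dots> = (\<Sum>\<^sub>\<infinity>l. norm ((\<i> * kdot k (a l)) *s a (k - l))) * norm (a k)"
      by (rule infsum_cmult_left')
    also have "\<dots> \<le> (norm (real_vec k) * gevrey_sum 0 a) * norm (a k)"
      using s0(2)[of k] by (intro mult_right_mono) auto
    finally show ?thesis by (simp add: mult_ac)
  qed
  have inner: "advect_coeff a k \<bullet> a k = (\<Sum>\<^sub>\<infinity>l. T k l)" for k
    unfolding advect_coeff_def T_def
    by (rule infsumI[OF has_sum_bounded_linear[OF bounded_linear_inner_left
            has_sum_infsum[OF abs_summable_summable[OF s0(1)]]], symmetric, unfolded o_def])
  have sk: "(\<lambda>k. \<Sum>\<^sub>\<infinity>l. norm (T k l)) summable_on UNIV"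
    by (rule summable_on_comparison_test[OF summable_on_cmult_left[OF gevrey_summable(2)[OF gv l0], of "gevrey_sum 0 a"]])
      (use bl in \<open>auto intro: infsum_nonneg\<close>)
  have "(\<lambda>p. norm ((\<lambda>(k, l). T k l) p)) summable_on (SIGMA k:UNIV. UNIV)"
    using sl sk by (subst Infinite_Sum.abs_summable_on_Sigma_iff) (auto simp: infsum_nonneg)
  then have sT: "(\<lambda>(k, l). T k l) summable_on (UNIV \<times> UNIV)"
    by (rule abs_summable_summable)
  \<comment> \<open>By reality, \<open>T k l\<close> is symmetric in \<open>k - l\<close> and \<open>- k\<close> apart from the factor \<open>k \<cdot> a l\<close>.\<close>
  have anti: "T (l - k) l = - T k l" for k l
  proof -
    have hm: "a (- m) $ i = cnj (a m $ i)" for m i using H by (simp add: H_coeffs_def)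
    have d0: "kdot l (a l) = 0" using H by (simp add: H_coeffs_def)
    have kd: "kdot (l - k) (a l) = - kdot k (a l)"
      using d0 by (simp add: left_diff_distrib sum_subtractf)
    have T: "T k l = Re (\<i> * kdot k (a l) * (\<Sum>i\<in>UNIV. a (k - l) $ i * a (- k) $ i))" for k l
    proof -
      have "T k l = (\<Sum>i\<in>UNIV. Re (\<i> * kdot k (a l) * (a (k - l) $ i * a (- k) $ i)))"
        by (simp only: T_def inner_vec_def vector_smult_component)
          (simp add: inner_complex_def hm algebra_simps)
      also have "\<dots> = Re (\<Sum>i\<in>UNIV. \<i> * kdot k (a l) * (a (k - l) $ i * a (- k) $ i))"
        by (rule Re_sum[symmetric])
      finally show ?thesis by (simp only: sum_distrib_left)
    qed
    have "T (l - k) l = Re (\<i> * - kdot k (a l) * (\<Sum>i\<in>UNIV. a (- k) $ i * a (k - l) $ i))"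
      unfolding T kd by simp
    also have "\<dots> = - T k l" unfolding T by (simp add: mult.commute)
    finally show ?thesis .
  qed
  have "(\<Sum>\<^sub>\<infinity>k. T k l) = 0" for l
  proof -
    have "(\<Sum>\<^sub>\<infinity>k. T k l) = (\<Sum>\<^sub>\<infinity>k. T (l - k) l)"
      by (rule infsum_reindex_bij_witness[of _ "\<lambda>k. l - k" "\<lambda>k. l - k"]) auto
    also have "\<dots> = - (\<Sum>\<^sub>\<infinity>k. T k l)" unfolding anti by (rule infsum_uminus)
    finally show ?thesis by simp
  qed
  then have z: "(\<Sum>\<^sub>\<infinity>k. \<Sum>\<^sub>\<infinity>l. T k l) = 0"
    using infsum_swap_banach[OF sT] by simp
  have "(\<lambda>k. \<Sum>\<^sub>\<infinity>l. T k l) summable_on UNIV"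
    by (rule abs_summable_summable, rule summable_on_comparison_test[OF sk])
      (rule norm_infsum_bound[OF sl], rule norm_ge_zero)
  then have "((\<lambda>k. \<Sum>\<^sub>\<infinity>l. T k l) has_sum 0) UNIV" using z by (simp add: has_sum_iff)
  then show ?thesis by (simp only: inner)
qed

subsection \<open>Weak gradients\<close>

text \<open>The series with coefficients \<open>\<i> k\<^sub>j a\<^sub>k\<close> converges absolutely, and each mode may be integrated by parts against
  a test function.\<close>

lemma weak_grad_exists:
  assumes u: "u \<in> H_space" and gv: "gevrey s (fourier_coeff u)" and s: "s > 0"
  shows "\<exists>G. is_weak_grad u G"
proof -
  define a where "a = fourier_coeff u"
  define d where "d i j k = \<i> * of_int (k $ j) * a k $ i" for i j k
  have H: "H_coeffs a" unfolding a_def by (rule H_space_coeffs[OF u])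
  have hm: "d i j (- k) = cnj (d i j k)" for i j k using H by (simp add: H_coeffs_def d_def)
  have db: "cmod (d i j k) \<le> norm (real_vec k) * norm (a k)" for i j k
  proof -
    have "\<bar>real_of_int (k $ j)\<bar> \<le> norm (real_vec k)" using component_le_norm_cart[of "real_vec k" j] by simp
    moreover have "cmod (a k $ i) \<le> norm (a k)" by (rule Finite_Cartesian_Product.norm_nth_le)
    ultimately show ?thesis by (simp add: d_def norm_mult mult_mono)
  qed
  have sm: "(\<lambda>k. cmod (d i j k)) summable_on UNIV" for i j
    by (rule summable_on_comparison_test[OF gevrey_summable(2)[OF gv s, folded a_def]]) (auto simp: db)
  define G :: "real^3 \<Rightarrow> real^3^3" where "G x = (\<chi> i j. real_series (d i j) x)" for x
  have Gc: "continuous_on UNIV G" unfolding G_def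
    by (intro continuous_on_vec_lambda real_series_continuous[OF sm hm])
  have Gp: "periodic G" using real_series_periodic[OF sm hm] by (simp add: periodic_def G_def)
  have ui: "integrable torus (\<lambda>x. u x $ i)" for i by (rule L2per_component(1)[OF H_space_L2per[OF u]])
  have us: "(\<lambda>k. cmod (fcoeff (\<lambda>x. u x $ i) k)) summable_on UNIV" for i
    by (rule summable_fourier_component[OF gevrey_summable(1)[OF gv s]])
  have "is_weak_grad u G" unfolding is_weak_grad_def
  proof (intro conjI allI impI)
    show "G \<in> L2per" by (rule L2per_continuous[OF Gc Gp])
    fix \<psi> d\<psi> i j assume t: "test_fun \<psi> d\<psi>"
    have dc: "continuous_on UNIV d\<psi>" and pc: "continuous_on UNIV \<psi>"
      using t test_fun_continuous by (auto simp: test_fun_def)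
    have pi: "integrable torus (\<lambda>x. complex_of_real (\<psi> x))" "integrable torus (\<lambda>x. complex_of_real (d\<psi> x $ j))"
      by (intro integrable_torus_continuous continuous_intros dc pc)+
    have "complex_of_real (\<integral>x. G x $ i $ j * \<psi> x \<partial>torus) = (\<integral>x. (\<Sum>\<^sub>\<infinity>k. d i j k * mode k x) * of_real (\<psi> x) \<partial>torus)"
      unfolding integral_complex_of_real[symmetric] of_real_mult by (simp add: G_def of_real_series[OF sm hm])
    also have "\<dots> = (\<Sum>\<^sub>\<infinity>k. d i j k * (\<integral>x. mode k x * of_real (\<psi> x) \<partial>torus))"
      by (rule integral_series_mult(1)[OF sm pi(1)])
    also have "\<dots> = (\<Sum>\<^sub>\<infinity>k. - (fcoeff (\<lambda>x. u x $ i) k * (\<integral>x. mode k x * of_real (d\<psi> x $ j) \<partial>torus)))"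
      by (simp add: mode_integral_by_parts[OF t] d_def a_def fourier_coeff_nth mult_ac)
    also have "\<dots> = - (\<integral>x. of_real (u x $ i) * of_real (d\<psi> x $ j) \<partial>torus)"
      unfolding fcoeff_integral_mult(1)[OF ui us pi(2)] by (rule infsum_uminus)
    also have "\<dots> = complex_of_real (- (\<integral>x. u x $ i * d\<psi> x $ j \<partial>torus))"
      unfolding of_real_minus integral_complex_of_real[symmetric] of_real_mult ..
    finally show "(LINT x:Omega|lebesgue. G x $ i $ j * \<psi> x) = - (LINT x:Omega|lebesgue. u x $ i * d\<psi> x $ j)"
      unfolding set_integral_Omega of_real_eq_iff .
  qed
  then show ?thesis by blast
qed

text \<open>Testing with sine and cosine determines the coefficients, so that all weak gradients, in particular the one
  chosen in \<open>advect\<close>, have the same Fourier series.\<close>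

lemma weak_grad_coeff:
  assumes u: "u \<in> H_space" and G: "is_weak_grad u G"
  shows "integrable torus (\<lambda>x. G x $ i $ j)"
    and "fcoeff (\<lambda>x. G x $ i $ j) k = \<i> * of_int (k $ j) * fcoeff (\<lambda>x. u x $ i) k"
proof -
  have GL: "G \<in> L2per" and Gw: "\<And>\<psi> d\<psi> i j. test_fun \<psi> d\<psi> \<Longrightarrow>
        (\<integral>x. G x $ i $ j * \<psi> x \<partial>torus) = - (\<integral>x. u x $ i * d\<psi> x $ j \<partial>torus)"
    using G by (auto simp: is_weak_grad_def set_integral_Omega)
  have bl: "bounded_linear (\<lambda>M::real^3^3. M $ i $ j)"
    using bounded_linear_compose[OF bounded_linear_vec_nth[of j] bounded_linear_vec_nth[of i]] by simp
  show Gi: "integrable torus (\<lambda>x. G x $ i $ j)" by (rule L2per_bounded_linear(1)[OF GL bl])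
  have ui: "integrable torus (\<lambda>x. u x $ i)" by (rule L2per_component(1)[OF H_space_L2per[OF u]])
  define Ic where "Ic g = (\<integral>x. g x * cos (real_vec k \<bullet> x) \<partial>torus)" for g
  define Is where "Is g = (\<integral>x. g x * sin (real_vec k \<bullet> x) \<partial>torus)" for g
  have 1: "Ic (\<lambda>x. G x $ i $ j) = of_int (k $ j) * Is (\<lambda>x. u x $ i)"
  proof -
    have e: "u x $ i * (- (sin (real_vec k \<bullet> x) *\<^sub>R real_vec k)) $ j = - of_int (k $ j) * (u x $ i * sin (real_vec k \<bullet> x))" for x
      by simp
    have "Ic (\<lambda>x. G x $ i $ j) = - (\<integral>x. u x $ i * (- (sin (real_vec k \<bullet> x) *\<^sub>R real_vec k)) $ j \<partial>torus)"
      unfolding Ic_def by (rule Gw[OF test_fun_cos])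
    then show ?thesis unfolding e by (simp add: Is_def)
  qed
  have 2: "Is (\<lambda>x. G x $ i $ j) = - of_int (k $ j) * Ic (\<lambda>x. u x $ i)"
  proof -
    have e: "u x $ i * (cos (real_vec k \<bullet> x) *\<^sub>R real_vec k) $ j = of_int (k $ j) * (u x $ i * cos (real_vec k \<bullet> x))" for x
      by simp
    have "Is (\<lambda>x. G x $ i $ j) = - (\<integral>x. u x $ i * (cos (real_vec k \<bullet> x) *\<^sub>R real_vec k) $ j \<partial>torus)"
      unfolding Is_def by (rule Gw[OF test_fun_sin])
    then show ?thesis unfolding e by (simp add: Ic_def)
  qed
  have J: "Re (\<integral>x. of_real (g x) * mode (- k) x \<partial>torus) = Ic g" "Im (\<integral>x. of_real (g x) * mode (- k) x \<partial>torus) = - Is g"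
    if "integrable torus g" for g
    using integrable_of_real_mult_mode[OF that, of "-k"]
    by (simp_all add: Ic_def Is_def integral_Re[symmetric] integral_Im[symmetric] mode_cis)
  have "(\<integral>x. of_real (G x $ i $ j) * mode (- k) x \<partial>torus) = \<i> * of_int (k $ j) * (\<integral>x. of_real (u x $ i) * mode (- k) x \<partial>torus)"
    using J[OF Gi] J[OF ui] 1 2 by (simp add: complex_eq_iff)
  then show "fcoeff (\<lambda>x. G x $ i $ j) k = \<i> * of_int (k $ j) * fcoeff (\<lambda>x. u x $ i) k"
    by (simp add: fcoeff_def)
qed

text \<open>The velocity equals its absolutely convergent series almost everywhere, which is integrated term by term
  against an entry of the gradient times a mode.\<close>

lemma advect_fourier:
  assumes u: "u \<in> H_space" and gv: "gevrey s (fourier_coeff u)" and s: "s > 0"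
  shows "integrable torus (\<lambda>x. advect u u x $ i)"
    and "fourier_coeff (advect u u) k = advect_coeff (fourier_coeff u) k"
proof -
  define a where "a = fourier_coeff u"
  define G where "G = (SOME G. is_weak_grad u G)"
  have G: "is_weak_grad u G" unfolding G_def by (rule someI_ex[OF weak_grad_exists[OF assms]])
  have H: "H_coeffs a" unfolding a_def by (rule H_space_coeffs[OF u])
  have adv: "advect u u x $ i = (\<Sum>j\<in>UNIV. G x $ i $ j * u x $ j)" for x i
    by (simp add: advect_def G_def matrix_vector_mult_def)
  note Gc = weak_grad_coeff[OF u G]
  have ui: "integrable torus (\<lambda>x. u x $ i)" for i by (rule L2per_component(1)[OF H_space_L2per[OF u]])
  have us: "(\<lambda>k. cmod (fcoeff (\<lambda>x. u x $ i) k)) summable_on UNIV" for i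
    by (rule summable_fourier_component[OF gevrey_summable(1)[OF gv s]])
  have Gi: "integrable torus (\<lambda>x. complex_of_real (G x $ i $ j) * mode (- k) x)" for i j k
    by (rule integrable_of_real_mult_mode[OF Gc(1)])
  have "complex_of_real (G x $ i $ j) = complex_of_real (G x $ i $ j) * mode (- 0) x" for x i j
    by (simp add: mode_simps)
  then have "integrable torus (\<lambda>x. complex_of_real (u x $ j) * complex_of_real (G x $ i $ j))" for i j
    using fcoeff_integral_mult(2)[OF ui us Gi[where k = 0], of j i j] by (simp add: mode_simps)
  then have Gu: "integrable torus (\<lambda>x. G x $ i $ j * u x $ j)" for i j
    by (simp only: of_real_mult[symmetric] complex_of_real_integrable_eq mult.commute)
  show "integrable torus (\<lambda>x. advect u u x $ i)" unfolding adv using Gu by simp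
  have V: "complex_of_real ((2 * pi) ^ 3) \<noteq> 0" by simp
  have summand: "((\<lambda>l. of_real ((2 * pi) ^ 3) * (a l $ j * (\<i> * of_int ((k - l) $ j) * a (k - l) $ i))) has_sum
      (\<integral>x. of_real (G x $ i $ j * u x $ j) * mode (- k) x \<partial>torus)) UNIV" for i j
  proof -
    have m: "(\<integral>x. mode l x * (of_real (G x $ i $ j) * mode (- k) x) \<partial>torus)
        = of_real ((2 * pi) ^ 3) * (\<i> * of_int ((k - l) $ j) * a (k - l) $ i)" for l
    proof -
      have "mode l x * (of_real (G x $ i $ j) * mode (- k) x) = of_real (G x $ i $ j) * mode (- (k - l)) x" for x
        using mode_simps(2)[of l "- k" x] by simp
      then show ?thesis
        by (simp only: fcoeff_integral(1)[of "\<lambda>x. G x $ i $ j" "k - l"] Gc(2) a_def fourier_coeff_nth)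
    qed
    have "(\<integral>x. of_real (G x $ i $ j * u x $ j) * mode (- k) x \<partial>torus)
        = (\<integral>x. of_real (u x $ j) * (of_real (G x $ i $ j) * mode (- k) x) \<partial>torus)"
      by (simp add: mult_ac)
    also have "\<dots> = (\<Sum>\<^sub>\<infinity>l. fcoeff (\<lambda>x. u x $ j) l * (\<integral>x. mode l x * (of_real (G x $ i $ j) * mode (- k) x) \<partial>torus))"
      by (rule fcoeff_integral_mult(1)[OF ui us Gi])
    finally have "(\<integral>x. of_real (G x $ i $ j * u x $ j) * mode (- k) x \<partial>torus)
        = (\<Sum>\<^sub>\<infinity>l. fcoeff (\<lambda>x. u x $ j) l * (\<integral>x. mode l x * (of_real (G x $ i $ j) * mode (- k) x) \<partial>torus))" .
    moreover have "(\<lambda>l. fcoeff (\<lambda>x. u x $ j) l * (\<integral>x. mode l x * (of_real (G x $ i $ j) * mode (- k) x) \<partial>torus)) summable_on UNIV"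
      by (rule fcoeff_integral_mult(3)[OF ui us Gi])
    ultimately have "((\<lambda>l. fcoeff (\<lambda>x. u x $ j) l * (\<integral>x. mode l x * (of_real (G x $ i $ j) * mode (- k) x) \<partial>torus)) has_sum
       (\<integral>x. of_real (G x $ i $ j * u x $ j) * mode (- k) x \<partial>torus)) UNIV"
      by (simp add: has_sum_iff)
    then show ?thesis unfolding m by (simp add: a_def fourier_coeff_nth mult_ac)
  qed
  have "of_real ((2 * pi) ^ 3) * fourier_coeff (advect u u) k $ i = of_real ((2 * pi) ^ 3) * advect_coeff a k $ i" for i
  proof -
    have "of_real ((2 * pi) ^ 3) * fourier_coeff (advect u u) k $ i = (\<integral>x. of_real (advect u u x $ i) * mode (- k) x \<partial>torus)"
      by (simp only: fourier_coeff_nth fcoeff_integral(1))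
    also have "\<dots> = (\<Sum>j\<in>UNIV. \<integral>x. of_real (G x $ i $ j * u x $ j) * mode (- k) x \<partial>torus)"
      unfolding adv of_real_sum sum_distrib_right
      by (rule Bochner_Integration.integral_sum) (rule integrable_of_real_mult_mode[OF Gu])
    finally have 1: "((\<lambda>l. \<Sum>j\<in>UNIV. of_real ((2 * pi) ^ 3) * (a l $ j * (\<i> * of_int ((k - l) $ j) * a (k - l) $ i))) has_sum
       of_real ((2 * pi) ^ 3) * fourier_coeff (advect u u) k $ i) UNIV"
      by (simp only:) (rule has_sum_finite_sum[OF finite summand])
    have 2: "(\<Sum>j\<in>UNIV. of_real ((2 * pi) ^ 3) * (a l $ j * (\<i> * of_int ((k - l) $ j) * a (k - l) $ i)))
       = of_real ((2 * pi) ^ 3) * (((\<i> * kdot k (a l)) *s a (k - l)) $ i)" for l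
    proof -
      have "(\<Sum>j\<in>UNIV. of_real ((2 * pi) ^ 3) * (a l $ j * (\<i> * of_int ((k - l) $ j) * a (k - l) $ i)))
         = of_real ((2 * pi) ^ 3) * (\<i> * kdot (k - l) (a l) * a (k - l) $ i)"
        unfolding sum_distrib_left sum_distrib_right by (simp only: mult_ac)
      also have "kdot (k - l) (a l) = kdot k (a l) - kdot l (a l)"
        by (simp add: left_diff_distrib sum_subtractf)
      also have "kdot l (a l) = 0" using H by (simp add: H_coeffs_def)
      finally show ?thesis by simp
    qed
    have "((\<lambda>l. ((\<i> * kdot k (a l)) *s a (k - l)) $ i) has_sum advect_coeff a k $ i) UNIV"
      unfolding advect_coeff_def
      by (rule has_sum_bounded_linear[OF bounded_linear_vec_nth, unfolded o_def], rule has_sum_infsum,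
          rule abs_summable_summable, rule advect_coeff_summable(1)[of s])
        (use gv s in \<open>auto simp: a_def\<close>)
    then have 3: "((\<lambda>l. of_real ((2 * pi) ^ 3) * (((\<i> * kdot k (a l)) *s a (k - l)) $ i)) has_sum
        of_real ((2 * pi) ^ 3) * advect_coeff a k $ i) UNIV"
      by (rule has_sum_cmult_right)
    show ?thesis using has_sum_unique[OF 1[unfolded 2] 3] .
  qed
  then have "fourier_coeff (advect u u) k $ i = advect_coeff a k $ i" for i
    using V mult_left_cancel by blast
  then show "fourier_coeff (advect u u) k = advect_coeff (fourier_coeff u) k"
    by (simp add: vec_eq_iff a_def)
qed

subsection \<open>The Leray projection of the nonlinear term\<close>

text \<open>The orthogonal projection of \<open>\<complex>\<^sup>3\<close> to the complement of \<open>k\<close>; on the zero mode it is \<open>0\<close> because fields in \<open>H\<close>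
  have mean zero.\<close>

definition leray_symbol :: "int^3 \<Rightarrow> complex^3 \<Rightarrow> complex^3" where
  "leray_symbol k v = (if k = 0 then 0 else v - (kdot k v / of_real ((norm (real_vec k))\<^sup>2)) *s (\<chi> i. of_int (k $ i)))"

lemma real_vec_eq_0: "real_vec k = 0 \<longleftrightarrow> k = 0"
  by (simp add: real_vec_def vec_eq_iff)

lemma kdot_self: "kdot k (\<chi> i. of_int (k $ i)) = of_real ((norm (real_vec k))\<^sup>2)"
proof -
  have "(norm (real_vec k))\<^sup>2 = (\<Sum>i\<in>UNIV. (real_of_int (k $ i))\<^sup>2)"
    by (simp add: norm_vec_def L2_set_def sum_nonneg)
  then show ?thesis by (simp add: power2_eq_square)
qed

lemma kdot_leray_symbol: "kdot k (leray_symbol k v) = 0"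
proof (cases "k = 0")
  case False
  then have n: "complex_of_real ((norm (real_vec k))\<^sup>2) \<noteq> 0" by (simp add: real_vec_eq_0)
  define c where "c = kdot k v / of_real ((norm (real_vec k))\<^sup>2)"
  have "kdot k (v - c *s w) = kdot k v - c * kdot k w" for w
    unfolding sum_distrib_left sum_subtractf[symmetric] by (simp add: algebra_simps)
  then have "kdot k (leray_symbol k v) = kdot k v - c * kdot k (\<chi> i. of_int (k $ i))"
    using False by (simp only: leray_symbol_def c_def[symmetric] if_False)
  also have "\<dots> = 0" unfolding kdot_self c_def using n by simp
  finally show ?thesis .
qed (simp add: leray_symbol_def)

lemma inner_leray_symbol:
  assumes "kdot k w = 0" "k \<noteq> 0"
  shows "leray_symbol k v \<bullet> w = v \<bullet> w"
proof -
  have o: "(c *s (\<chi> i. of_int (k $ i))) \<bullet> w = 0" for c :: complex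
  proof -
    have "(c *s (\<chi> i. of_int (k $ i))) \<bullet> w = Re (\<Sum>i\<in>UNIV. c * cnj (of_int (k $ i) * w $ i))"
      unfolding Re_sum by (simp add: inner_vec_def inner_complex_def algebra_simps)
    also have "(\<Sum>i\<in>UNIV. c * cnj (of_int (k $ i) * w $ i)) = c * cnj (kdot k w)"
      unfolding cnj_sum sum_distrib_left ..
    finally show ?thesis using assms by simp
  qed
  show ?thesis using assms by (simp add: leray_symbol_def inner_diff_left o)
qed

lemma norm_leray_symbol_le: "norm (leray_symbol k v) \<le> 2 * norm v"
proof (cases "k = 0")
  case False
  define n where "n = norm (real_vec k)"
  have n: "n > 0" using False by (simp add: n_def real_vec_eq_0)
  have nk: "norm (\<chi> i. complex_of_int (k $ i)) = n"
    by (simp add: n_def norm_vec_def L2_set_def)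
  have "norm (leray_symbol k v) \<le> norm v + norm ((kdot k v / of_real (n\<^sup>2)) *s (\<chi> i. complex_of_int (k $ i)))"
    using False norm_triangle_ineq4 by (simp add: leray_symbol_def n_def)
  also have "norm ((kdot k v / of_real (n\<^sup>2)) *s (\<chi> i. complex_of_int (k $ i))) = cmod (kdot k v) / n"
    unfolding norm_smult_complex nk using n by (simp add: norm_divide norm_mult power2_eq_square)
  also have "\<dots> \<le> norm v"
    using cmod_kdot_le[of k v] n by (simp add: n_def pos_divide_le_eq mult.commute)
  finally show ?thesis by simp
qed (simp add: leray_symbol_def)

text \<open>The coefficients of the nonlinear term are summable, so the projected series is a field in \<open>H\<close>.  The remainder has
  coefficients along \<open>k\<close>, hence is orthogonal to \<open>H\<close> by Parseval.\<close>

lemma leray_exists: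
  assumes u: "u \<in> H_space" and gv: "gevrey s (fourier_coeff u)" and s: "s > 0"
  shows "\<exists>h. h \<in> H_space \<and> (\<forall>v\<in>H_space. L2inner (\<lambda>x. advect u u x - h x) v = 0)"
proof -
  define a where "a = fourier_coeff u"
  define w where "w = advect u u"
  note W = advect_fourier[OF assms, folded w_def a_def]
  have gva: "gevrey s a" using gv by (simp add: a_def)
  have ns: "(\<lambda>k. norm (advect_coeff a k)) summable_on UNIV"
  proof (rule summable_on_comparison_test)
    show "norm (advect_coeff a k) \<le> norm (real_vec k) * exp (- s * norm (real_vec k)) * gevrey_sum s a" for k
      by (rule advect_coeff_bound[OF gva]) (use s in simp)
    have "\<bar>(norm (real_vec k) * exp (- (s/2) * norm (real_vec k))) * exp (- (s/2) * norm (real_vec k))\<bar> = norm (real_vec k) * exp (- s * norm (real_vec k))" for k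
      by (simp add: abs_mult mult.assoc exp_add[symmetric])
    moreover have "(\<lambda>k::int^3. \<bar>(norm (real_vec k) * exp (- (s/2) * norm (real_vec k))) * exp (- (s/2) * norm (real_vec k))\<bar>) summable_on UNIV"
    proof (rule summable_on_mult_of_squares[OF lattice_const_summable(1)])
      have "(exp (- (s/2) * norm (real_vec k)))\<^sup>2 = exp (- s * norm (real_vec k))" for k
        by (simp add: exp_double[symmetric])
      then show "(\<lambda>k::int^3. (exp (- (s/2) * norm (real_vec k)))\<^sup>2) summable_on UNIV"
        using summable_exp_lattice[OF s] by simp
    qed (use s in simp)
    ultimately have "(\<lambda>k::int^3. norm (real_vec k) * exp (- s * norm (real_vec k))) summable_on UNIV"
      by (simp only:)
    then show "(\<lambda>k::int^3. norm (real_vec k) * exp (- s * norm (real_vec k)) * gevrey_sum s a) summable_on UNIV"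
      by (rule summable_on_cmult_left)
  qed simp
  define p where "p k = leray_symbol k (advect_coeff a k)" for k
  have ps: "(\<lambda>k. norm (p k)) summable_on UNIV"
    by (rule summable_on_comparison_test[OF summable_on_cmult_right[OF ns, of 2]])
      (auto simp: p_def norm_leray_symbol_le)
  have Hp: "H_coeffs p" unfolding H_coeffs_def
  proof (intro conjI allI)
    show "p 0 = 0" by (simp add: p_def leray_symbol_def)
    show "kdot k (p k) = 0" for k unfolding p_def by (rule kdot_leray_symbol)
    fix k i
    have hm: "advect_coeff a (- k) $ j = cnj (advect_coeff a k $ j)" for j
      by (simp add: W(2)[symmetric] fourier_coeff_nth fcoeff_minus)
    have "kdot (- k) (advect_coeff a (- k)) = - cnj (kdot k (advect_coeff a k))"
      by (simp add: hm cnj_sum sum_negf)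
    then show "p (- k) $ i = cnj (p k $ i)"
      by (simp add: p_def leray_symbol_def hm)
  qed
  obtain h where h: "h \<in> H_space" "\<And>k. fourier_coeff h k = p k" using H_coeffs_field[OF Hp ps] by blast
  have hi: "integrable torus (\<lambda>x. h x $ i)" for i by (rule L2per_component(1)[OF H_space_L2per[OF h(1)]])
  define z where "z x = w x - h x" for x
  have zi: "integrable torus (\<lambda>x. z x $ i)" for i unfolding z_def using W(1) hi by simp
  have zc: "fourier_coeff z k = advect_coeff a k - p k" for k
    using fcoeff_diff[OF W(1) hi] by (simp add: vec_eq_iff fourier_coeff_nth z_def W(2)[symmetric] h(2)[symmetric])
  have zs: "(\<lambda>k. norm (fourier_coeff z k)) summable_on UNIV"
    by (rule summable_on_comparison_test[OF summable_on_add[OF ns ps]]) (auto simp: zc norm_triangle_ineq4)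
  have "L2inner z v = 0" if v: "v \<in> H_space" for v
  proof -
    have Hv: "H_coeffs (fourier_coeff v)" by (rule H_space_coeffs[OF v])
    have o: "fourier_coeff z k \<bullet> fourier_coeff v k = 0" for k
    proof (cases "k = 0")
      case True
      then show ?thesis using Hv by (simp add: H_coeffs_def)
    next
      case False
      then have "p k \<bullet> fourier_coeff v k = advect_coeff a k \<bullet> fourier_coeff v k"
        unfolding p_def using Hv by (intro inner_leray_symbol) (auto simp: H_coeffs_def)
      then show ?thesis by (simp add: zc inner_diff_left)
    qed
    have "((\<lambda>k. (2 * pi) ^ 3 * (fourier_coeff z k \<bullet> fourier_coeff v k)) has_sum L2inner z v) UNIV"
      by (rule parseval_summable[OF zi zs L2per_component(1)[OF H_space_L2per[OF v]]])
    then have "((\<lambda>k::int^3. 0::real) has_sum L2inner z v) UNIV" by (simp add: o)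
    then show ?thesis using has_sum_unique has_sum_0_simp by blast
  qed
  then show ?thesis using h(1) unfolding z_def w_def by blast
qed

text \<open>Any field that satisfies the defining property of \<open>leray\<close> has these components orthogonal to \<open>k\<close>, as one sees by
  pairing with \<open>mode_field\<close>; so the field chosen by \<open>leray\<close> has them.\<close>

theorem B_coeff:
  assumes u: "u \<in> H_space" and gv: "gevrey s (fourier_coeff u)" and s: "s > 0"
  shows "B u u \<in> H_space"
    and "kdot k c = 0 \<Longrightarrow> k \<noteq> 0 \<Longrightarrow> fourier_coeff (B u u) k \<bullet> c = advect_coeff (fourier_coeff u) k \<bullet> c"
proof -
  define h where "h = B u u"
  have h: "h \<in> H_space" "\<And>v. v \<in> H_space \<Longrightarrow> L2inner (\<lambda>x. advect u u x - h x) v = 0"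
    using someI_ex[OF leray_exists[OF assms]] by (auto simp: h_def B_def leray_def)
  show "B u u \<in> H_space" using h by (simp add: h_def)
  show "fourier_coeff (B u u) k \<bullet> c = advect_coeff (fourier_coeff u) k \<bullet> c" if c: "kdot k c = 0" "k \<noteq> 0"
  proof -
    note W = advect_fourier[OF assms]
    have hi: "integrable torus (\<lambda>x. h x $ i)" for i by (rule L2per_component(1)[OF H_space_L2per[OF h(1)]])
    obtain v where v: "v \<in> H_space"
      "\<And>g. (\<And>i. integrable torus (\<lambda>x. g x $ i)) \<Longrightarrow> L2inner g v = 2 * (2 * pi) ^ 3 * (fourier_coeff g k \<bullet> c)"
      using mode_field[OF c(2,1)] by metis
    have "L2inner (\<lambda>x. advect u u x - h x) v = 2 * (2 * pi) ^ 3 * (fourier_coeff (\<lambda>x. advect u u x - h x) k \<bullet> c)"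
      by (rule v(2)) (use W(1) hi in simp)
    then have "fourier_coeff (\<lambda>x. advect u u x - h x) k \<bullet> c = 0" using h(2)[OF v(1)] by simp
    moreover have "fourier_coeff (\<lambda>x. advect u u x - h x) k = advect_coeff (fourier_coeff u) k - fourier_coeff h k"
      using fcoeff_diff[OF W(1) hi] by (simp add: vec_eq_iff fourier_coeff_nth W(2)[symmetric])
    ultimately show ?thesis by (simp add: inner_diff_left h_def)
  qed
qed

section \<open>The energy identity for absolutely continuous functions\<close>

lemma integrable_lebesgue_on_subinterval:
  fixes r :: "real \<Rightarrow> 'b::{banach, second_countable_topology}"
  assumes "integrable (lebesgue_on {s..t}) r" "s \<le> x" "y \<le> t"
  shows "integrable (lebesgue_on {x..y}) r"
proof -
  have "set_integrable lebesgue {s..t} r" using assms(1) by (simp add: set_integrable_def integrable_restrict_space)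
  then have "set_integrable lebesgue {x..y} r" by (rule set_integrable_subset) (use assms in auto)
  then show ?thesis by (simp add: set_integrable_def integrable_restrict_space)
qed

lemma integral_lebesgue_on_combine:
  fixes r :: "real \<Rightarrow> 'b::euclidean_space"
  assumes r: "integrable (lebesgue_on {s..t}) r" and x: "s \<le> x" "x \<le> t"
  shows "(\<integral>y. r y \<partial>lebesgue_on {s..x}) + (\<integral>y. r y \<partial>lebesgue_on {x..t}) = (\<integral>y. r y \<partial>lebesgue_on {s..t})"
proof -
  have i: "integrable (lebesgue_on {s..x}) r" "integrable (lebesgue_on {x..t}) r"
    using x by (auto intro: integrable_lebesgue_on_subinterval[OF r])
  have e: "(\<integral>y. r y \<partial>lebesgue_on {p..q}) = integral {p..q} r" if "integrable (lebesgue_on {p..q}) r" for p q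
    by (rule lebesgue_integral_eq_integral[OF that]) simp
  have "r integrable_on {s..t}" using integrable_on_lebesgue_on[OF r] by simp
  then show ?thesis
    unfolding e[OF r] e[OF i(1)] e[OF i(2)] by (rule Henstock_Kurzweil_Integration.integral_combine[OF x])
qed

lemma finite_measure_interval: "finite_measure (lebesgue_on {s..t::real})"
proof
  have "emeasure lebesgue {s..t} = emeasure lborel {s..t}" by simp
  also have "\<dots> < \<infinity>" using emeasure_lborel_cbox_finite[of s t] by simp
  finally show "emeasure (lebesgue_on {s..t}) (space (lebesgue_on {s..t})) \<noteq> \<infinity>"
    by (simp add: emeasure_restrict_space)
qed

text \<open>The chain rule for the square of an indefinite integral.  Fubini over the triangle \<open>y \<le> x\<close> gives
  \<open>\<integral> r (g - g s) = \<integral> r (g t - g)\<close>, which can be solved for \<open>\<integral> r g\<close>.\<close>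

lemma absolutely_continuous_square:
  fixes g r :: "real \<Rightarrow> real"
  assumes r: "integrable (lebesgue_on {s..t}) r" and st: "s \<le> t"
    and AC: "\<And>x y. s \<le> x \<Longrightarrow> x \<le> y \<Longrightarrow> y \<le> t \<Longrightarrow> g y - g x = (\<integral>z. r z \<partial>lebesgue_on {x..y})"
    and g: "continuous_on {s..t} g"
  shows "integrable (lebesgue_on {s..t}) (\<lambda>x. g x * r x)"
    and "(g t)\<^sup>2 - (g s)\<^sup>2 = 2 * (\<integral>x. g x * r x \<partial>lebesgue_on {s..t})"
proof -
  define M where "M = lebesgue_on {s..t}"
  interpret M: finite_measure M unfolding M_def by (rule finite_measure_interval)
  interpret P: pair_sigma_finite M M by unfold_locales
  have rM: "integrable M r" using r by (simp add: M_def)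
  have rm[measurable]: "r \<in> borel_measurable M" using rM by simp
  have gm[measurable]: "g \<in> borel_measurable M"
    unfolding M_def by (rule continuous_imp_measurable_on_sets_lebesgue[OF g]) simp
  have idm[measurable]: "(\<lambda>x. x) \<in> borel_measurable M"
    unfolding M_def by (rule continuous_imp_measurable_on_sets_lebesgue) (auto intro: continuous_intros)
  have spM: "space M = {s..t}" by (simp add: M_def)
  have "bounded (g ` {s..t})" by (intro compact_imp_bounded compact_continuous_image g) simp
  then obtain C where "\<forall>y\<in>g ` {s..t}. norm y \<le> C" unfolding bounded_iff by blast
  then have C: "\<bar>g x\<bar> \<le> C" if "x \<in> {s..t}" for x using that by auto
  have gr: "integrable M (\<lambda>x. g x * r x)"
  proof (rule Bochner_Integration.integrable_bound[of _ "\<lambda>x. C * r x"])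
    show "AE x in M. norm (g x * r x) \<le> norm (C * r x)"
    proof (rule AE_I2)
      fix x assume "x \<in> space M"
      then have "\<bar>g x\<bar> \<le> \<bar>C\<bar>" using C[of x] by (auto simp: spM)
      then show "norm (g x * r x) \<le> norm (C * r x)" by (simp add: abs_mult mult_right_mono)
    qed
  qed (use rM in auto)
  then show "integrable (lebesgue_on {s..t}) (\<lambda>x. g x * r x)" by (simp add: M_def)
  \<comment> \<open>The integrand over the triangle \<open>y \<le> x\<close>, integrated first in \<open>y\<close> and then in \<open>x\<close>, and vice versa.\<close>
  define K where "K x y = r x * (r y * indicator {y. y \<le> x} y)" for x y :: real
  have Km: "case_prod K \<in> borel_measurable (M \<Otimes>\<^sub>M M)"
  proof -
    have "(\<lambda>(x, y). r x * (r y * (if y \<le> x then 1 else 0))) \<in> borel_measurable (M \<Otimes>\<^sub>M M)"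
      by measurable
    moreover have "case_prod K = (\<lambda>(x, y). r x * (r y * (if y \<le> x then 1 else 0)))"
      by (auto simp: K_def indicator_def)
    ultimately show ?thesis by simp
  qed
  have Kb: "norm (K x y) \<le> \<bar>r x\<bar> * \<bar>r y\<bar>" for x y by (auto simp: K_def abs_mult indicator_def)
  have Kx: "integrable M (\<lambda>y. K x y)" for x
  proof (rule Bochner_Integration.integrable_bound[of _ "\<lambda>y. \<bar>r x\<bar> * \<bar>r y\<bar>"])
    show "(\<lambda>y. K x y) \<in> borel_measurable M" unfolding K_def by measurable
  qed (use rM Kb in auto)
  have K: "integrable (M \<Otimes>\<^sub>M M) (case_prod K)"
  proof (rule P.Fubini_integrable[OF Km])
    show "AE x in M. integrable M (\<lambda>y. case_prod K (x, y))" using Kx by simp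
    have nm: "(\<lambda>x. \<integral>y. norm (case_prod K (x, y)) \<partial>M) \<in> borel_measurable M"
      using Km by (intro M.borel_measurable_lebesgue_integral) simp
    show "integrable M (\<lambda>x. \<integral>y. norm (case_prod K (x, y)) \<partial>M)"
    proof (rule Bochner_Integration.integrable_bound[OF _ nm])
      show "integrable M (\<lambda>x. \<bar>r x\<bar> * (\<integral>y. \<bar>r y\<bar> \<partial>M))" using rM by simp
      show "AE x in M. norm (\<integral>y. norm (case_prod K (x, y)) \<partial>M) \<le> norm (\<bar>r x\<bar> * (\<integral>y. \<bar>r y\<bar> \<partial>M))"
      proof (rule AE_I2)
        fix x
        have "(\<integral>y. norm (K x y) \<partial>M) \<le> (\<integral>y. \<bar>r x\<bar> * \<bar>r y\<bar> \<partial>M)"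
          by (rule integral_mono) (use rM Kx Kb in auto)
        then show "norm (\<integral>y. norm (case_prod K (x, y)) \<partial>M) \<le> norm (\<bar>r x\<bar> * (\<integral>y. \<bar>r y\<bar> \<partial>M))"
          by (simp add: abs_mult)
      qed
    qed
  qed
  have sub: "(\<integral>z. r z * indicator A z \<partial>M) = (\<integral>z. r z \<partial>lebesgue_on {p..q})"
    if "{p..q} = {s..t} \<inter> A" for A p q
  proof -
    have "(\<integral>z. r z * indicator A z \<partial>M) = (\<integral>z. indicator {s..t} z *\<^sub>R (r z * indicator A z) \<partial>lebesgue)"
      unfolding M_def by (rule integral_restrict_space) simp
    also have "\<dots> = (\<integral>z. indicator {p..q} z *\<^sub>R r z \<partial>lebesgue)"
      by (rule Bochner_Integration.integral_cong) (auto simp: that indicator_def)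
    also have "\<dots> = (\<integral>z. r z \<partial>lebesgue_on {p..q})"
      by (rule integral_restrict_space[symmetric]) simp
    finally show ?thesis .
  qed
  have i1: "(\<integral>y. K x y \<partial>M) = r x * (g x - g s)" if "x \<in> {s..t}" for x
  proof -
    have "(\<integral>y. r y * indicator {y. y \<le> x} y \<partial>M) = (\<integral>z. r z \<partial>lebesgue_on {s..x})"
      by (rule sub) (use that in auto)
    also have "\<dots> = g x - g s" using that by (intro AC[symmetric]) auto
    finally show ?thesis by (simp add: K_def)
  qed
  have i2: "(\<integral>x. K x y \<partial>M) = r y * (g t - g y)" if "y \<in> {s..t}" for y
  proof -
    have "K x y = r y * (r x * indicator {x. y \<le> x} x)" for x by (auto simp: K_def indicator_def)
    then have "(\<integral>x. K x y \<partial>M) = r y * (\<integral>x. r x * indicator {x. y \<le> x} x \<partial>M)" by simp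
    also have "(\<integral>x. r x * indicator {x. y \<le> x} x \<partial>M) = (\<integral>z. r z \<partial>lebesgue_on {y..t})"
      by (rule sub) (use that in auto)
    also have "\<dots> = g t - g y" using that by (intro AC[symmetric]) auto
    finally show ?thesis .
  qed
  have "(\<integral>y. (\<integral>x. K x y \<partial>M) \<partial>M) = (\<integral>x. (\<integral>y. K x y \<partial>M) \<partial>M)"
    by (rule P.Fubini_integral[OF K])
  moreover have "(\<integral>y. (\<integral>x. K x y \<partial>M) \<partial>M) = (\<integral>y. g t * r y - g y * r y \<partial>M)"
    by (rule Bochner_Integration.integral_cong) (auto simp: spM i2 algebra_simps)
  moreover have "(\<integral>x. (\<integral>y. K x y \<partial>M) \<partial>M) = (\<integral>x. g x * r x - g s * r x \<partial>M)"
    by (rule Bochner_Integration.integral_cong) (auto simp: spM i1 algebra_simps)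
  ultimately have "g t * (\<integral>x. r x \<partial>M) - (\<integral>x. g x * r x \<partial>M) = (\<integral>x. g x * r x \<partial>M) - g s * (\<integral>x. r x \<partial>M)"
    using rM gr by simp
  moreover have "(\<integral>x. r x \<partial>M) = g t - g s" unfolding M_def using st by (intro AC[symmetric]) auto
  ultimately show "(g t)\<^sup>2 - (g s)\<^sup>2 = 2 * (\<integral>x. g x * r x \<partial>lebesgue_on {s..t})"
    by (simp add: M_def[symmetric] power2_eq_square algebra_simps)
qed

lemma absolutely_continuous_norm_square:
  fixes g r :: "real \<Rightarrow> 'a::euclidean_space"
  assumes r: "\<And>b. b \<in> Basis \<Longrightarrow> integrable (lebesgue_on {s..t}) (\<lambda>x. r x \<bullet> b)" and st: "s \<le> t"
    and AC: "\<And>x y b. b \<in> Basis \<Longrightarrow> s \<le> x \<Longrightarrow> x \<le> y \<Longrightarrow> y \<le> t \<Longrightarrow> g y \<bullet> b - g x \<bullet> b = (\<integral>z. r z \<bullet> b \<partial>lebesgue_on {x..y})"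
    and g: "continuous_on {s..t} g"
  shows "integrable (lebesgue_on {s..t}) (\<lambda>x. r x \<bullet> g x)"
    and "(norm (g t))\<^sup>2 - (norm (g s))\<^sup>2 = 2 * (\<integral>x. r x \<bullet> g x \<partial>lebesgue_on {s..t})"
proof -
  have gb: "continuous_on {s..t} (\<lambda>x. g x \<bullet> b)" for b by (intro continuous_intros g)
  note S = absolutely_continuous_square[OF r st AC gb]
  have n: "(norm y)\<^sup>2 = (\<Sum>b\<in>Basis. (y \<bullet> b)\<^sup>2)" for y :: 'a
    unfolding power2_norm_eq_inner euclidean_inner[of y y] by (simp add: power2_eq_square)
  have i: "r x \<bullet> g x = (\<Sum>b\<in>Basis. (g x \<bullet> b) * (r x \<bullet> b))" for x
    unfolding euclidean_inner[of "r x" "g x"] by (simp add: mult.commute)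
  show "integrable (lebesgue_on {s..t}) (\<lambda>x. r x \<bullet> g x)" unfolding i
    by (intro Bochner_Integration.integrable_sum S(1))
  have "(norm (g t))\<^sup>2 - (norm (g s))\<^sup>2 = (\<Sum>b\<in>Basis. (g t \<bullet> b)\<^sup>2 - (g s \<bullet> b)\<^sup>2)"
    by (simp add: n sum_subtractf)
  also have "\<dots> = (\<Sum>b\<in>Basis. 2 * (\<integral>x. (g x \<bullet> b) * (r x \<bullet> b) \<partial>lebesgue_on {s..t}))"
    by (intro sum.cong refl S(2))
  also have "\<dots> = 2 * (\<integral>x. r x \<bullet> g x \<partial>lebesgue_on {s..t})"
    unfolding i by (subst Bochner_Integration.integral_sum) (auto simp: sum_distrib_left intro: S(1))
  finally show "(norm (g t))\<^sup>2 - (norm (g s))\<^sup>2 = 2 * (\<integral>x. r x \<bullet> g x \<partial>lebesgue_on {s..t})" .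
qed

section \<open>Weak solutions in Fourier variables\<close>

lemma set_integral_interval:
  fixes g :: "real \<Rightarrow> 'b::{banach, second_countable_topology}"
  shows "(LINT x:{s..t}|lebesgue. g x) = (\<integral>x. g x \<partial>lebesgue_on {s..t})"
    and "set_integrable lebesgue {s..t} g \<longleftrightarrow> integrable (lebesgue_on {s..t}) g"
  by (simp_all add: set_lebesgue_integral_def integral_restrict_space set_integrable_def integrable_restrict_space)

lemma leray_symbol_id: "kdot k v = 0 \<Longrightarrow> k \<noteq> 0 \<Longrightarrow> leray_symbol k v = v"
  by (simp add: leray_symbol_def)

lemma linear_leray_symbol: "linear (leray_symbol k)"
proof (rule linearI)
  have "kdot k (b + c) = kdot k b + kdot k c" for b c by (simp add: algebra_simps sum.distrib)
  then show "leray_symbol k (b + c) = leray_symbol k b + leray_symbol k c" for b c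
    by (simp add: leray_symbol_def add_divide_distrib vector_sadd_rdistrib)
  have sc: "r *\<^sub>R z = complex_of_real r * z" for r z by (rule scaleR_conv_of_real)
  have kd: "kdot k (r *\<^sub>R b) = complex_of_real r * kdot k b" for r b
    unfolding sum_distrib_left by (simp add: vector_scaleR_component sc algebra_simps)
  show "leray_symbol k (r *\<^sub>R b) = r *\<^sub>R leray_symbol k b" for r b
    unfolding leray_symbol_def kd by (simp add: vec_eq_iff sc algebra_simps)
qed

text \<open>The weak equation is tested with the mode fields for the projections of the basis vectors \<open>b\<close> of \<open>\<complex>\<^sup>3\<close>.  The
  coefficient of \<open>u\<close> is orthogonal to \<open>k\<close>, so that its component along the projection of \<open>b\<close> is its component
  along \<open>b\<close>.\<close>

lemma mode_equation:
  assumes ws: "weak_solution \<mu> \<sigma> T u0 f u" and \<sigma>: "\<sigma> > 0" and T: "T > 0" and k: "k \<noteq> 0"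
    and f: "\<And>t. t \<in> {0..T} \<Longrightarrow> f t \<in> H_space"
  obtains r :: "real \<Rightarrow> complex^3" where
    "\<And>b. b \<in> Basis \<Longrightarrow> integrable (lebesgue_on {0..T}) (\<lambda>s. r s \<bullet> b)"
    "\<And>b s t. b \<in> Basis \<Longrightarrow> 0 \<le> s \<Longrightarrow> s \<le> t \<Longrightarrow> t \<le> T \<Longrightarrow>
        fourier_coeff (u t) k \<bullet> b - fourier_coeff (u s) k \<bullet> b = (\<integral>x. r x \<bullet> b \<partial>lebesgue_on {s..t})"
    "AE s in lebesgue_on {0..T}. r s \<bullet> fourier_coeff (u s) k =
        fourier_coeff (f s) k \<bullet> fourier_coeff (u s) k
        - \<mu> * (exp (2 * \<sigma> * norm (real_vec k)) * (norm (fourier_coeff (u s) k))\<^sup>2)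
        - advect_coeff (fourier_coeff (u s)) k \<bullet> fourier_coeff (u s) k"
proof -
  define V :: real where "V = 2 * (2 * pi) ^ 3"
  have V: "V > 0" by (simp add: V_def)
  \<comment> \<open>Mode fields exist for amplitudes orthogonal to \<open>k\<close>, so the basis vectors are projected.\<close>
  define c where "c b = leray_symbol k b" for b
  have c0: "kdot k (c b) = 0" for b unfolding c_def by (rule kdot_leray_symbol)
  have "\<forall>b. \<exists>v. v \<in> H_space \<and> (\<forall>l. v \<in> dom_expA l) \<and>
    (\<forall>g. (\<forall>i. integrable torus (\<lambda>x. g x $ i)) \<longrightarrow> L2inner g v = V * (fourier_coeff g k \<bullet> c b)) \<and>
    (\<forall>l g. g \<in> H_space \<longrightarrow> L2inner g (expA l v) = V * (exp (l * norm (real_vec k)) * (fourier_coeff g k \<bullet> c b)))"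
    unfolding V_def by (intro allI, rule mode_field[OF k c0], blast)
  then obtain v where v: "\<And>b. v b \<in> H_space" "\<And>b l. v b \<in> dom_expA l"
    "\<And>b g. (\<And>i. integrable torus (\<lambda>x. g x $ i)) \<Longrightarrow> L2inner g (v b) = V * (fourier_coeff g k \<bullet> c b)"
    "\<And>b l g. g \<in> H_space \<Longrightarrow> L2inner g (expA l (v b)) = V * (exp (l * norm (real_vec k)) * (fourier_coeff g k \<bullet> c b))"
    by metis
  define R where "R b s = L2inner (f s) (v b) - \<mu> * L2inner (expA \<sigma> (u s)) (expA \<sigma> (v b)) - L2inner (B (u s) (u s)) (v b)" for b s
  have Ri: "integrable (lebesgue_on {0..T}) (R b)" and
    Re: "\<And>t. t \<in> {0..T} \<Longrightarrow> L2inner (u t) (v b) - L2inner u0 (v b) = (\<integral>s. R b s \<partial>lebesgue_on {0..t})" for b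
    using ws v(2)[of b \<sigma>] unfolding weak_solution_def Let_def R_def[abs_def]
    by (auto simp: set_integral_interval[symmetric])
  have uH: "u t \<in> H_space" if "t \<in> {0..T}" for t
    using ws that by (auto simp: weak_solution_def continuous_in_H_def)
  have comp: "\<And>i. integrable torus (\<lambda>x. g x $ i)" if "g \<in> H_space" for g
    by (rule L2per_component(1)[OF H_space_L2per[OF that]])
  have k0: "kdot k (fourier_coeff g k) = 0" if "g \<in> H_space" for g
    using H_space_coeffs[OF that] by (simp add: H_coeffs_def)
  have cb: "fourier_coeff g k \<bullet> c b = fourier_coeff g k \<bullet> b" if "g \<in> H_space" for g b
    using inner_leray_symbol[OF k0[OF that] k, of b] by (simp add: c_def inner_commute)
  define r where "r s = (\<Sum>b\<in>Basis. (R b s / V) *\<^sub>R b)" for s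
  have rb: "r s \<bullet> b = R b s / V" if "b \<in> Basis" for s b
    using that by (simp add: r_def inner_sum_left inner_Basis if_distrib cong: if_cong)
  show thesis
  proof (rule that[of r])
    show "integrable (lebesgue_on {0..T}) (\<lambda>s. r s \<bullet> b)" if "b \<in> Basis" for b
      using Ri[of b] by (simp add: rb[OF that])
    show "fourier_coeff (u t) k \<bullet> b - fourier_coeff (u s) k \<bullet> b = (\<integral>x. r x \<bullet> b \<partial>lebesgue_on {s..t})"
      if b: "b \<in> Basis" and st: "0 \<le> s" "s \<le> t" "t \<le> T" for b s t
    proof -
      have s': "s \<in> {0..T}" and t': "t \<in> {0..T}" using st by auto
      have "(\<integral>x. R b x \<partial>lebesgue_on {0..s}) + (\<integral>x. R b x \<partial>lebesgue_on {s..t}) = (\<integral>x. R b x \<partial>lebesgue_on {0..t})"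
        by (rule integral_lebesgue_on_combine) (use st integrable_lebesgue_on_subinterval[OF Ri[of b]] in auto)
      then have "(\<integral>x. R b x \<partial>lebesgue_on {s..t}) = L2inner (u t) (v b) - L2inner (u s) (v b)"
        using Re[OF s', of b] Re[OF t', of b] by simp
      also have "\<dots> = V * (fourier_coeff (u t) k \<bullet> b - fourier_coeff (u s) k \<bullet> b)"
        unfolding v(3)[OF comp[OF uH[OF s']]] v(3)[OF comp[OF uH[OF t']]] cb[OF uH[OF s']] cb[OF uH[OF t']]
        by (simp add: right_diff_distrib)
      finally show ?thesis using V by (simp add: rb[OF b])
    qed
    have "AE s in lebesgue_on {0..T}. u s \<in> dom_expA \<sigma>"
      using ws by (auto simp: weak_solution_def expA_in_L2_def AE_restrict_space_iff)
    then show "AE s in lebesgue_on {0..T}. r s \<bullet> fourier_coeff (u s) k =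
        fourier_coeff (f s) k \<bullet> fourier_coeff (u s) k
        - \<mu> * (exp (2 * \<sigma> * norm (real_vec k)) * (norm (fourier_coeff (u s) k))\<^sup>2)
        - advect_coeff (fourier_coeff (u s)) k \<bullet> fourier_coeff (u s) k"
      using AE_space
    proof eventually_elim
      case (elim s)
      then have s: "s \<in> {0..T}" and d: "u s \<in> dom_expA \<sigma>" by auto
      define a where "a = fourier_coeff (u s)"
      have e: "is_expA \<sigma> (u s) (expA \<sigma> (u s))" by (rule expA_is_expA[OF d])
      have eH: "expA \<sigma> (u s) \<in> H_space" using e by (simp add: is_expA_def)
      note Bc = B_coeff[OF uH[OF s] dom_expA_gevrey(1)[OF d] \<sigma>, folded a_def]
      define x where "x = fourier_coeff (f s) k - (\<mu> * exp (2 * \<sigma> * norm (real_vec k))) *\<^sub>R a k - advect_coeff a k"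
      have ie: "(complex_of_real y *s z) \<bullet> w = y * (z \<bullet> w)" for y z and w :: "complex^3"
        by (simp add: inner_vec_def inner_complex_def sum_distrib_left algebra_simps)
      have Rb: "R b s / V = x \<bullet> c b" for b
      proof -
        have "L2inner (expA \<sigma> (u s)) (expA \<sigma> (v b)) = V * (exp (2 * \<sigma> * norm (real_vec k)) * (a k \<bullet> c b))"
          unfolding v(4)[OF eH] is_expA_coeff[OF e] ie a_def
          by (simp add: mult.assoc[symmetric] exp_add[symmetric])
        then have "R b s = V * (fourier_coeff (f s) k \<bullet> c b - \<mu> * (exp (2 * \<sigma> * norm (real_vec k)) * (a k \<bullet> c b)) - advect_coeff a k \<bullet> c b)"
          unfolding R_def v(3)[OF comp[OF f[OF s]]] v(3)[OF comp[OF Bc(1)]] Bc(2)[OF c0 k]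
          by (simp add: algebra_simps)
        then show ?thesis using V by (simp add: x_def inner_diff_left mult.assoc)
      qed
      have "r s \<bullet> a k = (\<Sum>b\<in>Basis. (x \<bullet> c b) * (a k \<bullet> b))"
        unfolding r_def Rb inner_sum_left inner_scaleR_left by (simp add: inner_commute)
      also have "\<dots> = x \<bullet> (\<Sum>b\<in>Basis. (a k \<bullet> b) *\<^sub>R leray_symbol k b)"
        by (simp add: inner_sum_right c_def mult.commute)
      also have "(\<Sum>b\<in>Basis. (a k \<bullet> b) *\<^sub>R leray_symbol k b) = leray_symbol k (\<Sum>b\<in>Basis. (a k \<bullet> b) *\<^sub>R b)"
        by (simp add: linear_sum[OF linear_leray_symbol] linear_scale[OF linear_leray_symbol])
      also have "\<dots> = a k"
        using k0[OF uH[OF s]] by (simp add: euclidean_representation leray_symbol_id k a_def)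
      finally show ?case
        by (simp add: x_def inner_diff_left a_def power2_norm_eq_inner mult.assoc)
    qed
  qed
qed

section \<open>Energy estimates\<close>

lemma young_weighted:
  fixes x y \<epsilon> :: real
  assumes "\<epsilon> > 0" shows "2 * (x * y) \<le> \<epsilon> * y\<^sup>2 + x\<^sup>2 / \<epsilon>"
proof -
  have "0 \<le> (\<epsilon> * y - x)\<^sup>2 / \<epsilon>" using assms by simp
  also have "(\<epsilon> * y - x)\<^sup>2 / \<epsilon> = \<epsilon> * y\<^sup>2 + x\<^sup>2 / \<epsilon> - 2 * (x * y)"
    using assms by (simp add: power2_eq_square field_simps)
  finally show ?thesis by simp
qed

text \<open>The weight \<open>e\<^bsup>2l|k|\<^esup>\<close> is shared unevenly: the dissipation controls \<open>a\<close> with weight \<open>l + \<sigma>\<close>, so \<open>f\<close> is needed with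
  weight \<open>l - \<sigma>\<close> only.\<close>

lemma forcing_term_bound:
  assumes "\<epsilon> > 0"
  shows "2 * (exp (2 * l * norm (real_vec k)) * (f k \<bullet> a k)) \<le> \<epsilon> * gevrey_term (l + \<sigma>) a k + gevrey_term (l - \<sigma>) f k / \<epsilon>"
proof -
  have e: "exp (2 * l * norm (real_vec k)) = exp ((l - \<sigma>) * norm (real_vec k)) * exp ((l + \<sigma>) * norm (real_vec k))"
    by (simp add: exp_add[symmetric] algebra_simps)
  have "exp (2 * l * norm (real_vec k)) * (f k \<bullet> a k) \<le> exp (2 * l * norm (real_vec k)) * (norm (f k) * norm (a k))"
    by (intro mult_left_mono norm_cauchy_schwarz) simp
  also have "\<dots> = (exp ((l - \<sigma>) * norm (real_vec k)) * norm (f k)) * (exp ((l + \<sigma>) * norm (real_vec k)) * norm (a k))"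
    unfolding e by (simp only: mult_ac)
  finally show ?thesis
    using young_weighted[OF assms, of "exp ((l - \<sigma>) * norm (real_vec k)) * norm (f k)" "exp ((l + \<sigma>) * norm (real_vec k)) * norm (a k)"]
    unfolding gevrey_term_square by linarith
qed

lemma gevrey_interpolation:
  assumes g: "gevrey l a" and s: "\<sigma> \<ge> 0"
  shows "(gevrey_sum (l - \<sigma> / 2) a)\<^sup>2 \<le> gevrey_sum (l - \<sigma>) a * gevrey_sum l a"
proof -
  define x where "x m k = exp (m * norm (real_vec k)) * norm (a k)" for m k
  have x2: "(x m k)\<^sup>2 = gevrey_term m a k" for m k by (simp add: x_def gevrey_term_square)
  have "gevrey (l - \<sigma>) a" by (rule gevrey_mono[OF g]) (use s in simp)
  then have s1: "(\<lambda>k. (x (l - \<sigma>) k)\<^sup>2) summable_on UNIV" and s2: "(\<lambda>k. (x l k)\<^sup>2) summable_on UNIV"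
    using g by (simp_all add: x2 gevrey_def)
  have "\<bar>x (l - \<sigma>) k * x l k\<bar> = gevrey_term (l - \<sigma> / 2) a k" for k
  proof -
    have "exp ((l - \<sigma>) * norm (real_vec k)) * exp (l * norm (real_vec k)) = exp (2 * (l - \<sigma> / 2) * norm (real_vec k))"
      by (simp add: exp_add[symmetric] algebra_simps)
    then show ?thesis
      by (simp add: x_def gevrey_term_def abs_mult power2_eq_square mult_ac)
  qed
  then show ?thesis using Cauchy_Schwarz_infsum[OF s1 s2] by (simp add: x2 gevrey_sum_def)
qed

text \<open>The estimate that makes the induction work.  Write \<open>e\<^bsup>2l|k|\<^esup> = e\<^bsup>(l+\<sigma>)|k|\<^esup> e\<^bsup>(l-\<sigma>)|k|\<^esup>\<close>.  The first factor goes to the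
  dissipation.  The second is beaten by the bound of the nonlinear term at level \<open>\<theta> = l - \<sigma>/2\<close>, with
  \<open>\<bar>k\<bar> e\<^bsup>-\<sigma>|k|/2\<^esup>\<close> left over, which is square summable.  Level \<open>\<theta>\<close> lies halfway between \<open>l - \<sigma>\<close>, where \<open>a\<close> is already
  bounded in time, and \<open>l\<close>, where it is already square integrable in time; so no Gronwall argument is needed,
  and the bounds stay polynomial in \<open>1/t\<close>.\<close>

lemma nonlinear_term_bound:
  assumes e: "\<epsilon> > 0" and g: "gevrey l a" and s: "\<sigma> > 0" and l: "l \<ge> \<sigma> / 2" and F: "finite F"
  shows "(\<Sum>k\<in>F. - 2 * (exp (2 * l * norm (real_vec k)) * (advect_coeff a k \<bullet> a k)))
      \<le> \<epsilon> * (\<Sum>k\<in>F. gevrey_term (l + \<sigma>) a k) + lattice_const (\<sigma> / 2) * (gevrey_sum (l - \<sigma>) a * gevrey_sum l a) / \<epsilon>"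
proof -
  define \<theta> where "\<theta> = l - \<sigma> / 2"
  define Z where "Z = gevrey_sum \<theta> a"
  define w where "w k = norm (real_vec k) * exp (- (\<sigma> / 2) * norm (real_vec k))" for k :: "int^3"
  have g\<theta>: "gevrey \<theta> a" by (rule gevrey_mono[OF g]) (use s in \<open>simp add: \<theta>_def\<close>)
  have \<theta>0: "\<theta> \<ge> 0" using l by (simp add: \<theta>_def)
  have one: "- 2 * (exp (2 * l * norm (real_vec k)) * (advect_coeff a k \<bullet> a k)) \<le> \<epsilon> * gevrey_term (l + \<sigma>) a k + (w k)\<^sup>2 * Z\<^sup>2 / \<epsilon>" for k
  proof -
    have ee: "exp (2 * l * norm (real_vec k)) * exp (- \<theta> * norm (real_vec k)) = exp (- (\<sigma> / 2) * norm (real_vec k)) * exp ((l + \<sigma>) * norm (real_vec k))"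
      by (simp add: exp_add[symmetric] \<theta>_def algebra_simps)
    have "- (advect_coeff a k \<bullet> a k) \<le> norm (advect_coeff a k) * norm (a k)"
      using Cauchy_Schwarz_ineq2[of "advect_coeff a k" "a k"] by linarith
    also have "\<dots> \<le> (norm (real_vec k) * exp (- \<theta> * norm (real_vec k)) * Z) * norm (a k)"
      unfolding Z_def by (intro mult_right_mono advect_coeff_bound g\<theta> \<theta>0) simp
    finally have "exp (2 * l * norm (real_vec k)) * (- (advect_coeff a k \<bullet> a k))
      \<le> exp (2 * l * norm (real_vec k)) * ((norm (real_vec k) * exp (- \<theta> * norm (real_vec k)) * Z) * norm (a k))"
      by (rule mult_left_mono) simp
    also have "\<dots> = (exp (2 * l * norm (real_vec k)) * exp (- \<theta> * norm (real_vec k))) * (norm (real_vec k) * Z * norm (a k))"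
      by (simp only: mult_ac)
    also have "\<dots> = (w k * Z) * (exp ((l + \<sigma>) * norm (real_vec k)) * norm (a k))"
      unfolding ee w_def by (simp only: mult_ac)
    finally show ?thesis
      using young_weighted[OF e, of "w k * Z" "exp ((l + \<sigma>) * norm (real_vec k)) * norm (a k)"]
      unfolding gevrey_term_square power_mult_distrib by linarith
  qed
  have wF: "(\<Sum>k\<in>F. (w k)\<^sup>2) \<le> lattice_const (\<sigma> / 2)"
    unfolding w_def lattice_const_summable(2)[of "\<sigma> / 2", OF half_gt_zero[OF s]]
    by (rule finite_sum_le_infsum[OF lattice_const_summable(1)]) (use F s in auto)
  have Z2: "Z\<^sup>2 \<le> gevrey_sum (l - \<sigma>) a * gevrey_sum l a"
    unfolding Z_def \<theta>_def by (rule gevrey_interpolation[OF g]) (use s in simp)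
  have "(\<Sum>k\<in>F. (w k)\<^sup>2) * Z\<^sup>2 \<le> lattice_const (\<sigma> / 2) * (gevrey_sum (l - \<sigma>) a * gevrey_sum l a)"
    by (rule mult_mono[OF wF Z2]) (auto simp: lattice_const_def intro!: infsum_nonneg)
  then have "(\<Sum>k\<in>F. (w k)\<^sup>2) * Z\<^sup>2 / \<epsilon> \<le> lattice_const (\<sigma> / 2) * (gevrey_sum (l - \<sigma>) a * gevrey_sum l a) / \<epsilon>"
    using e by (intro divide_right_mono) auto
  moreover have "(\<Sum>k\<in>F. - 2 * (exp (2 * l * norm (real_vec k)) * (advect_coeff a k \<bullet> a k)))
      \<le> (\<Sum>k\<in>F. \<epsilon> * gevrey_term (l + \<sigma>) a k + (w k)\<^sup>2 * Z\<^sup>2 / \<epsilon>)"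
    by (rule sum_mono) (rule one)
  ultimately show ?thesis
    by (simp add: sum.distrib sum_distrib_left sum_distrib_right sum_divide_distrib)
qed

text \<open>The full sum vanishes, so the sum over \<open>F\<close> is minus the sum over the complement, and the latter is small
  uniformly for bounded \<open>gevrey_sum \<sigma> a\<close>.\<close>

lemma truncated_cancellation:
  assumes H: "H_coeffs a" and g: "gevrey \<sigma> a" and s: "\<sigma> > 0" and F: "finite F"
    and tail: "(\<Sum>\<^sub>\<infinity>k\<in>- F. (norm (real_vec k) * exp (- \<sigma> * norm (real_vec k)))\<^sup>2) \<le> \<delta>\<^sup>2" and d: "\<delta> \<ge> 0"
  shows "\<bar>\<Sum>k\<in>F. advect_coeff a k \<bullet> a k\<bar> \<le> \<delta> * (1 + gevrey_sum \<sigma> a) * gevrey_sum 0 a"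
proof -
  define q where "q k = advect_coeff a k \<bullet> a k" for k
  define y where "y k = norm (real_vec k) * (exp (0 * norm (real_vec k)) * norm (a k))" for k
  have g0: "gevrey 0 a" by (rule gevrey_mono[OF g]) (use s in simp)
  have qs: "(q has_sum 0) UNIV" unfolding q_def by (rule advect_coeff_cancellation[OF H g s])
  have "(q has_sum (\<Sum>k\<in>F. q k)) F" by (rule has_sum_finite[OF F])
  then have "(q has_sum (0 - (\<Sum>k\<in>F. q k))) (UNIV - F)"
    by (intro has_sum_Diff[OF qs]) auto
  then have hs: "(q has_sum (- (\<Sum>k\<in>F. q k))) (- F)" by (simp add: Compl_eq_Diff_UNIV)
  note L = gevrey_l1(1,2)[OF g s, folded y_def, of "- F"]
  have qb: "norm (q k) \<le> y k * gevrey_sum 0 a" for k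
  proof -
    have "norm (q k) \<le> norm (advect_coeff a k) * norm (a k)"
      unfolding q_def real_norm_def by (rule Cauchy_Schwarz_ineq2)
    also have "\<dots> \<le> (norm (real_vec k) * exp (- 0 * norm (real_vec k)) * gevrey_sum 0 a) * norm (a k)"
      by (intro mult_right_mono advect_coeff_bound g0) auto
    finally show ?thesis by (simp add: y_def mult_ac)
  qed
  have ys: "(\<lambda>k. y k * gevrey_sum 0 a) summable_on (- F)" by (rule summable_on_cmult_left[OF L(1)])
  have ns: "(\<lambda>k. norm (q k)) summable_on (- F)"
    by (rule summable_on_comparison_test[OF ys]) (use qb in auto)
  have "\<bar>\<Sum>k\<in>F. q k\<bar> = norm (\<Sum>\<^sub>\<infinity>k\<in>- F. q k)" using infsumI[OF hs] by simp
  also have "\<dots> \<le> (\<Sum>\<^sub>\<infinity>k\<in>- F. norm (q k))" by (rule norm_infsum_bound[OF ns])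
  also have "\<dots> \<le> (\<Sum>\<^sub>\<infinity>k\<in>- F. y k * gevrey_sum 0 a)" by (rule infsum_mono[OF ns ys qb])
  also have "\<dots> = (\<Sum>\<^sub>\<infinity>k\<in>- F. y k) * gevrey_sum 0 a" by (rule infsum_cmult_left')
  also have "\<dots> \<le> (\<delta> * (1 + gevrey_sum \<sigma> a)) * gevrey_sum 0 a"
  proof (rule mult_right_mono)
    have "(\<Sum>\<^sub>\<infinity>k\<in>- F. y k)\<^sup>2 \<le> (\<Sum>\<^sub>\<infinity>k\<in>- F. (norm (real_vec k) * exp (- (\<sigma> - 0) * norm (real_vec k)))\<^sup>2) * gevrey_sum \<sigma> a"
      by (rule L(2))
    also have "\<dots> \<le> \<delta>\<^sup>2 * (1 + gevrey_sum \<sigma> a)\<^sup>2"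
    proof (rule mult_mono)
      have "gevrey_sum \<sigma> a * 1 \<le> (1 + gevrey_sum \<sigma> a) * (1 + gevrey_sum \<sigma> a)"
        by (rule mult_mono) auto
      then show "gevrey_sum \<sigma> a \<le> (1 + gevrey_sum \<sigma> a)\<^sup>2" by (simp add: power2_eq_square)
    qed (use tail in auto)
    also have "\<dots> = (\<delta> * (1 + gevrey_sum \<sigma> a))\<^sup>2" by (simp add: power_mult_distrib)
    finally show "(\<Sum>\<^sub>\<infinity>k\<in>- F. y k) \<le> \<delta> * (1 + gevrey_sum \<sigma> a)"
      by (rule power2_le_imp_le) (use d in \<open>simp add: add_nonneg_nonneg\<close>)
  qed simp
  finally show ?thesis by (simp add: q_def)
qed

lemma infsum_tail_small:
  fixes g :: "'i \<Rightarrow> real"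
  assumes g: "g summable_on UNIV" and nn: "\<And>k. g k \<ge> 0" and e: "\<epsilon> > 0"
  obtains F0 where "finite F0" "\<And>F. finite F \<Longrightarrow> F0 \<subseteq> F \<Longrightarrow> (\<Sum>\<^sub>\<infinity>k\<in>- F. g k) \<le> \<epsilon>"
proof -
  obtain F0 where F0: "finite F0" "\<And>F. finite F \<Longrightarrow> F0 \<subseteq> F \<Longrightarrow> dist (sum g F) (infsum g UNIV) < \<epsilon>"
    using tendstoD[OF has_sum_infsum[OF g, unfolded has_sum_def] e]
    unfolding eventually_finite_subsets_at_top by auto
  show thesis
  proof (rule that[OF F0(1)])
    fix F assume F: "finite F" "F0 \<subseteq> F"
    have "infsum g (UNIV - F) = infsum g UNIV - infsum g F"
      by (rule infsum_Diff[OF g]) (use F in auto)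
    then have "(\<Sum>\<^sub>\<infinity>k\<in>- F. g k) = infsum g UNIV - sum g F" using F by (simp add: Compl_eq_Diff_UNIV)
    then show "(\<Sum>\<^sub>\<infinity>k\<in>- F. g k) \<le> \<epsilon>" using F0(2)[OF F] by (simp add: dist_real_def)
  qed
qed

text \<open>What the estimates use of a weak solution: \<open>a\<close> and \<open>fh\<close> are the coefficients of the solution and of the
  forcing.  The equation enters through the energy of single modes only, tested with the solution itself, so
  that the pressure and the projection have disappeared.\<close>

locale fourier_solution =
  fixes \<mu> \<sigma> T :: real and a fh :: "real \<Rightarrow> int^3 \<Rightarrow> complex^3"
  assumes mu: "\<mu> > 0" and sigma: "\<sigma> > 0" and T: "T > 0"
    and H: "\<And>t. t \<in> {0..T} \<Longrightarrow> H_coeffs (a t)"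
    and cont: "\<And>k. continuous_on {0..T} (\<lambda>t. a t k)"
    and gevrey_AE: "AE s in lebesgue_on {0..T}. gevrey \<sigma> (a s)"
    and gevrey_majorant: "\<exists>Y. integrable (lebesgue_on {0..T}) Y \<and> (AE s in lebesgue_on {0..T}. gevrey_sum \<sigma> (a s) \<le> Y s)"
    and bounded: "\<exists>M. \<forall>t\<in>{0..T}. gevrey 0 (a t) \<and> gevrey_sum 0 (a t) \<le> M"
    and mode_energy: "\<And>k s t. k \<noteq> 0 \<Longrightarrow> 0 \<le> s \<Longrightarrow> s \<le> t \<Longrightarrow> t \<le> T \<Longrightarrow>
       \<exists>\<rho>. integrable (lebesgue_on {s..t}) \<rho> \<and>
         (norm (a t k))\<^sup>2 - (norm (a s k))\<^sup>2 = 2 * (\<integral>x. \<rho> x \<partial>lebesgue_on {s..t}) \<and>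
         (AE x in lebesgue_on {s..t}. \<rho> x = fh x k \<bullet> a x k - \<mu> * gevrey_term \<sigma> (a x) k - advect_coeff (a x) k \<bullet> a x k)"
begin

lemma AE_subinterval:
  assumes "AE x in lebesgue_on {0..T}. P x" "0 \<le> s" "t \<le> T"
  shows "AE x in lebesgue_on {s..t}. P x"
proof -
  have "AE x in lebesgue. x \<in> {0..T} \<longrightarrow> P x" using assms(1) by (simp add: AE_restrict_space_iff)
  then have "AE x in lebesgue. x \<in> {s..t} \<longrightarrow> P x" by eventually_elim (use assms(2,3) in auto)
  then show ?thesis by (simp add: AE_restrict_space_iff)
qed

lemma a_zero: "t \<in> {0..T} \<Longrightarrow> a t 0 = 0"
  using H by (simp add: H_coeffs_def)

lemma continuous_gevrey_term:
  assumes "0 \<le> s" "t \<le> T"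
  shows "continuous_on {s..t} (\<lambda>x. gevrey_term l (a x) k)"
  unfolding gevrey_term_def
  by (intro continuous_intros continuous_on_subset[OF cont]) (use assms in auto)

lemma integrable_gevrey_term:
  assumes "0 \<le> s" "t \<le> T"
  shows "integrable (lebesgue_on {s..t}) (\<lambda>x. gevrey_term l (a x) k)"
  using absolutely_integrable_continuous_real[OF continuous_gevrey_term[OF assms]]
  by (simp only: set_integral_interval(2))

lemma integrable_sum_gevrey_term:
  assumes "0 \<le> s" "t \<le> T"
  shows "integrable (lebesgue_on {s..t}) (\<lambda>x. \<Sum>k\<in>F. gevrey_term l (a x) k)"
  by (intro Bochner_Integration.integrable_sum integrable_gevrey_term assms)

lemma mode_energy_all:
  assumes "0 \<le> s" "s \<le> t" "t \<le> T"
  shows "\<exists>\<rho>. integrable (lebesgue_on {s..t}) \<rho> \<and>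
         (norm (a t k))\<^sup>2 - (norm (a s k))\<^sup>2 = 2 * (\<integral>x. \<rho> x \<partial>lebesgue_on {s..t}) \<and>
         (AE x in lebesgue_on {s..t}. \<rho> x = fh x k \<bullet> a x k - \<mu> * gevrey_term \<sigma> (a x) k - advect_coeff (a x) k \<bullet> a x k)"
proof (cases "k = 0")
  case True
  have "AE x in lebesgue_on {s..t}. (0::real) = fh x k \<bullet> a x k - \<mu> * gevrey_term \<sigma> (a x) k - advect_coeff (a x) k \<bullet> a x k"
    by (rule AE_I2) (use True assms a_zero in \<open>auto simp: gevrey_term_def\<close>)
  then show ?thesis using a_zero assms True by (intro exI[of _ "\<lambda>_. 0"]) auto
qed (rule mode_energy[OF _ assms])

text \<open>The energy identity has twice the dissipation; one half of it is available to absorb the forcing and the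
  nonlinear term.\<close>

lemma energy_inequality:
  assumes st: "0 \<le> s" "s \<le> t" "t \<le> T" and F: "finite F"
    and G: "integrable (lebesgue_on {s..t}) G"
    and le: "AE x in lebesgue_on {s..t}.
      (\<Sum>k\<in>F. 2 * (exp (2 * l * norm (real_vec k)) * (fh x k \<bullet> a x k)) + - 2 * (exp (2 * l * norm (real_vec k)) * (advect_coeff (a x) k \<bullet> a x k)))
       \<le> \<mu> * (\<Sum>k\<in>F. gevrey_term (l + \<sigma>) (a x) k) + G x"
  shows "(\<Sum>k\<in>F. gevrey_term l (a t) k) + \<mu> * (\<integral>x. (\<Sum>k\<in>F. gevrey_term (l + \<sigma>) (a x) k) \<partial>lebesgue_on {s..t})
      \<le> (\<Sum>k\<in>F. gevrey_term l (a s) k) + (\<integral>x. G x \<partial>lebesgue_on {s..t})"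
proof -
  define M where "M = lebesgue_on {s..t}"
  have "\<forall>k. \<exists>\<rho>. integrable M \<rho> \<and>
         (norm (a t k))\<^sup>2 - (norm (a s k))\<^sup>2 = 2 * (\<integral>x. \<rho> x \<partial>M) \<and>
         (AE x in M. \<rho> x = fh x k \<bullet> a x k - \<mu> * gevrey_term \<sigma> (a x) k - advect_coeff (a x) k \<bullet> a x k)"
    unfolding M_def by (intro allI mode_energy_all[OF st])
  from choice[OF this] obtain \<rho> where "\<forall>k. integrable M (\<rho> k) \<and>
         (norm (a t k))\<^sup>2 - (norm (a s k))\<^sup>2 = 2 * (\<integral>x. \<rho> k x \<partial>M) \<and>
         (AE x in M. \<rho> k x = fh x k \<bullet> a x k - \<mu> * gevrey_term \<sigma> (a x) k - advect_coeff (a x) k \<bullet> a x k)" ..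
  note \<rho>all = this
  note \<rho> = \<rho>all[THEN spec, THEN conjunct1] \<rho>all[THEN spec, THEN conjunct2, THEN conjunct1]
    \<rho>all[THEN spec, THEN conjunct2, THEN conjunct2]
  define w where "w k = exp (2 * l * norm (real_vec k))" for k :: "int^3"
  have gt: "w k * gevrey_term \<sigma> (a x) k = gevrey_term (l + \<sigma>) (a x) k" for k x
  proof -
    have "w k * exp (2 * \<sigma> * norm (real_vec k)) = exp (2 * (l + \<sigma>) * norm (real_vec k))"
      by (simp add: w_def exp_add[symmetric] algebra_simps)
    then show ?thesis by (simp add: gevrey_term_def mult.assoc[symmetric])
  qed
  have D: "integrable M (\<lambda>x. \<Sum>k\<in>F. gevrey_term (l + \<sigma>) (a x) k)"
    unfolding M_def by (rule integrable_sum_gevrey_term[OF st(1,3)])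
  have all: "AE x in M. \<forall>k\<in>F. \<rho> k x = fh x k \<bullet> a x k - \<mu> * gevrey_term \<sigma> (a x) k - advect_coeff (a x) k \<bullet> a x k"
    by (rule AE_finite_allI[OF F \<rho>(3)])
  have "(\<Sum>k\<in>F. gevrey_term l (a t) k) - (\<Sum>k\<in>F. gevrey_term l (a s) k)
      = (\<Sum>k\<in>F. w k * ((norm (a t k))\<^sup>2 - (norm (a s k))\<^sup>2))"
    by (simp add: gevrey_term_def w_def sum_subtractf right_diff_distrib)
  also have "\<dots> = (\<integral>x. (\<Sum>k\<in>F. 2 * w k * \<rho> k x) \<partial>M)"
    unfolding \<rho>(2) by (subst Bochner_Integration.integral_sum) (auto intro: \<rho>(1) sum.cong simp: mult_ac)
  also have "\<dots> \<le> (\<integral>x. G x - \<mu> * (\<Sum>k\<in>F. gevrey_term (l + \<sigma>) (a x) k) \<partial>M)"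
  proof (rule integral_mono_AE)
    show "integrable M (\<lambda>x. \<Sum>k\<in>F. 2 * w k * \<rho> k x)"
      by (intro Bochner_Integration.integrable_sum integrable_mult_right \<rho>(1))
    show "integrable M (\<lambda>x. G x - \<mu> * (\<Sum>k\<in>F. gevrey_term (l + \<sigma>) (a x) k))"
      using G D by (simp add: M_def)
    show "AE x in M. (\<Sum>k\<in>F. 2 * w k * \<rho> k x) \<le> G x - \<mu> * (\<Sum>k\<in>F. gevrey_term (l + \<sigma>) (a x) k)"
      using all le[folded M_def]
    proof eventually_elim
      case (elim x)
      have "(\<Sum>k\<in>F. 2 * w k * \<rho> k x) = (\<Sum>k\<in>F. (2 * (w k * (fh x k \<bullet> a x k)) + - 2 * (w k * (advect_coeff (a x) k \<bullet> a x k)))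
          - 2 * \<mu> * gevrey_term (l + \<sigma>) (a x) k)"
      proof (rule sum.cong)
        fix k assume "k \<in> F"
        then have e: "\<rho> k x = fh x k \<bullet> a x k - \<mu> * gevrey_term \<sigma> (a x) k - advect_coeff (a x) k \<bullet> a x k"
          using elim(1) by blast
        show "2 * w k * \<rho> k x = (2 * (w k * (fh x k \<bullet> a x k)) + - 2 * (w k * (advect_coeff (a x) k \<bullet> a x k)))
          - 2 * \<mu> * gevrey_term (l + \<sigma>) (a x) k"
          unfolding e gt[symmetric] by (simp add: algebra_simps)
      qed simp
      also have "\<dots> = (\<Sum>k\<in>F. 2 * (w k * (fh x k \<bullet> a x k)) + - 2 * (w k * (advect_coeff (a x) k \<bullet> a x k)))
          - 2 * \<mu> * (\<Sum>k\<in>F. gevrey_term (l + \<sigma>) (a x) k)"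
        by (simp only: sum_subtractf sum_distrib_left)
      finally show ?case using elim(2) unfolding w_def by linarith
    qed
  qed
  also have "\<dots> = (\<integral>x. G x \<partial>M) - \<mu> * (\<integral>x. (\<Sum>k\<in>F. gevrey_term (l + \<sigma>) (a x) k) \<partial>M)"
    using G D by (simp add: M_def)
  finally show ?thesis by (simp add: M_def)
qed

text \<open>The dissipation integral is stated for finite sets of modes: these integrands are continuous in time, and
  monotone convergence supplies the infinite sum afterwards.\<close>

definition regular_at :: "nat \<Rightarrow> real \<Rightarrow> real \<Rightarrow> bool" where
  "regular_at n D t \<longleftrightarrow> gevrey (real n * \<sigma>) (a t) \<and> gevrey_sum (real n * \<sigma>) (a t) \<le> D \<and>
     (\<forall>F. finite F \<longrightarrow> (\<integral>x. (\<Sum>k\<in>F. gevrey_term ((real n + 1) * \<sigma>) (a x) k) \<partial>lebesgue_on {t..T}) \<le> D)"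

lemma gevrey_from_finite_sums:
  assumes "\<And>F. finite F \<Longrightarrow> (\<Sum>k\<in>F. gevrey_term l b k) \<le> D"
  shows "gevrey l b" "gevrey_sum l b \<le> D"
proof -
  show g: "gevrey l b" unfolding gevrey_def
    by (rule nonneg_bdd_above_summable_on) (use assms in \<open>auto intro!: bdd_aboveI[of _ D]\<close>)
  show "gevrey_sum l b \<le> D" unfolding gevrey_sum_def
    by (rule infsum_le_finite_sums) (use g assms in \<open>auto simp: gevrey_def\<close>)
qed

text \<open>The basic energy estimate.  The nonlinear term drops out only in the sum over all modes; over a large finite
  set it contributes at most \<open>e\<close>, which tends to \<open>0\<close>.\<close>

lemma regular_level_zero:
  assumes \<Phi>: "integrable (lebesgue_on {0..T}) \<Phi>" "\<And>x. \<Phi> x \<ge> 0"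
    and \<Phi>f: "AE x in lebesgue_on {0..T}. \<forall>F. finite F \<longrightarrow> (\<Sum>k\<in>F. gevrey_term (- \<sigma>) (fh x) k) \<le> \<Phi> x"
    and \<Phi>I: "(\<integral>x. \<Phi> x \<partial>lebesgue_on {0..T}) \<le> I"
    and X: "gevrey_sum 0 (a 0) \<le> X" and t: "0 \<le> t" "t \<le> T"
  shows "regular_at 0 ((X + I / \<mu>) * (1 + 1 / \<mu>)) t"
proof -
  obtain M where M: "\<And>t. t \<in> {0..T} \<Longrightarrow> gevrey 0 (a t) \<and> gevrey_sum 0 (a t) \<le> M" using bounded by blast
  have M0: "M \<ge> 0" using M[of 0] T order_trans[OF gevrey_sum_nonneg[of 0 "a 0"]] by auto
  obtain Y where Y: "integrable (lebesgue_on {0..T}) Y" "AE s in lebesgue_on {0..T}. gevrey_sum \<sigma> (a s) \<le> Y s"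
    using gevrey_majorant by blast
  have est: "(\<Sum>k\<in>F. gevrey_term 0 (a t) k) + \<mu> * (\<integral>x. (\<Sum>k\<in>F. gevrey_term \<sigma> (a x) k) \<partial>lebesgue_on {0..t}) \<le> X + I / \<mu>"
    if F: "finite F" and t: "0 \<le> t" "t \<le> T" for F t
  proof -
    define L where "L F = (\<Sum>k\<in>F. gevrey_term 0 (a t) k) + \<mu> * (\<integral>x. (\<Sum>k\<in>F. gevrey_term \<sigma> (a x) k) \<partial>lebesgue_on {0..t})" for F
    define Q where "Q = (\<integral>x. 2 * M * (1 + Y x) \<partial>lebesgue_on {0..t})"
    have Yi: "integrable (lebesgue_on {0..t}) Y" and \<Phi>i: "integrable (lebesgue_on {0..t}) \<Phi>"
      using integrable_lebesgue_on_subinterval[OF Y(1), of 0 t] integrable_lebesgue_on_subinterval[OF \<Phi>(1), of 0 t] t by auto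
    interpret fin: finite_measure "lebesgue_on {0..t}" by (rule finite_measure_interval)
    have Q0: "Q \<le> \<bar>Q\<bar>" by simp
    have "L F \<le> X + I / \<mu> + e" if e: "e > 0" for e
    proof -
      \<comment> \<open>The truncation error will be \<open>\<delta> * Q\<close>, and \<open>\<delta>\<close> makes it at most \<open>e\<close>.\<close>
      define \<delta> where "\<delta> = e / (\<bar>Q\<bar> + 1)"
      have d: "\<delta> > 0" using e by (simp add: \<delta>_def add_nonneg_pos)
      obtain F0 where F0: "finite F0" "\<And>F. finite F \<Longrightarrow> F0 \<subseteq> F \<Longrightarrow>
          (\<Sum>\<^sub>\<infinity>k\<in>- F. (norm (real_vec k) * exp (- \<sigma> * norm (real_vec k)))\<^sup>2) \<le> \<delta>\<^sup>2"
        by (rule infsum_tail_small[OF lattice_const_summable(1)[OF sigma], of "\<delta>\<^sup>2"]) (use d in auto)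
      define F' where "F' = F \<union> F0"
      have F': "finite F'" "F0 \<subseteq> F'" "F \<subseteq> F'" using F F0 by (auto simp: F'_def)
      have "L F \<le> L F'" unfolding L_def
      proof (intro add_mono mult_left_mono integral_mono sum_mono2 integrable_sum_gevrey_term)
      qed (use F' mu t in auto)
      also have "L F' \<le> (\<Sum>k\<in>F'. gevrey_term 0 (a 0) k) + (\<integral>x. \<Phi> x / \<mu> + \<delta> * (2 * M * (1 + Y x)) \<partial>lebesgue_on {0..t})"
        unfolding L_def
      proof (rule energy_inequality[where l = 0 and s = 0 and F = F', simplified])
        show "integrable (lebesgue_on {0..t}) (\<lambda>x. \<Phi> x / \<mu> + \<delta> * (2 * M * (1 + Y x)))"
          using Yi \<Phi>i by simp
        show "AE x in lebesgue_on {0..t}. (\<Sum>k\<in>F'. 2 * (fh x k \<bullet> a x k) - 2 * (advect_coeff (a x) k \<bullet> a x k))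
            \<le> \<mu> * (\<Sum>k\<in>F'. gevrey_term \<sigma> (a x) k) + (\<Phi> x / \<mu> + \<delta> * (2 * M * (1 + Y x)))"
          using AE_subinterval[OF gevrey_AE order_refl t(2)] AE_subinterval[OF \<Phi>f order_refl t(2)]
            AE_subinterval[OF Y(2) order_refl t(2)] AE_space
        proof eventually_elim
          case (elim x)
          then have x: "x \<in> {0..T}" using t by auto
          have 1: "(\<Sum>k\<in>F'. 2 * (fh x k \<bullet> a x k)) \<le> \<mu> * (\<Sum>k\<in>F'. gevrey_term \<sigma> (a x) k) + \<Phi> x / \<mu>"
          proof -
            have "(\<Sum>k\<in>F'. 2 * (fh x k \<bullet> a x k)) \<le> (\<Sum>k\<in>F'. \<mu> * gevrey_term \<sigma> (a x) k + gevrey_term (- \<sigma>) (fh x) k / \<mu>)"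
              using forcing_term_bound[OF mu, of 0 _ "fh x" "a x" \<sigma>] by (intro sum_mono) simp
            also have "\<dots> = \<mu> * (\<Sum>k\<in>F'. gevrey_term \<sigma> (a x) k) + (\<Sum>k\<in>F'. gevrey_term (- \<sigma>) (fh x) k) / \<mu>"
              by (simp add: sum.distrib sum_distrib_left sum_divide_distrib)
            also have "(\<Sum>k\<in>F'. gevrey_term (- \<sigma>) (fh x) k) / \<mu> \<le> \<Phi> x / \<mu>"
              using elim(2) F' mu by (intro divide_right_mono) auto
            finally show ?thesis by simp
          qed
          have "\<bar>\<Sum>k\<in>F'. advect_coeff (a x) k \<bullet> a x k\<bar> \<le> \<delta> * (1 + gevrey_sum \<sigma> (a x)) * gevrey_sum 0 (a x)"
            by (rule truncated_cancellation[OF H[OF x] elim(1) sigma F'(1) F0(2)[OF F'(1,2)]]) (use d in simp)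
          also have "\<dots> \<le> \<delta> * (1 + Y x) * M"
            using elim(3) M[OF x] d M0 order_trans[OF gevrey_sum_nonneg elim(3)] by (intro mult_mono) auto
          finally have "- 2 * (\<Sum>k\<in>F'. advect_coeff (a x) k \<bullet> a x k) \<le> \<delta> * (2 * M * (1 + Y x))"
            by (simp add: algebra_simps)
          moreover have "(\<Sum>k\<in>F'. 2 * (fh x k \<bullet> a x k) - 2 * (advect_coeff (a x) k \<bullet> a x k))
             = (\<Sum>k\<in>F'. 2 * (fh x k \<bullet> a x k)) + - 2 * (\<Sum>k\<in>F'. advect_coeff (a x) k \<bullet> a x k)"
            by (simp only: diff_conv_add_uminus sum.distrib sum_negf sum_distrib_left mult_minus_left)
          ultimately show ?case using 1 by linarith
        qed
      qed (use t F' in auto)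
      also have "(\<integral>x. \<Phi> x / \<mu> + \<delta> * (2 * M * (1 + Y x)) \<partial>lebesgue_on {0..t}) = (\<integral>x. \<Phi> x \<partial>lebesgue_on {0..t}) / \<mu> + \<delta> * Q"
        unfolding Q_def using Yi \<Phi>i by (subst Bochner_Integration.integral_add) auto
      also have "(\<integral>x. \<Phi> x \<partial>lebesgue_on {0..t}) \<le> I"
      proof -
        have "(\<integral>x. \<Phi> x \<partial>lebesgue_on {0..t}) + (\<integral>x. \<Phi> x \<partial>lebesgue_on {t..T}) = (\<integral>x. \<Phi> x \<partial>lebesgue_on {0..T})"
          by (rule integral_lebesgue_on_combine[OF \<Phi>(1)]) (use t in auto)
        moreover have "0 \<le> (\<integral>x. \<Phi> x \<partial>lebesgue_on {t..T})" by (rule Bochner_Integration.integral_nonneg) (rule \<Phi>)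
        ultimately show ?thesis using \<Phi>I by linarith
      qed
      also have "(\<Sum>k\<in>F'. gevrey_term 0 (a 0) k) \<le> X"
        using sum_gevrey_term_le[of 0 "a 0" F'] M[of 0] T F' X by (intro order_trans[OF _ X]) auto
      also have "\<delta> * Q \<le> e"
      proof -
        have "\<delta> * Q \<le> \<delta> * (\<bar>Q\<bar> + 1)" using d by (intro mult_left_mono) auto
        then show ?thesis by (simp add: \<delta>_def)
      qed
      finally show ?thesis using mu by (simp add: divide_right_mono)
    qed
    then have "L F \<le> X + I / \<mu>" by (rule field_le_epsilon)
    then show ?thesis by (simp add: L_def)
  qed
  define D where "D = X + I / \<mu>"
  have i0: "0 \<le> (\<integral>x. (\<Sum>k\<in>F. gevrey_term \<sigma> (a x) k) \<partial>lebesgue_on {p..q})" for F p q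
    by (intro Bochner_Integration.integral_nonneg sum_nonneg) simp
  have D0: "D \<ge> 0" using est[of "{}" 0] T by (simp add: D_def)
  have De: "D * (1 + 1 / \<mu>) = D + D / \<mu>" by (simp add: algebra_simps)
  have Dm: "D \<le> D * (1 + 1 / \<mu>)" "D / \<mu> \<le> D * (1 + 1 / \<mu>)"
    unfolding De using D0 mu by simp_all
  have 1: "(\<Sum>k\<in>F. gevrey_term 0 (a t) k) \<le> D * (1 + 1 / \<mu>)" if "finite F" for F
  proof -
    have "0 \<le> \<mu> * (\<integral>x. (\<Sum>k\<in>F. gevrey_term \<sigma> (a x) k) \<partial>lebesgue_on {0..t})" using i0 mu by simp
    then show ?thesis using est[OF that t] Dm(1) unfolding D_def[symmetric] by linarith
  qed
  have 2: "(\<integral>x. (\<Sum>k\<in>F. gevrey_term \<sigma> (a x) k) \<partial>lebesgue_on {t..T}) \<le> D * (1 + 1 / \<mu>)" if "finite F" for F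
  proof -
    have "(\<integral>x. (\<Sum>k\<in>F. gevrey_term \<sigma> (a x) k) \<partial>lebesgue_on {0..t}) + (\<integral>x. (\<Sum>k\<in>F. gevrey_term \<sigma> (a x) k) \<partial>lebesgue_on {t..T})
        = (\<integral>x. (\<Sum>k\<in>F. gevrey_term \<sigma> (a x) k) \<partial>lebesgue_on {0..T})"
      by (rule integral_lebesgue_on_combine[OF integrable_sum_gevrey_term]) (use t in auto)
    then have "(\<integral>x. (\<Sum>k\<in>F. gevrey_term \<sigma> (a x) k) \<partial>lebesgue_on {t..T}) \<le> (\<integral>x. (\<Sum>k\<in>F. gevrey_term \<sigma> (a x) k) \<partial>lebesgue_on {0..T})"
      using i0[where F = F and p = 0 and q = t] by linarith
    moreover have "\<mu> * (\<integral>x. (\<Sum>k\<in>F. gevrey_term \<sigma> (a x) k) \<partial>lebesgue_on {0..T}) \<le> D"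
    proof -
      have "0 \<le> (\<Sum>k\<in>F. gevrey_term 0 (a T) k)" by (intro sum_nonneg) simp
      then show ?thesis using est[OF that, of T] T unfolding D_def[symmetric] by simp
    qed
    then have "(\<integral>x. (\<Sum>k\<in>F. gevrey_term \<sigma> (a x) k) \<partial>lebesgue_on {0..T}) \<le> D / \<mu>"
      using mu by (simp add: pos_le_divide_eq mult.commute)
    ultimately show ?thesis using Dm(2) by linarith
  qed
  show ?thesis unfolding regular_at_def D_def[symmetric]
    using gevrey_from_finite_sums[OF 1] 2 by simp
qed

lemma gevrey_sum_integral:
  assumes t: "0 \<le> t" "t \<le> T"
    and bd: "\<And>F. finite F \<Longrightarrow> (\<integral>x. (\<Sum>k\<in>F. gevrey_term l (a x) k) \<partial>lebesgue_on {t..T}) \<le> D"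
  shows "AE x in lebesgue_on {t..T}. gevrey l (a x)"
    and "integrable (lebesgue_on {t..T}) (\<lambda>x. gevrey_sum l (a x))"
    and "(\<integral>x. gevrey_sum l (a x) \<partial>lebesgue_on {t..T}) \<le> D"
  unfolding gevrey_def gevrey_sum_def
  by (rule nonneg_infsum_integral_bound[OF infinite_lattice integrable_gevrey_term _ bd]; use t in simp)+

text \<open>If \<open>gevrey_sum l\<close> exceeded \<open>2 * (D + 1) / t\<close> on the whole interval of length \<open>t / 2\<close>, its integral would be at least
  \<open>D + 1\<close>, whereas it is at most \<open>D\<close>.\<close>

lemma exists_good_time:
  assumes t: "0 < t" "t \<le> T"
    and bd: "\<And>F. finite F \<Longrightarrow> (\<integral>x. (\<Sum>k\<in>F. gevrey_term l (a x) k) \<partial>lebesgue_on {t/2..T}) \<le> D"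
  obtains s where "s \<in> {t/2..t}" "gevrey l (a s)" "gevrey_sum l (a s) \<le> 2 / t * (D + 1)"
proof -
  have t2: "0 \<le> t / 2" "t / 2 \<le> T" "t / 2 \<le> t" using t by auto
  note W = gevrey_sum_integral[OF t2(1,2) bd]
  have Wi: "integrable (lebesgue_on {t/2..t}) (\<lambda>x. gevrey_sum l (a x))"
    by (rule integrable_lebesgue_on_subinterval[OF W(2)]) (use t in auto)
  have "AE x in lebesgue. x \<in> {t/2..T} \<longrightarrow> gevrey l (a x)" using W(1) by (simp add: AE_restrict_space_iff)
  then have "AE x in lebesgue. x \<in> {t/2..t} \<longrightarrow> gevrey l (a x)" by eventually_elim (use t in auto)
  then have ga: "AE x in lebesgue_on {t/2..t}. gevrey l (a x)" by (simp add: AE_restrict_space_iff)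
  have "\<exists>s. s \<in> {t/2..t} \<and> gevrey l (a s) \<and> gevrey_sum l (a s) \<le> 2 / t * (D + 1)"
  proof (rule ccontr)
    assume no: "\<not> ?thesis"
    interpret fin: finite_measure "lebesgue_on {t/2..t}" by (rule finite_measure_interval)
    have ms: "measure (lebesgue_on {t/2..t}) (space (lebesgue_on {t/2..t})) = t / 2"
      using t by (simp add: measure_restrict_space)
    have "D + 1 = (\<integral>x. 2 / t * (D + 1) \<partial>lebesgue_on {t/2..t})"
      unfolding lebesgue_integral_const ms using t by simp
    also have "\<dots> \<le> (\<integral>x. gevrey_sum l (a x) \<partial>lebesgue_on {t/2..t})"
    proof (rule integral_mono_AE)
      show "AE x in lebesgue_on {t/2..t}. 2 / t * (D + 1) \<le> gevrey_sum l (a x)"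
        using ga AE_space
      proof eventually_elim
        case (elim x)
        then have "x \<in> {t/2..t}" by simp
        then show ?case using elim no by force
      qed
    qed (use Wi in auto)
    also have "\<dots> \<le> (\<integral>x. gevrey_sum l (a x) \<partial>lebesgue_on {t/2..T})"
    proof -
      have "(\<integral>x. gevrey_sum l (a x) \<partial>lebesgue_on {t/2..t}) + (\<integral>x. gevrey_sum l (a x) \<partial>lebesgue_on {t..T})
        = (\<integral>x. gevrey_sum l (a x) \<partial>lebesgue_on {t/2..T})"
        by (rule integral_lebesgue_on_combine[OF W(2)]) (use t in auto)
      moreover have "0 \<le> (\<integral>x. gevrey_sum l (a x) \<partial>lebesgue_on {t..T})"
        by (rule Bochner_Integration.integral_nonneg) simp
      ultimately show ?thesis by linarith
    qed
    also have "\<dots> \<le> D" by (rule W(3))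
    finally show False by simp
  qed
  then show thesis using that by blast
qed

text \<open>The energy inequality at level \<open>n\<close> is started from a good time \<open>s\<close> between \<open>t / 2\<close> and \<open>t\<close>.  Its right-hand side
  contains the product of the levels \<open>n - 1\<close> and \<open>n\<close>; the former is bounded by \<open>D\<close> and the latter has integral at
  most \<open>D\<close>.\<close>

lemma regular_step:
  assumes n: "n \<ge> 1" and t: "0 < t" "t \<le> T"
    and prev: "\<And>s. t / 2 \<le> s \<Longrightarrow> s \<le> T \<Longrightarrow> regular_at (n - 1) D s"
    and \<Phi>: "integrable (lebesgue_on {0..T}) \<Phi>" "\<And>x. \<Phi> x \<ge> 0"
    and \<Phi>f: "AE x in lebesgue_on {0..T}. \<forall>F. finite F \<longrightarrow> (\<Sum>k\<in>F. gevrey_term ((real n - 1) * \<sigma>) (fh x) k) \<le> \<Phi> x"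
    and \<Phi>I: "(\<integral>x. \<Phi> x \<partial>lebesgue_on {0..T}) \<le> I"
  shows "regular_at n ((2 / t * (D + 1) + 2 / \<mu> * I + 2 / \<mu> * lattice_const (\<sigma> / 2) * D\<^sup>2) * (1 + 1 / \<mu>)) t"
proof -
  define l where "l = real n * \<sigma>"
  have ls: "l - \<sigma> = (real n - 1) * \<sigma>" "l + \<sigma> = (real n + 1) * \<sigma>" "real (n - 1) * \<sigma> = l - \<sigma>"
    "(real (n - 1) + 1) * \<sigma> = l"
    using n by (auto simp: l_def algebra_simps of_nat_diff)
  have "1 * \<sigma> \<le> l" unfolding l_def using n sigma by (intro mult_right_mono) auto
  then have l2: "l \<ge> \<sigma> / 2" using sigma by simp
  define c where "c = lattice_const (\<sigma> / 2)"
  have c0: "c \<ge> 0" by (auto simp: c_def lattice_const_def intro!: infsum_nonneg)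
  have t2: "0 \<le> t / 2" "t / 2 \<le> T" using t by auto
  have pv: "gevrey_sum (l - \<sigma>) (a s) \<le> D" if "t / 2 \<le> s" "s \<le> T" for s
    using prev[OF that] unfolding regular_at_def ls by blast
  have bd: "(\<integral>x. (\<Sum>k\<in>F. gevrey_term l (a x) k) \<partial>lebesgue_on {t/2..T}) \<le> D" if "finite F" for F
    using prev[OF order_refl t2(2)] that unfolding regular_at_def ls by blast
  have D0: "D \<ge> 0" using bd[of "{}"] by simp
  note W = gevrey_sum_integral[OF t2 bd]
  obtain s where s: "s \<in> {t/2..t}" "gevrey l (a s)" "gevrey_sum l (a s) \<le> 2 / t * (D + 1)"
    using exists_good_time[OF t bd] by blast
  have s0: "0 \<le> s" using s(1) t by auto
  define X where "X = 2 / t * (D + 1) + 2 / \<mu> * I + 2 / \<mu> * c * D\<^sup>2"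
  define G where "G x = 2 / \<mu> * \<Phi> x + 2 / \<mu> * c * D * gevrey_sum l (a x)" for x
  have sub: "(\<integral>x. h x \<partial>lebesgue_on {p..q}) \<le> (\<integral>x. h x \<partial>lebesgue_on {p'..T})"
    if "integrable (lebesgue_on {p'..T}) h" "\<And>x. h x \<ge> 0" "p' \<le> p" "p \<le> q" "q \<le> T" for h :: "real \<Rightarrow> real" and p q p'
  proof -
    have 1: "(\<integral>x. h x \<partial>lebesgue_on {p'..p}) + (\<integral>x. h x \<partial>lebesgue_on {p..T}) = (\<integral>x. h x \<partial>lebesgue_on {p'..T})"
      by (rule integral_lebesgue_on_combine[OF that(1)]) (use that in auto)
    have 2: "(\<integral>x. h x \<partial>lebesgue_on {p..q}) + (\<integral>x. h x \<partial>lebesgue_on {q..T}) = (\<integral>x. h x \<partial>lebesgue_on {p..T})"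
      by (rule integral_lebesgue_on_combine[OF integrable_lebesgue_on_subinterval[OF that(1)]]) (use that in auto)
    have "0 \<le> (\<integral>x. h x \<partial>lebesgue_on {p'..p})" "0 \<le> (\<integral>x. h x \<partial>lebesgue_on {q..T})"
      by (intro Bochner_Integration.integral_nonneg that)+
    then show ?thesis using 1 2 by linarith
  qed
  have est: "(\<Sum>k\<in>F. gevrey_term l (a t') k) + \<mu> * (\<integral>x. (\<Sum>k\<in>F. gevrey_term (l + \<sigma>) (a x) k) \<partial>lebesgue_on {s..t'}) \<le> X"
    if F: "finite F" and t': "t \<le> t'" "t' \<le> T" for F t'
  proof -
    have st: "s \<le> t'" using s(1) t' by auto
    have Wi: "integrable (lebesgue_on {s..t'}) (\<lambda>x. gevrey_sum l (a x))"
      by (rule integrable_lebesgue_on_subinterval[OF W(2)]) (use s t' in auto)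
    have \<Phi>i: "integrable (lebesgue_on {s..t'}) \<Phi>"
      by (rule integrable_lebesgue_on_subinterval[OF \<Phi>(1) s0 t'(2)])
    have WA: "AE x in lebesgue_on {s..t'}. gevrey l (a x)"
    proof -
      have "AE x in lebesgue. x \<in> {t/2..T} \<longrightarrow> gevrey l (a x)" using W(1) by (simp add: AE_restrict_space_iff)
      then have "AE x in lebesgue. x \<in> {s..t'} \<longrightarrow> gevrey l (a x)" by eventually_elim (use s t' in auto)
      then show ?thesis by (simp add: AE_restrict_space_iff)
    qed
    have "(\<Sum>k\<in>F. gevrey_term l (a t') k) + \<mu> * (\<integral>x. (\<Sum>k\<in>F. gevrey_term (l + \<sigma>) (a x) k) \<partial>lebesgue_on {s..t'})
      \<le> (\<Sum>k\<in>F. gevrey_term l (a s) k) + (\<integral>x. G x \<partial>lebesgue_on {s..t'})"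
    proof (rule energy_inequality[OF s0 st t'(2) F])
      show "integrable (lebesgue_on {s..t'}) G" unfolding G_def using Wi \<Phi>i by simp
      show "AE x in lebesgue_on {s..t'}.
        (\<Sum>k\<in>F. 2 * (exp (2 * l * norm (real_vec k)) * (fh x k \<bullet> a x k)) + - 2 * (exp (2 * l * norm (real_vec k)) * (advect_coeff (a x) k \<bullet> a x k)))
         \<le> \<mu> * (\<Sum>k\<in>F. gevrey_term (l + \<sigma>) (a x) k) + G x"
        using WA AE_subinterval[OF \<Phi>f s0 t'(2)] AE_space
      proof eventually_elim
        case (elim x)
        have x: "t / 2 \<le> x" "x \<le> T" using elim(3) s t' by auto
        define E where "E = (\<Sum>k\<in>F. gevrey_term (l + \<sigma>) (a x) k)"
        have m2: "\<mu> / 2 > 0" using mu by simp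
        have "(\<Sum>k\<in>F. 2 * (exp (2 * l * norm (real_vec k)) * (fh x k \<bullet> a x k)))
            \<le> (\<Sum>k\<in>F. \<mu> / 2 * gevrey_term (l + \<sigma>) (a x) k + gevrey_term (l - \<sigma>) (fh x) k / (\<mu> / 2))"
          by (rule sum_mono) (rule forcing_term_bound[OF m2])
        also have "\<dots> = \<mu> / 2 * E + (\<Sum>k\<in>F. gevrey_term (l - \<sigma>) (fh x) k) / (\<mu> / 2)"
          by (simp only: E_def sum.distrib sum_distrib_left sum_divide_distrib)
        also have "(\<Sum>k\<in>F. gevrey_term (l - \<sigma>) (fh x) k) / (\<mu> / 2) \<le> \<Phi> x / (\<mu> / 2)"
          using elim(2) F mu by (intro divide_right_mono) (auto simp: ls)
        finally have 1: "(\<Sum>k\<in>F. 2 * (exp (2 * l * norm (real_vec k)) * (fh x k \<bullet> a x k))) \<le> \<mu> / 2 * E + 2 / \<mu> * \<Phi> x"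
          by simp
        have "(\<Sum>k\<in>F. - 2 * (exp (2 * l * norm (real_vec k)) * (advect_coeff (a x) k \<bullet> a x k)))
          \<le> \<mu> / 2 * E + c * (gevrey_sum (l - \<sigma>) (a x) * gevrey_sum l (a x)) / (\<mu> / 2)"
          unfolding E_def c_def by (rule nonlinear_term_bound[OF m2 elim(1) sigma l2 F])
        also have "c * (gevrey_sum (l - \<sigma>) (a x) * gevrey_sum l (a x)) / (\<mu> / 2) \<le> c * (D * gevrey_sum l (a x)) / (\<mu> / 2)"
          using pv[OF x] c0 mu by (intro divide_right_mono mult_left_mono mult_right_mono) auto
        finally have 2: "(\<Sum>k\<in>F. - 2 * (exp (2 * l * norm (real_vec k)) * (advect_coeff (a x) k \<bullet> a x k)))
          \<le> \<mu> / 2 * E + 2 / \<mu> * c * D * gevrey_sum l (a x)"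
          by (simp add: mult_ac)
        have "\<mu> / 2 * E + \<mu> / 2 * E = \<mu> * E" by simp
        then show ?case using add_mono[OF 1 2] unfolding sum.distrib E_def[symmetric] G_def by linarith
      qed
    qed
    also have "(\<Sum>k\<in>F. gevrey_term l (a s) k) \<le> 2 / t * (D + 1)"
      by (rule order_trans[OF sum_gevrey_term_le[OF s(2) F] s(3)])
    also have "(\<integral>x. G x \<partial>lebesgue_on {s..t'}) = 2 / \<mu> * (\<integral>x. \<Phi> x \<partial>lebesgue_on {s..t'}) + 2 / \<mu> * c * D * (\<integral>x. gevrey_sum l (a x) \<partial>lebesgue_on {s..t'})"
      unfolding G_def using Wi \<Phi>i by simp
    also have "\<dots> \<le> 2 / \<mu> * I + 2 / \<mu> * c * D * D"
    proof (intro add_mono mult_left_mono)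
      show "(\<integral>x. \<Phi> x \<partial>lebesgue_on {s..t'}) \<le> I"
        using sub[OF \<Phi> s0 st t'(2)] \<Phi>I by linarith
      show "(\<integral>x. gevrey_sum l (a x) \<partial>lebesgue_on {s..t'}) \<le> D"
        using sub[OF W(2) gevrey_sum_nonneg _ st t'(2)] W(3) s(1) by auto
    qed (use mu c0 D0 in auto)
    finally show ?thesis by (simp add: X_def power2_eq_square mult_ac)
  qed
  have i0: "0 \<le> (\<integral>x. (\<Sum>k\<in>F. gevrey_term (l + \<sigma>) (a x) k) \<partial>lebesgue_on {p..q})" for F p q
    by (intro Bochner_Integration.integral_nonneg sum_nonneg) simp
  have X0: "X \<ge> 0" using est[of "{}" t] t by simp
  have Xe: "X * (1 + 1 / \<mu>) = X + X / \<mu>" by (simp add: algebra_simps)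
  have Xm: "X \<le> X * (1 + 1 / \<mu>)" "X / \<mu> \<le> X * (1 + 1 / \<mu>)"
    unfolding Xe using X0 mu by simp_all
  have 1: "(\<Sum>k\<in>F. gevrey_term l (a t) k) \<le> X * (1 + 1 / \<mu>)" if "finite F" for F
  proof -
    have "0 \<le> \<mu> * (\<integral>x. (\<Sum>k\<in>F. gevrey_term (l + \<sigma>) (a x) k) \<partial>lebesgue_on {s..t})" using i0 mu by simp
    then show ?thesis using est[OF that order_refl t(2)] Xm(1) by linarith
  qed
  have 2: "(\<integral>x. (\<Sum>k\<in>F. gevrey_term (l + \<sigma>) (a x) k) \<partial>lebesgue_on {t..T}) \<le> X * (1 + 1 / \<mu>)" if "finite F" for F
  proof -
    have "(\<integral>x. (\<Sum>k\<in>F. gevrey_term (l + \<sigma>) (a x) k) \<partial>lebesgue_on {t..T}) \<le> (\<integral>x. (\<Sum>k\<in>F. gevrey_term (l + \<sigma>) (a x) k) \<partial>lebesgue_on {s..T})"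
      by (rule sub[OF integrable_sum_gevrey_term[OF s0 order_refl]]) (use s t in \<open>auto intro: sum_nonneg\<close>)
    moreover have "\<mu> * (\<integral>x. (\<Sum>k\<in>F. gevrey_term (l + \<sigma>) (a x) k) \<partial>lebesgue_on {s..T}) \<le> X"
    proof -
      have "0 \<le> (\<Sum>k\<in>F. gevrey_term l (a T) k)" by (intro sum_nonneg) simp
      then show ?thesis using est[OF that t(2) order_refl] by linarith
    qed
    then have "(\<integral>x. (\<Sum>k\<in>F. gevrey_term (l + \<sigma>) (a x) k) \<partial>lebesgue_on {s..T}) \<le> X / \<mu>"
      using mu by (simp add: pos_le_divide_eq mult.commute)
    ultimately show ?thesis using Xm(2) by linarith
  qed
  show ?thesis unfolding regular_at_def
    using gevrey_from_finite_sums[OF 1] 2 by (simp add: X_def c_def l_def[symmetric] ls(2)[symmetric])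
qed

end

section \<open>Constants and exponents\<close>

text \<open>In \<open>regular_step\<close> the bound \<open>D = M (1 + 2/t)\<^sup>p\<close> enters squared and also with the factor \<open>2/t\<close>; the exponent
  \<open>2p + 1\<close> covers both.\<close>

fun level_exp :: "nat \<Rightarrow> nat" where
  "level_exp 0 = 1"
| "level_exp (Suc n) = 2 * level_exp n + 1"

fun level_const :: "real \<Rightarrow> real \<Rightarrow> real \<Rightarrow> real \<Rightarrow> nat \<Rightarrow> real" where
  "level_const \<mu> \<sigma> X I 0 = (X + I / \<mu>) * (1 + 1 / \<mu>)"
| "level_const \<mu> \<sigma> X I (Suc n) =
     (2 * (level_const \<mu> \<sigma> X I n * 2 ^ level_exp n + 1) + 2 / \<mu> * I
      + 2 / \<mu> * lattice_const (\<sigma> / 2) * (level_const \<mu> \<sigma> X I n * 2 ^ level_exp n)\<^sup>2) * (1 + 1 / \<mu>)"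

lemma lattice_const_nonneg: "lattice_const d \<ge> 0"
  by (auto simp: lattice_const_def intro!: infsum_nonneg)

lemma level_const_nonneg:
  assumes "\<mu> > 0" "X \<ge> 0" "I \<ge> 0"
  shows "level_const \<mu> \<sigma> X I n \<ge> 0"
  using assms by (induction n) (auto intro!: mult_nonneg_nonneg add_nonneg_nonneg divide_nonneg_nonneg lattice_const_nonneg)

lemma level_step_bound:
  fixes t M \<mu> I c :: real and p :: nat
  assumes mu: "\<mu> > 0" and M: "M \<ge> 0" and I: "I \<ge> 0" and c: "c \<ge> 0" and t: "t > 0"
  defines "D \<equiv> M * (1 + 2 / t) ^ p"
  shows "(2 / t * (D + 1) + 2 / \<mu> * I + 2 / \<mu> * c * D\<^sup>2) * (1 + 1 / \<mu>)
     \<le> (2 * (M * 2 ^ p + 1) + 2 / \<mu> * I + 2 / \<mu> * c * (M * 2 ^ p)\<^sup>2) * (1 + 1 / \<mu>) * (1 + 1 / t) ^ (2 * p + 1)"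
proof -
  define q where "q = 1 + 1 / t"
  have q1: "q \<ge> 1" using t by (simp add: q_def)
  have tq: "2 / t \<le> 2 * q" "1 + 2 / t \<le> 2 * q" using t by (simp_all add: q_def field_simps)
  have "(1 + 2 / t) ^ p \<le> (2 * q) ^ p" using tq t by (intro power_mono) auto
  then have DE: "D \<le> M * 2 ^ p * q ^ p"
    unfolding D_def using M by (simp add: power_mult_distrib mult_left_mono mult.assoc)
  have D0: "D \<ge> 0" unfolding D_def using M t by simp
  have qp: "1 \<le> q ^ m" for m by (rule one_le_power[OF q1])
  have qm: "q ^ i \<le> q ^ j" if "i \<le> j" for i j by (rule power_increasing[OF that q1])
  define Q where "Q = q ^ (2 * p + 1)"
  have "D + 1 \<le> (M * 2 ^ p + 1) * q ^ p" using DE qp[of p] by (simp add: algebra_simps)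
  then have "2 / t * (D + 1) \<le> (2 * q) * ((M * 2 ^ p + 1) * q ^ p)"
    using tq t D0 q1 by (intro mult_mono) auto
  also have "\<dots> = 2 * (M * 2 ^ p + 1) * q ^ (p + 1)" by simp
  also have "\<dots> \<le> 2 * (M * 2 ^ p + 1) * Q" unfolding Q_def using M by (intro mult_left_mono qm) auto
  finally have 1: "2 / t * (D + 1) \<le> 2 * (M * 2 ^ p + 1) * Q" .
  have "2 / \<mu> * I * 1 \<le> 2 / \<mu> * I * Q" unfolding Q_def using mu I by (intro mult_left_mono qp) auto
  then have 2: "2 / \<mu> * I \<le> 2 / \<mu> * I * Q" by simp
  have "D\<^sup>2 \<le> (M * 2 ^ p * q ^ p)\<^sup>2" using DE D0 by (intro power_mono)
  also have "\<dots> = (M * 2 ^ p)\<^sup>2 * q ^ (2 * p)" by (simp add: power_mult_distrib power_mult[symmetric] mult.commute)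
  also have "\<dots> \<le> (M * 2 ^ p)\<^sup>2 * Q" unfolding Q_def by (intro mult_left_mono qm) auto
  finally have "2 / \<mu> * c * D\<^sup>2 \<le> 2 / \<mu> * c * ((M * 2 ^ p)\<^sup>2 * Q)"
    using mu c by (intro mult_left_mono) auto
  then have "2 / t * (D + 1) + 2 / \<mu> * I + 2 / \<mu> * c * D\<^sup>2
     \<le> (2 * (M * 2 ^ p + 1) + 2 / \<mu> * I + 2 / \<mu> * c * (M * 2 ^ p)\<^sup>2) * Q"
    using 1 2 by (simp add: distrib_right mult.assoc)
  then have "(2 / t * (D + 1) + 2 / \<mu> * I + 2 / \<mu> * c * D\<^sup>2) * (1 + 1 / \<mu>)
     \<le> (2 * (M * 2 ^ p + 1) + 2 / \<mu> * I + 2 / \<mu> * c * (M * 2 ^ p)\<^sup>2) * Q * (1 + 1 / \<mu>)"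
    using mu by (intro mult_right_mono) auto
  then show ?thesis by (simp only: Q_def q_def mult_ac)
qed

lemma power_one_plus_le:
  fixes x :: real
  assumes "x \<ge> 0" shows "(1 + x) ^ p \<le> 2 ^ p * (x ^ p + 1)"
proof -
  have "(1 + x) ^ p \<le> (2 * max 1 x) ^ p" using assms by (intro power_mono) auto
  also have "\<dots> = 2 ^ p * (max 1 x) ^ p" by (rule power_mult_distrib)
  also have "(max 1 x) ^ p \<le> x ^ p + 1" using assms by (cases "x \<le> 1") (auto simp: max_def)
  finally show ?thesis by simp
qed

context fourier_solution begin

lemma regular_at_mono: "regular_at n D t \<Longrightarrow> D \<le> D' \<Longrightarrow> regular_at n D' t"
  unfolding regular_at_def by (meson order_trans)

theorem regular_all_levels:
  assumes \<Phi>: "integrable (lebesgue_on {0..T}) \<Phi>" "\<And>x. \<Phi> x \<ge> 0"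
    and \<Phi>f: "AE x in lebesgue_on {0..T}. \<forall>F. finite F \<longrightarrow> (\<Sum>k\<in>F. gevrey_term ((real n - 1) * \<sigma>) (fh x) k) \<le> \<Phi> x"
    and \<Phi>I: "(\<integral>x. \<Phi> x \<partial>lebesgue_on {0..T}) \<le> I"
    and X: "gevrey_sum 0 (a 0) \<le> X"
  shows "m \<le> n \<Longrightarrow> 0 < t \<Longrightarrow> t \<le> T \<Longrightarrow>
    regular_at m (level_const \<mu> \<sigma> X I m * (1 + 1 / t) ^ level_exp m) t"
proof (induction m arbitrary: t)
  have X0: "X \<ge> 0" using X gevrey_sum_nonneg order_trans by blast
  have "0 \<le> (\<integral>x. \<Phi> x \<partial>lebesgue_on {0..T})" by (rule Bochner_Integration.integral_nonneg) (rule \<Phi>)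
  then have I0: "I \<ge> 0" using \<Phi>I by linarith
  note M0 = level_const_nonneg[OF mu X0 I0, of \<sigma>]
  have \<Phi>m: "AE x in lebesgue_on {0..T}. \<forall>F. finite F \<longrightarrow> (\<Sum>k\<in>F. gevrey_term ((real m - 1) * \<sigma>) (fh x) k) \<le> \<Phi> x"
    if "m \<le> n" for m
    using \<Phi>f
  proof eventually_elim
    case (elim x)
    have "(real m - 1) * \<sigma> \<le> (real n - 1) * \<sigma>" using that sigma by (intro mult_right_mono) auto
    then have "(\<Sum>k\<in>F. gevrey_term ((real m - 1) * \<sigma>) (fh x) k) \<le> (\<Sum>k\<in>F. gevrey_term ((real n - 1) * \<sigma>) (fh x) k)" for F
      by (intro sum_mono gevrey_term_mono)
    then show ?case using elim order_trans by blast
  qed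
  {
    case 0
    have "regular_at 0 (level_const \<mu> \<sigma> X I 0) t"
      using regular_level_zero[OF \<Phi> _ \<Phi>I X, of t] \<Phi>m[of 0] 0 by simp
    moreover have "level_const \<mu> \<sigma> X I 0 * 1 \<le> level_const \<mu> \<sigma> X I 0 * (1 + 1 / t) ^ level_exp 0"
      using M0[of 0] 0 by (intro mult_left_mono) (auto simp del: level_const.simps)
    ultimately show ?case by (metis regular_at_mono mult_1_right)
  next
    case (Suc m)
    define p where "p = level_exp m"
    define M where "M = level_const \<mu> \<sigma> X I m"
    have MM: "M \<ge> 0" unfolding M_def by (rule M0)
    \<comment> \<open>On \<open>{t/2..T}\<close> the bound of the previous level is largest at \<open>t/2\<close>.\<close>
    have prev: "regular_at (Suc m - 1) (M * (1 + 2 / t) ^ p) s" if s: "t / 2 \<le> s" "s \<le> T" for s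
    proof -
      have s0: "0 < s" using s Suc.prems by auto
      have "regular_at m (M * (1 + 1 / s) ^ p) s"
        unfolding M_def p_def by (rule Suc.IH) (use Suc.prems s s0 in auto)
      moreover have "M * (1 + 1 / s) ^ p \<le> M * (1 + 2 / t) ^ p"
      proof (intro mult_left_mono power_mono add_left_mono)
        show "1 / s \<le> 2 / t" using s s0 Suc.prems by (simp add: field_simps)
      qed (use s0 MM in auto)
      ultimately show ?thesis using regular_at_mono by simp
    qed
    have "regular_at (Suc m) ((2 / t * (M * (1 + 2 / t) ^ p + 1) + 2 / \<mu> * I + 2 / \<mu> * lattice_const (\<sigma> / 2) * (M * (1 + 2 / t) ^ p)\<^sup>2) * (1 + 1 / \<mu>)) t"
      by (rule regular_step[OF _ Suc.prems(2,3) prev \<Phi> \<Phi>m[OF Suc.prems(1)] \<Phi>I]) auto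
    then show ?case
      using level_step_bound[OF mu MM I0 lattice_const_nonneg[of "\<sigma> / 2"] Suc.prems(2), of p]
      by (auto simp: M_def p_def elim: regular_at_mono)
  }
qed

end

section \<open>From weak solutions to Fourier solutions\<close>

text \<open>The inequality \<open>\<bar>x + y\<bar>\<^sup>2 \<le> 2 \<bar>x\<bar>\<^sup>2 + 2 \<bar>y\<bar>\<^sup>2\<close> takes the place of the triangle inequality for the \<open>L\<^sup>2\<close> norm.\<close>

lemma L2per_diff:
  fixes g h :: "real^3 \<Rightarrow> real^3"
  assumes g: "g \<in> L2per" and h: "h \<in> L2per"
  shows "(\<lambda>x. g x - h x) \<in> L2per"
    and "(L2norm g)\<^sup>2 \<le> 2 * (L2norm (\<lambda>x. g x - h x))\<^sup>2 + 2 * (L2norm h)\<^sup>2"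
proof -
  have m: "g \<in> borel_measurable lebesgue" "h \<in> borel_measurable lebesgue"
    and i: "integrable torus (\<lambda>x. (norm (g x))\<^sup>2)" "integrable torus (\<lambda>x. (norm (h x))\<^sup>2)"
    using g h by (simp_all add: L2per_def set_integrable_Omega)
  have mt: "(\<lambda>x. (norm (g x - h x))\<^sup>2) \<in> borel_measurable torus"
    using m by (intro measurable_restrict_space1) simp
  have par: "(norm (x + y))\<^sup>2 \<le> 2 * (norm x)\<^sup>2 + 2 * (norm y)\<^sup>2" for x y :: "real^3"
  proof -
    have "(norm (x + y))\<^sup>2 \<le> (norm x + norm y)\<^sup>2" by (intro power_mono norm_triangle_ineq) simp
    also have "\<dots> \<le> 2 * (norm x)\<^sup>2 + 2 * (norm y)\<^sup>2"
      using sum_squares_bound[of "norm x" "norm y"] by (simp add: power2_sum)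
    finally show ?thesis .
  qed
  have di: "integrable torus (\<lambda>x. (norm (g x - h x))\<^sup>2)"
  proof (rule Bochner_Integration.integrable_bound[of _ "\<lambda>x. 2 * (norm (g x))\<^sup>2 + 2 * (norm (h x))\<^sup>2"])
    show "AE x in torus. norm ((norm (g x - h x))\<^sup>2) \<le> norm (2 * (norm (g x))\<^sup>2 + 2 * (norm (h x))\<^sup>2)"
      using par[of "g _" "- h _"] by (intro AE_I2) simp
  qed (use i mt in auto)
  show "(\<lambda>x. g x - h x) \<in> L2per"
    using g h m di by (simp add: L2per_def set_integrable_Omega periodic_def)
  have "(\<integral>x. (norm (g x))\<^sup>2 \<partial>torus) \<le> (\<integral>x. 2 * (norm (g x - h x))\<^sup>2 + 2 * (norm (h x))\<^sup>2 \<partial>torus)"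
  proof (rule integral_mono)
    show "(norm (g x))\<^sup>2 \<le> 2 * (norm (g x - h x))\<^sup>2 + 2 * (norm (h x))\<^sup>2" for x
      using par[of "g x - h x" "h x"] by simp
  qed (use i di in auto)
  also have "\<dots> = 2 * (L2norm (\<lambda>x. g x - h x))\<^sup>2 + 2 * (L2norm h)\<^sup>2"
    using i di by (simp add: L2norm_torus)
  finally show "(L2norm g)\<^sup>2 \<le> 2 * (L2norm (\<lambda>x. g x - h x))\<^sup>2 + 2 * (L2norm h)\<^sup>2"
    by (simp only: L2norm_torus)
qed

lemma fourier_coeff_diff:
  fixes g h :: "real^3 \<Rightarrow> real^3"
  assumes "g \<in> L2per" "h \<in> L2per"
  shows "fourier_coeff (\<lambda>x. g x - h x) k = fourier_coeff g k - fourier_coeff h k"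
  using fcoeff_diff[OF L2per_component(1)[OF assms(1)] L2per_component(1)[OF assms(2)]]
  by (simp add: vec_eq_iff fourier_coeff_nth)

lemma norm_fourier_coeff_le:
  fixes g :: "real^3 \<Rightarrow> real^3"
  assumes "g \<in> L2per" shows "norm (fourier_coeff g k) \<le> L2norm g"
proof -
  have "1 \<le> (2 * pi) ^ 3" using pi_ge_two by (intro one_le_power) simp
  then have "1 * (norm (fourier_coeff g k))\<^sup>2 \<le> (2 * pi) ^ 3 * (norm (fourier_coeff g k))\<^sup>2"
    by (rule mult_right_mono) simp
  then have "(norm (fourier_coeff g k))\<^sup>2 \<le> (L2norm g)\<^sup>2"
    using bessel_inequality(1)[OF assms, of "{k}"] by simp
  then show ?thesis by (rule power2_le_imp_le) (rule L2norm_nonneg)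
qed

lemma continuous_in_H_fourier_coeff:
  assumes c: "continuous_in_H T u"
  shows "continuous_on {0..T} (\<lambda>t. fourier_coeff (u t) k)"
  unfolding continuous_on_def
proof
  fix t assume t: "t \<in> {0..T}"
  have L: "u s \<in> L2per" if "s \<in> {0..T}" for s using c that by (auto simp: continuous_in_H_def H_space_L2per)
  have "((\<lambda>s. fourier_coeff (u s) k - fourier_coeff (u t) k) \<longlongrightarrow> 0) (at t within {0..T})"
  proof (rule Lim_null_comparison)
    show "((\<lambda>s. L2norm (\<lambda>x. u s x - u t x)) \<longlongrightarrow> 0) (at t within {0..T})"
      using c t by (auto simp: continuous_in_H_def)
    show "\<forall>\<^sub>F s in at t within {0..T}. norm (fourier_coeff (u s) k - fourier_coeff (u t) k) \<le> L2norm (\<lambda>x. u s x - u t x)"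
      unfolding eventually_at_filter
      by (rule always_eventually) (use L t norm_fourier_coeff_le L2per_diff(1) in \<open>auto simp: fourier_coeff_diff[symmetric]\<close>)
  qed
  then show "((\<lambda>t. fourier_coeff (u t) k) \<longlongrightarrow> fourier_coeff (u t) k) (at t within {0..T})"
    by (simp add: LIM_zero_iff)
qed

text \<open>Along a sequence of times with unbounded norms, a subsequence converges in the compact interval, which
  contradicts continuity at its limit.\<close>

lemma continuous_in_H_bounded:
  assumes c: "continuous_in_H T u"
  shows "\<exists>M. \<forall>t\<in>{0..T}. (L2norm (u t))\<^sup>2 \<le> M"
proof (rule ccontr)
  assume no: "\<not> ?thesis"
  have L: "u s \<in> L2per" if "s \<in> {0..T}" for s using c that by (auto simp: continuous_in_H_def H_space_L2per)
  have "\<forall>n. \<exists>t. t \<in> {0..T} \<and> (L2norm (u t))\<^sup>2 > real n" using no by (metis not_le)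
  then obtain s where s: "\<And>n. s n \<in> {0..T}" "\<And>n. (L2norm (u (s n)))\<^sup>2 > real n" by metis
  have "compact {0..T}" by simp
  then obtain t r where t: "t \<in> {0..T}" "strict_mono r" "(s \<circ> r) \<longlonglongrightarrow> t"
    using s(1) unfolding compact_def by metis
  have z: "L2norm (\<lambda>x. u t x - u t x) = 0" by (simp add: L2norm_def set_integral_Omega)
  have "continuous (at t within {0..T}) (\<lambda>s. L2norm (\<lambda>x. u s x - u t x))"
    unfolding continuous_within z using c t(1) by (auto simp: continuous_in_H_def)
  then have "(\<lambda>n. L2norm (\<lambda>x. u ((s \<circ> r) n) x - u t x)) \<longlonglongrightarrow> L2norm (\<lambda>x. u t x - u t x)"
    by (rule continuous_within_tendsto_compose[OF _ _ t(3)]) (use s(1) in auto)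
  then have "eventually (\<lambda>n. L2norm (\<lambda>x. u ((s \<circ> r) n) x - u t x) < 1) sequentially"
    unfolding z by (rule order_tendstoD) simp
  then obtain N where N: "\<And>n. n \<ge> N \<Longrightarrow> L2norm (\<lambda>x. u (s (r n)) x - u t x) < 1"
    by (auto simp: eventually_sequentially)
  obtain m :: nat where m: "2 + 2 * (L2norm (u t))\<^sup>2 < real m" using reals_Archimedean2 by blast
  define n where "n = max N m"
  have "(L2norm (u (s (r n))))\<^sup>2 \<le> 2 * (L2norm (\<lambda>x. u (s (r n)) x - u t x))\<^sup>2 + 2 * (L2norm (u t))\<^sup>2"
    by (rule L2per_diff(2)[OF L[OF s(1)] L[OF t(1)]])
  also have "(L2norm (\<lambda>x. u (s (r n)) x - u t x))\<^sup>2 \<le> 1"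
    using N[of n] L2norm_nonneg by (intro power_le_one) (auto simp: n_def less_imp_le)
  finally have "(L2norm (u (s (r n))))\<^sup>2 < real m" using m by simp
  moreover have "m \<le> r n" using seq_suble[OF t(2), of n] by (simp add: n_def)
  ultimately show False using s(2)[of "r n"] by (smt (verit) of_nat_mono)
qed

lemma L2norm_gevrey_zero:
  assumes "g \<in> L2per"
  shows "gevrey 0 (fourier_coeff g)" "gevrey_sum 0 (fourier_coeff g) \<le> (L2norm g)\<^sup>2 / (2 * pi) ^ 3"
proof -
  have e: "gevrey_term 0 (fourier_coeff g) = (\<lambda>k. (norm (fourier_coeff g k))\<^sup>2)"
    by (simp add: gevrey_term_def fun_eq_iff)
  show "gevrey 0 (fourier_coeff g)" using bessel_inequality(2)[OF assms] by (simp add: gevrey_def e)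
  show "gevrey_sum 0 (fourier_coeff g) \<le> (L2norm g)\<^sup>2 / (2 * pi) ^ 3"
    using bessel_inequality(3)[OF assms] by (simp add: gevrey_sum_def e pos_le_divide_eq mult.commute)
qed

lemma expA_in_L2_gevrey:
  assumes "expA_in_L2 s t l w"
  shows "integrable (lebesgue_on {s..t}) (\<lambda>x. (L2norm (expA l (w x)))\<^sup>2 / (2 * pi) ^ 3)"
    and "AE x in lebesgue_on {s..t}. gevrey l (fourier_coeff (w x)) \<and>
       gevrey_sum l (fourier_coeff (w x)) \<le> (L2norm (expA l (w x)))\<^sup>2 / (2 * pi) ^ 3"
proof -
  show "integrable (lebesgue_on {s..t}) (\<lambda>x. (L2norm (expA l (w x)))\<^sup>2 / (2 * pi) ^ 3)"
    using assms by (simp add: expA_in_L2_def set_integral_interval)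
  have "AE x in lebesgue_on {s..t}. w x \<in> dom_expA l"
    using assms by (auto simp: expA_in_L2_def AE_restrict_space_iff)
  then show "AE x in lebesgue_on {s..t}. gevrey l (fourier_coeff (w x)) \<and>
       gevrey_sum l (fourier_coeff (w x)) \<le> (L2norm (expA l (w x)))\<^sup>2 / (2 * pi) ^ 3"
    by eventually_elim (use dom_expA_gevrey in \<open>auto simp: pos_le_divide_eq mult.commute\<close>)
qed

theorem weak_solution_fourier:
  assumes ws: "weak_solution \<mu> \<sigma> T u0 f u" and mu: "\<mu> > 0" and \<sigma>: "\<sigma> > 0" and T: "T > 0"
    and f: "\<And>t. t \<in> {0..T} \<Longrightarrow> f t \<in> H_space"
  shows "fourier_solution \<mu> \<sigma> T (\<lambda>t. fourier_coeff (u t)) (\<lambda>t. fourier_coeff (f t))"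
proof
  have c: "continuous_in_H T u" and e: "expA_in_L2 0 T \<sigma> u" using ws by (auto simp: weak_solution_def)
  have uH: "u t \<in> H_space" if "t \<in> {0..T}" for t using c that by (auto simp: continuous_in_H_def)
  show "\<mu> > 0" "\<sigma> > 0" "T > 0" by (rule mu \<sigma> T)+
  show "H_coeffs (fourier_coeff (u t))" if "t \<in> {0..T}" for t by (rule H_space_coeffs[OF uH[OF that]])
  show ct: "continuous_on {0..T} (\<lambda>t. fourier_coeff (u t) k)" for k
    by (rule continuous_in_H_fourier_coeff[OF c])
  show "AE s in lebesgue_on {0..T}. gevrey \<sigma> (fourier_coeff (u s))"
    using expA_in_L2_gevrey(2)[OF e] by eventually_elim simp
  show "\<exists>Y. integrable (lebesgue_on {0..T}) Y \<and> (AE s in lebesgue_on {0..T}. gevrey_sum \<sigma> (fourier_coeff (u s)) \<le> Y s)"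
  proof (intro exI conjI)
    show "integrable (lebesgue_on {0..T}) (\<lambda>x. (L2norm (expA \<sigma> (u x)))\<^sup>2 / (2 * pi) ^ 3)"
      by (rule expA_in_L2_gevrey(1)[OF e])
    show "AE s in lebesgue_on {0..T}. gevrey_sum \<sigma> (fourier_coeff (u s)) \<le> (L2norm (expA \<sigma> (u s)))\<^sup>2 / (2 * pi) ^ 3"
      using expA_in_L2_gevrey(2)[OF e] by eventually_elim simp
  qed
  show "\<exists>M. \<forall>t\<in>{0..T}. gevrey 0 (fourier_coeff (u t)) \<and> gevrey_sum 0 (fourier_coeff (u t)) \<le> M"
  proof -
    obtain M where M: "\<And>t. t \<in> {0..T} \<Longrightarrow> (L2norm (u t))\<^sup>2 \<le> M" using continuous_in_H_bounded[OF c] by blast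
    have "gevrey 0 (fourier_coeff (u t)) \<and> gevrey_sum 0 (fourier_coeff (u t)) \<le> M / (2 * pi) ^ 3" if t: "t \<in> {0..T}" for t
    proof -
      have "(L2norm (u t))\<^sup>2 / (2 * pi) ^ 3 \<le> M / (2 * pi) ^ 3" using M[OF t] by (intro divide_right_mono) auto
      then show ?thesis using L2norm_gevrey_zero[OF H_space_L2per[OF uH[OF t]]] by auto
    qed
    then show ?thesis by blast
  qed
  fix k :: "int^3" and s t assume k: "k \<noteq> 0" and st: "0 \<le> s" "s \<le> t" "t \<le> T"
  obtain r where r: "\<And>b. b \<in> Basis \<Longrightarrow> integrable (lebesgue_on {0..T}) (\<lambda>s. r s \<bullet> b)"
    "\<And>b s t. b \<in> Basis \<Longrightarrow> 0 \<le> s \<Longrightarrow> s \<le> t \<Longrightarrow> t \<le> T \<Longrightarrow>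
        fourier_coeff (u t) k \<bullet> b - fourier_coeff (u s) k \<bullet> b = (\<integral>x. r x \<bullet> b \<partial>lebesgue_on {s..t})"
    "AE s in lebesgue_on {0..T}. r s \<bullet> fourier_coeff (u s) k =
        fourier_coeff (f s) k \<bullet> fourier_coeff (u s) k
        - \<mu> * (exp (2 * \<sigma> * norm (real_vec k)) * (norm (fourier_coeff (u s) k))\<^sup>2)
        - advect_coeff (fourier_coeff (u s)) k \<bullet> fourier_coeff (u s) k"
    using mode_equation[OF ws \<sigma> T k f] by blast
  have ri: "integrable (lebesgue_on {s..t}) (\<lambda>x. r x \<bullet> b)" if "b \<in> Basis" for b
    by (rule integrable_lebesgue_on_subinterval[OF r(1)[OF that]]) (use st in auto)
  have AC: "fourier_coeff (u y) k \<bullet> b - fourier_coeff (u x) k \<bullet> b = (\<integral>z. r z \<bullet> b \<partial>lebesgue_on {x..y})"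
    if "b \<in> Basis" "s \<le> x" "x \<le> y" "y \<le> t" for b x y
    by (rule r(2)) (use that st in auto)
  have cst: "continuous_on {s..t} (\<lambda>t. fourier_coeff (u t) k)"
    by (rule continuous_on_subset[OF ct]) (use st in auto)
  note E = absolutely_continuous_norm_square[OF ri st(2) AC cst]
  show "\<exists>\<rho>. integrable (lebesgue_on {s..t}) \<rho> \<and>
         (norm (fourier_coeff (u t) k))\<^sup>2 - (norm (fourier_coeff (u s) k))\<^sup>2 = 2 * (\<integral>x. \<rho> x \<partial>lebesgue_on {s..t}) \<and>
         (AE x in lebesgue_on {s..t}. \<rho> x = fourier_coeff (f x) k \<bullet> fourier_coeff (u x) k
            - \<mu> * gevrey_term \<sigma> (fourier_coeff (u x)) k - advect_coeff (fourier_coeff (u x)) k \<bullet> fourier_coeff (u x) k)"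
  proof (intro exI conjI)
    show "integrable (lebesgue_on {s..t}) (\<lambda>x. r x \<bullet> fourier_coeff (u x) k)" by (rule E(1))
    show "(norm (fourier_coeff (u t) k))\<^sup>2 - (norm (fourier_coeff (u s) k))\<^sup>2 = 2 * (\<integral>x. r x \<bullet> fourier_coeff (u x) k \<partial>lebesgue_on {s..t})"
      by (rule E(2))
    have "AE x in lebesgue. x \<in> {0..T} \<longrightarrow> r x \<bullet> fourier_coeff (u x) k = fourier_coeff (f x) k \<bullet> fourier_coeff (u x) k
            - \<mu> * gevrey_term \<sigma> (fourier_coeff (u x)) k - advect_coeff (fourier_coeff (u x)) k \<bullet> fourier_coeff (u x) k"
      using r(3) by (simp add: AE_restrict_space_iff gevrey_term_def)
    then have "AE x in lebesgue. x \<in> {s..t} \<longrightarrow> r x \<bullet> fourier_coeff (u x) k = fourier_coeff (f x) k \<bullet> fourier_coeff (u x) k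
            - \<mu> * gevrey_term \<sigma> (fourier_coeff (u x)) k - advect_coeff (fourier_coeff (u x)) k \<bullet> fourier_coeff (u x) k"
      by eventually_elim (use st in auto)
    then show "AE x in lebesgue_on {s..t}. r x \<bullet> fourier_coeff (u x) k = fourier_coeff (f x) k \<bullet> fourier_coeff (u x) k
            - \<mu> * gevrey_term \<sigma> (fourier_coeff (u x)) k - advect_coeff (fourier_coeff (u x)) k \<bullet> fourier_coeff (u x) k"
      by (simp add: AE_restrict_space_iff)
  qed
qed

lemma borel_measurable_has_sum:
  fixes f :: "'i::countable \<Rightarrow> 'x \<Rightarrow> real"
  assumes inf: "infinite (UNIV :: 'i set)" and f: "\<And>k. f k \<in> borel_measurable M"
    and hs: "\<And>x. x \<in> space M \<Longrightarrow> ((\<lambda>k. f k x) has_sum g x) UNIV"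
  shows "g \<in> borel_measurable M"
proof -
  define e where "e = (from_nat_into UNIV :: nat \<Rightarrow> 'i)"
  have e: "bij_betw e UNIV UNIV" unfolding e_def
    by (rule bij_betw_from_nat_into) (use inf in auto)
  show ?thesis
  proof (rule borel_measurable_LIMSEQ_real)
    show "(\<lambda>x. \<Sum>n<i. f (e n) x) \<in> borel_measurable M" for i using f by simp
    fix x assume "x \<in> space M"
    then have "((\<lambda>n. f (e n) x) has_sum g x) UNIV"
      using has_sum_reindex_bij_betw[OF e, of "\<lambda>k. f k x" "g x"] hs by simp
    then show "(\<lambda>i. \<Sum>n<i. f (e n) x) \<longlonglongrightarrow> g x"
      using has_sum_imp_sums by (auto simp: sums_def)
  qed
qed

text \<open>That \<open>u t\<close> lies in the domain at level \<open>n\<close> is read off from finiteness at level \<open>n + 1\<close>, where the coefficients of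
  \<open>e\<^bsup>n\<sigma> A^(1/2)\<^esup> u\<close> are summable; the bound itself involves the forcing at level \<open>n - 1\<close> only.\<close>

lemma smoothing_estimates:
  fixes n :: nat
  assumes ws: "weak_solution \<mu> \<sigma> T u0 f u" and mu: "\<mu> > 0" and \<sigma>: "\<sigma> > 0" and T: "T > 0"
    and u0: "u0 \<in> H_space" and f: "\<And>t. t \<in> {0..T} \<Longrightarrow> f t \<in> H_space"
    and fL: "\<And>m::nat. expA_in_L2 0 T ((real m - 1) * \<sigma>) f" and t: "0 < t" "t \<le> T"
  defines "D \<equiv> (2 * pi) ^ 3 * (level_const \<mu> \<sigma> ((L2norm u0)\<^sup>2 / (2 * pi) ^ 3)
      ((LINT s:{0..T}|lebesgue. (L2norm (expA ((real n - 1) * \<sigma>) (f s)))\<^sup>2) / (2 * pi) ^ 3) n * (1 + 1 / t) ^ level_exp n)"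
  shows "u t \<in> dom_expA (real n * \<sigma>)"
    and "(L2norm (expA (real n * \<sigma>) (u t)))\<^sup>2 \<le> D"
    and "expA_in_L2 t T ((real n + 1) * \<sigma>) u"
    and "(LINT s:{t..T}|lebesgue. (L2norm (expA ((real n + 1) * \<sigma>) (u s)))\<^sup>2) \<le> D"
proof -
  define V :: real where "V = (2 * pi) ^ 3"
  have V: "V > 0" by (simp add: V_def)
  define a where "a t = fourier_coeff (u t)" for t
  define I where "I n = (LINT s:{0..T}|lebesgue. (L2norm (expA ((real n - 1) * \<sigma>) (f s)))\<^sup>2) / V" for n :: nat
  define X where "X = (L2norm u0)\<^sup>2 / V"
  interpret S: fourier_solution \<mu> \<sigma> T a "\<lambda>t. fourier_coeff (f t)"
    unfolding a_def by (rule weak_solution_fourier[OF ws mu \<sigma> T f])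
  have c: "continuous_in_H T u" using ws by (auto simp: weak_solution_def)
  have uH: "u s \<in> H_space" if "s \<in> {0..T}" for s using c that by (auto simp: continuous_in_H_def)
  have "gevrey_sum 0 (a 0) \<le> X"
  proof -
    have u00: "u 0 \<in> H_space" using uH[of 0] T by simp
    have "AE x in lebesgue. u 0 x = u0 x" using ws by (auto simp: weak_solution_def)
    then have ae: "AE x in torus. u 0 x = u0 x" by (auto simp: AE_restrict_space_iff elim!: eventually_mono)
    have m: "g \<in> borel_measurable torus" if "g \<in> H_space" for g
      using H_space_L2per[OF that] by (auto simp: L2per_def intro: measurable_restrict_space1)
    have "(\<integral>x. (norm (u 0 x))\<^sup>2 \<partial>torus) = (\<integral>x. (norm (u0 x))\<^sup>2 \<partial>torus)"
      by (rule integral_cong_AE) (use ae m[OF u00] m[OF u0] in \<open>auto elim!: eventually_mono\<close>)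
    then have "(L2norm (u 0))\<^sup>2 = (L2norm u0)\<^sup>2" by (simp add: L2norm_torus)
    then show ?thesis using L2norm_gevrey_zero(2)[OF H_space_L2per[OF u00]] by (simp add: a_def X_def V_def)
  qed
  note X = this
  have reg: "S.regular_at m (level_const \<mu> \<sigma> X (I m) m * (1 + 1 / s) ^ level_exp m) s" if s: "0 < s" "s \<le> T" for m s
  proof (rule S.regular_all_levels[OF _ _ _ _ X order_refl s])
    note E = expA_in_L2_gevrey[OF fL[of m], folded V_def]
    show "integrable (lebesgue_on {0..T}) (\<lambda>x. (L2norm (expA ((real m - 1) * \<sigma>) (f x)))\<^sup>2 / V)" by (rule E(1))
    show "0 \<le> (L2norm (expA ((real m - 1) * \<sigma>) (f x)))\<^sup>2 / V" for x using V by simp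
    show "AE x in lebesgue_on {0..T}. \<forall>F. finite F \<longrightarrow>
       (\<Sum>k\<in>F. gevrey_term ((real m - 1) * \<sigma>) (fourier_coeff (f x)) k) \<le> (L2norm (expA ((real m - 1) * \<sigma>) (f x)))\<^sup>2 / V"
      using E(2) by eventually_elim (use sum_gevrey_term_le order_trans in blast)
    show "(\<integral>x. (L2norm (expA ((real m - 1) * \<sigma>) (f x)))\<^sup>2 / V \<partial>lebesgue_on {0..T}) \<le> I m"
      by (simp add: I_def set_integral_interval)
  qed
  have gev: "gevrey (real m * \<sigma>) (a s)" if "0 < s" "s \<le> T" for m s
    using reg[OF that, of m] by (simp add: S.regular_at_def)
  define d where "d = level_const \<mu> \<sigma> X (I n) n * (1 + 1 / t) ^ level_exp n"
  have D: "D = V * d" by (simp add: D_def d_def V_def X_def I_def)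
  have rn: "S.regular_at n d t" unfolding d_def by (rule reg[OF t])
  have lt1: "real n * \<sigma> < real (n + 1) * \<sigma>" and lt2: "(real n + 1) * \<sigma> < real (n + 2) * \<sigma>" using \<sigma> by simp_all
  have tT: "t \<in> {0..T}" using t by simp
  note A = gevrey_dom_expA[OF uH[OF tT] gev[OF t, unfolded a_def] lt1]
  show "u t \<in> dom_expA (real n * \<sigma>)" by (rule A(1))
  have "gevrey_sum (real n * \<sigma>) (a t) \<le> d" using rn by (simp add: S.regular_at_def)
  then show "(L2norm (expA (real n * \<sigma>) (u t)))\<^sup>2 \<le> D"
    unfolding A(2) D V_def[symmetric] a_def[symmetric] using V by (intro mult_left_mono) auto
  define l where "l = (real n + 1) * \<sigma>"
  have pos: "0 < s \<and> s \<le> T \<and> s \<in> {0..T}" if "s \<in> {t..T}" for s using that t by auto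
  have B: "u s \<in> dom_expA l" "(L2norm (expA l (u s)))\<^sup>2 = V * gevrey_sum l (a s)"
    "\<And>v. v \<in> H_space \<Longrightarrow> ((\<lambda>k. V * (exp (l * norm (real_vec k)) * (a s k \<bullet> fourier_coeff v k))) has_sum L2inner (expA l (u s)) v) UNIV"
    if "s \<in> {t..T}" for s
    using gevrey_dom_expA[OF uH gev[unfolded a_def] lt2, of s] pos[OF that] by (auto simp: l_def V_def a_def)
  have bd: "(\<integral>x. (\<Sum>k\<in>F. gevrey_term l (a x) k) \<partial>lebesgue_on {t..T}) \<le> d" if "finite F" for F
    using rn that unfolding S.regular_at_def l_def by blast
  have t0: "0 \<le> t" using t by simp
  note W = S.gevrey_sum_integral[OF t0 t(2) bd]
  have eqW: "integral\<^sup>L (lebesgue_on {t..T}) (\<lambda>s. (L2norm (expA l (u s)))\<^sup>2) = integral\<^sup>L (lebesgue_on {t..T}) (\<lambda>s. V * gevrey_sum l (a s))"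
    by (rule Bochner_Integration.integral_cong) (auto simp: B(2))
  have intW: "integrable (lebesgue_on {t..T}) (\<lambda>s. (L2norm (expA l (u s)))\<^sup>2)
      \<longleftrightarrow> integrable (lebesgue_on {t..T}) (\<lambda>s. V * gevrey_sum l (a s))"
    by (rule Bochner_Integration.integrable_cong) (auto simp: B(2))
  have "expA_in_L2 t T l u" unfolding expA_in_L2_def set_integral_interval
  proof (intro conjI ballI)
    show "AE s in lebesgue. s \<in> {t..T} \<longrightarrow> u s \<in> dom_expA l" using B(1) by simp
    show "integrable (lebesgue_on {t..T}) (\<lambda>s. (L2norm (expA l (u s)))\<^sup>2)"
      unfolding intW using W(2) by simp
    fix v assume v: "v \<in> H_space"
    show "(\<lambda>s. L2inner (expA l (u s)) v) \<in> borel_measurable (lebesgue_on {t..T})"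
    proof (rule borel_measurable_has_sum[OF infinite_lattice])
      fix k
      have "continuous_on {t..T} (\<lambda>s. V * (exp (l * norm (real_vec k)) * (a s k \<bullet> fourier_coeff v k)))"
        by (intro continuous_intros continuous_on_subset[OF S.cont]) (use t in auto)
      then show "(\<lambda>s. V * (exp (l * norm (real_vec k)) * (a s k \<bullet> fourier_coeff v k))) \<in> borel_measurable (lebesgue_on {t..T})"
        by (rule continuous_imp_measurable_on_sets_lebesgue) simp
    qed (use B(3) v in simp)
  qed
  then show "expA_in_L2 t T ((real n + 1) * \<sigma>) u" by (simp add: l_def)
  have "(LINT s:{t..T}|lebesgue. (L2norm (expA l (u s)))\<^sup>2) \<le> D"
    unfolding set_integral_interval eqW D using W(2,3) V by (simp add: mult_left_mono)
  then show "(LINT s:{t..T}|lebesgue. (L2norm (expA ((real n + 1) * \<sigma>) (u s)))\<^sup>2) \<le> D"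
    by (simp add: l_def)
qed

section \<open>Instant smoothing\<close>

theorem theorem2p1:
  shows "\<forall>n::nat. \<exists>(p::nat) (q::nat)
           (C :: real \<Rightarrow> real \<Rightarrow> real \<Rightarrow> real \<Rightarrow> real \<Rightarrow> real)
           (C' :: real \<Rightarrow> real \<Rightarrow> real \<Rightarrow> real \<Rightarrow> real \<Rightarrow> real)
           (K :: real \<Rightarrow> real \<Rightarrow> real \<Rightarrow> real \<Rightarrow> real \<Rightarrow> real)
           (K' :: real \<Rightarrow> real \<Rightarrow> real \<Rightarrow> real \<Rightarrow> real \<Rightarrow> real).
         p \<ge> 1 \<and> q \<ge> 1 \<and>
         (\<forall>(\<mu>::real) (\<sigma>::real) (T::real) (u0 :: real^3 \<Rightarrow> real^3)
            (f :: real \<Rightarrow> real^3 \<Rightarrow> real^3) (u :: real \<Rightarrow> real^3 \<Rightarrow> real^3).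
            \<mu> > 0 \<longrightarrow> \<sigma> > 0 \<longrightarrow> T > 0 \<longrightarrow>
            u0 \<in> H_space \<longrightarrow>
            (\<forall>t\<in>{0..T}. f t \<in> H_space \<and> entire_field (f t)) \<longrightarrow>
            (\<forall>m::nat. expA_in_L2 0 T ((real m - 1) * \<sigma>) f) \<longrightarrow>
            weak_solution \<mu> \<sigma> T u0 f u \<longrightarrow>
            (let N = L2norm u0;
                 F = (LINT s:{0..T}|lebesgue. (L2norm (expA ((real n - 1) * \<sigma>) (f s)))\<^sup>2)
             in \<forall>t. 0 < t \<and> t \<le> T \<longrightarrow>
                  (u t \<in> dom_expA (real n * \<sigma>) \<and>
                   (L2norm (expA (real n * \<sigma>) (u t)))\<^sup>2 \<le> K N \<mu> T \<sigma> F / t ^ p + C N \<mu> T \<sigma> F) \<and>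
                  (expA_in_L2 t T ((real n + 1) * \<sigma>) u \<and>
                   (LINT s:{t..T}|lebesgue. (L2norm (expA ((real n + 1) * \<sigma>) (u s)))\<^sup>2)
                     \<le> K' N \<mu> T \<sigma> F / t ^ q + C' N \<mu> T \<sigma> F)))"
proof (rule allI, goal_cases)
  case (1 n)
  define p where "p = level_exp n"
  \<comment> \<open>One constant serves for all four; \<open>2 ^ p\<close> comes from replacing \<open>(1 + 1 / t) ^ p\<close> by \<open>1 / t ^ p + 1\<close>.\<close>
  define C where "C N \<mu> T \<sigma> F = (2 * pi) ^ 3 * (level_const \<mu> \<sigma> (N\<^sup>2 / (2 * pi) ^ 3) (F / (2 * pi) ^ 3) n * 2 ^ p)"
    for N \<mu> T \<sigma> F :: real
  have p1: "p \<ge> 1" unfolding p_def by (cases n) auto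
  have C_bound: "(2 * pi) ^ 3 * (level_const \<mu> \<sigma> (N\<^sup>2 / (2 * pi) ^ 3) (F / (2 * pi) ^ 3) n * (1 + 1 / t) ^ level_exp n)
      \<le> C N \<mu> T \<sigma> F / t ^ p + C N \<mu> T \<sigma> F"
    if "\<mu> > 0" "F \<ge> 0" "t > 0" for N \<mu> T \<sigma> F t :: real
  proof -
    define M where "M = level_const \<mu> \<sigma> (N\<^sup>2 / (2 * pi) ^ 3) (F / (2 * pi) ^ 3) n"
    have M: "M \<ge> 0" unfolding M_def by (rule level_const_nonneg) (use that in auto)
    have "(1 + 1 / t) ^ p \<le> 2 ^ p * ((1 / t) ^ p + 1)" by (rule power_one_plus_le) (use that in simp)
    then have "(2 * pi) ^ 3 * (M * (1 + 1 / t) ^ p) \<le> (2 * pi) ^ 3 * (M * (2 ^ p * ((1 / t) ^ p + 1)))"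
      using M by (intro mult_left_mono) auto
    also have "\<dots> = C N \<mu> T \<sigma> F / t ^ p + C N \<mu> T \<sigma> F"
      unfolding C_def M_def[symmetric] by (simp add: power_one_over field_simps)
    finally show ?thesis by (simp add: M_def p_def)
  qed
  show ?case unfolding Let_def
  proof (rule exI[of _ p], rule exI[of _ p], (rule exI[of _ C])+, intro conjI allI impI)
    show "p \<ge> 1" "p \<ge> 1" by (rule p1)+
    fix \<mu> \<sigma> T :: real and u0 f u and t :: real
    assume mu: "\<mu> > 0" and \<sigma>: "\<sigma> > 0" and T: "T > 0" and u0: "u0 \<in> H_space"
      and f: "\<forall>t\<in>{0..T}. f t \<in> H_space \<and> entire_field (f t)"
      and fL: "\<forall>m::nat. expA_in_L2 0 T ((real m - 1) * \<sigma>) f"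
      and ws: "weak_solution \<mu> \<sigma> T u0 f u" and t: "0 < t \<and> t \<le> T"
    define F where "F = (LINT s:{0..T}|lebesgue. (L2norm (expA ((real n - 1) * \<sigma>) (f s)))\<^sup>2)"
    have F0: "F \<ge> 0" unfolding F_def set_integral_interval by (rule Bochner_Integration.integral_nonneg) simp
    note S = smoothing_estimates[OF ws mu \<sigma> T u0 bspec[OF f, THEN conjunct1] fL[THEN spec] t[THEN conjunct1] t[THEN conjunct2], of n, folded F_def]
    note Cb = C_bound[OF mu F0 t[THEN conjunct1], where N = "L2norm u0" and \<sigma> = \<sigma> and T = T]
    show "u t \<in> dom_expA (real n * \<sigma>)" by (rule S(1))
    show "(L2norm (expA (real n * \<sigma>) (u t)))\<^sup>2
      \<le> C (L2norm u0) \<mu> T \<sigma> (LINT s:{0..T}|lebesgue. (L2norm (expA ((real n - 1) * \<sigma>) (f s)))\<^sup>2) / t ^ p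
        + C (L2norm u0) \<mu> T \<sigma> (LINT s:{0..T}|lebesgue. (L2norm (expA ((real n - 1) * \<sigma>) (f s)))\<^sup>2)"
      unfolding F_def[symmetric] by (rule order_trans[OF S(2) Cb])
    show "expA_in_L2 t T ((real n + 1) * \<sigma>) u" by (rule S(3))
    show "(LINT s:{t..T}|lebesgue. (L2norm (expA ((real n + 1) * \<sigma>) (u s)))\<^sup>2)
      \<le> C (L2norm u0) \<mu> T \<sigma> (LINT s:{0..T}|lebesgue. (L2norm (expA ((real n - 1) * \<sigma>) (f s)))\<^sup>2) / t ^ p
        + C (L2norm u0) \<mu> T \<sigma> (LINT s:{0..T}|lebesgue. (L2norm (expA ((real n - 1) * \<sigma>) (f s)))\<^sup>2)"
      unfolding F_def[symmetric] by (rule order_trans[OF S(4) Cb])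
  qed
qed

end
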